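(* For sufficiently large $\mathcal{E}$, let $u_*$ be the unique solution in $\check{H}^2_{\rm per}(\mathbb{T})$ with $u_*'(0)<0$ of the problem of maximizing $R(u)$ over $u \in H^2_{\rm per}(\mathbb{T})$ subject to $E(u)=\mathcal{E}$. Then, as $\mathcal{E}\to\infty$, $$K(u_* ) = \frac{1}{6^{1/3}}\,\mathcal{E}^{2/3} + \mathcal{O}(\mathcal{E}^{1/3}), \qquad R(u_* ) = \frac{3^{5/3}}{5\cdot 2^{1/3}}\,\mathcal{E}^{5/3} + \mathcal{O}(\mathcal{E}^{4/3}).$$
   Context: $\mathbb{T} = [-\frac12,\frac12]$ is the unit circle (endpoints identified, periodic boundary conditions); functions are real-valued. $H^2_{\rm per}(\mathbb{T})$ is the Sobolev space of $1$-periodic functions and $\check{H}^2_{\rm per}(\mathbb{T})$ is its restriction to odd functions. For functions $u$ on $\mathbb{T}$, $$K(u) = \frac12\int_{\mathbb{T}} u^2\,dx, \qquad E(u) = \frac12 \int_{\mathbb{T}} u_x^2\,dx, \qquad R(u) = -\int_{\mathbb{T}} (u_{xx}^2 + u_x^3)\,dx.$$ For all sufficiently large $\mathcal{E}$ the maximizer $u_*$ described in the claim exists and is unique. It is associated with a parameter $k=k(\mathcal{E})\to\infty$ such that $u_*(x) = 4k(2x-\tanh(kx)) + \mathcal{O}_{L^\infty}(k^2e^{-k})$, $K(u_* ) = \frac83 k^2+\mathcal{O}(k)$, $E(u_* ) = \frac{32}{3}k^3+\mathcal{O}(k^2)$, $R(u_* ) = \frac{256}{5}k^5+\mathcal{O}(k^4)$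 as $k\to\infty$; the corollary expresses these in terms of $\mathcal{E}=E(u_* )$. $\mathcal{O}$ for error terms means bounded in absolute value by a constant times the indicated quantity in the indicated limit. *)

theory Defs
  imports "HOL-Analysis.Analysis" "HOL-Library.Landau_Symbols"
begin

definition circle :: "real set" (\<open>\<T>\<close>) where
  "\<T> = {-1/2..1/2}"

text \<open>Functions on the unit circle are represented by 1-periodic functions on the real line.\<close>

definition periodic1 :: "(real \<Rightarrow> real) \<Rightarrow> bool" where
  "periodic1 f \<longleftrightarrow> (\<forall>x. f (x + 1) = f x)"

definition L2_per :: "(real \<Rightarrow> real) set" where
  "L2_per = {f. periodic1 f \<and> f \<in> borel_measurable lebesgue \<and>
                set_integrable lebesgue \<T> (\<lambda>x. (f x)\<^sup>2)}"

definition smooth_per :: "(real \<Rightarrow> real) set" where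
  "smooth_per = {\<phi>. periodic1 \<phi> \<and> (\<forall>n x. (deriv ^^ n) \<phi> differentiable (at x))}"

definition has_weak_deriv :: "(real \<Rightarrow> real) \<Rightarrow> (real \<Rightarrow> real) \<Rightarrow> bool" where
  "has_weak_deriv f g \<longleftrightarrow>
     (\<forall>\<phi>\<in>smooth_per. (LINT x:\<T>|lebesgue. f x * deriv \<phi> x) = - (LINT x:\<T>|lebesgue. g x * \<phi> x))"

text \<open>By the Sobolev embedding every class in the periodic Sobolev space of order 2 has exactly one
  continuous representative, and that representative is continuously differentiable. Elements
  are taken to be these representatives, so that equality of functions is equality in the
  space and the value of the first derivative at a point is meaningful.\<close>

definition H2_per :: "(real \<Rightarrow> real) set" where
  "H2_per = {u \<in> L2_per. continuous_on UNIV u \<and>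
     (\<exists>v\<in>L2_per. \<exists>w\<in>L2_per. has_weak_deriv u v \<and> has_weak_deriv v w)}"

definition H2_per_odd :: "(real \<Rightarrow> real) set" where
  "H2_per_odd = {u \<in> H2_per. \<forall>x. u (- x) = - u x}"

text \<open>A weak derivative is determined only up to a null set; the integrals below do not depend on
  the chosen version.\<close>

definition weak_deriv :: "(real \<Rightarrow> real) \<Rightarrow> real \<Rightarrow> real" where
  "weak_deriv f = (SOME g. g \<in> L2_per \<and> has_weak_deriv f g)"

definition Kfun :: "(real \<Rightarrow> real) \<Rightarrow> real" where
  "Kfun u = 1/2 * (LINT x:\<T>|lebesgue. (u x)\<^sup>2)"

definition Efun :: "(real \<Rightarrow> real) \<Rightarrow> real" where
  "Efun u = 1/2 * (LINT x:\<T>|lebesgue. (weak_deriv u x)\<^sup>2)"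

definition Rfun :: "(real \<Rightarrow> real) \<Rightarrow> real" where
  "Rfun u = - (LINT x:\<T>|lebesgue. (weak_deriv (weak_deriv u) x)\<^sup>2 + (weak_deriv u x) ^ 3)"

definition is_maximizer :: "real \<Rightarrow> (real \<Rightarrow> real) \<Rightarrow> bool" where
  "is_maximizer \<E> u \<longleftrightarrow> is_arg_max Rfun (\<lambda>v. v \<in> H2_per \<and> Efun v = \<E>) u"

text \<open>The competitors range over the whole space; only the selected solution is odd.\<close>

definition is_odd_maximizer :: "real \<Rightarrow> (real \<Rightarrow> real) \<Rightarrow> bool" where
  "is_odd_maximizer \<E> u \<longleftrightarrow> is_maximizer \<E> u \<and> u \<in> H2_per_odd \<and> deriv u 0 < 0"

definition ustar :: "real \<Rightarrow> real \<Rightarrow> real" where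
  "ustar \<E> = (THE u. is_odd_maximizer \<E> u)"

end

(* With w = -u' the problem is to maximize \<integral> w^3 - \<integral> w'^2 over periodic w of mean zero with
   \<integral> w^2 = 2E. A maximizing sequence is compact in the uniform norm, and since a rescaled average of two
   near-maximizers cannot beat the supremum, the parallelogram law makes the derivatives an L^2 Cauchy
   sequence; so a maximizer exists. Its Euler-Lagrange equation is a second order equation with quadratic
   right-hand side, so w is even about each critical point, and f = w - min w satisfies
   f'^2 = f (f + p) (h - f). A period shorter than 1 is impossible, because translating a single period
   would give a maximizer with a kink. Substituting f = h cos^2, all integrals become h-powers times moments
   of the weight 1 / sqrt (cos^2 + p/h) on [0, pi/2]; the period 1 fixes h, the mean value fixes min w, and E
   is a variance-type expression that is strictly monotone in p/h. This gives uniqueness, and the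
   expansion of the moments as p/h tends to 0 gives the asymptotics. *)

theory Submission imports Defs "HOL-Complex_Analysis.Great_Picard" begin

section \<open>Periodic functions\<close>

text \<open>The functionals use an arbitrarily chosen version of a weak derivative, so much of the
  proof is regularity: du Bois-Reymond's lemma turns membership in \<open>H2_per\<close> into two
  successive primitives, after which only pairs (function, derivative) occur. The profile is an
  elliptic function, but neither it nor its modulus is ever computed. L = \<open>sqrt h\<close> is 4
  times an elliptic integral in eps = p/h, and the trivial bound 1 / sqrt eps on the integrand
  already gives p \<le> 64. The true p is exponentially small in L, yet every error caused by the
  crude bound is one power of L below the main term, which is all that the statement asks. Shorter
  periods must be excluded because several equal humps can also solve the Euler-Lagrange equation;
  the relation between h and p/h would then depend on their number. Existence and uniqueness hold
  for every positive energy; only the estimates need a lower bound on it. To leading order L = 2 k,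
  so the main terms 8/3 k^2, 32/3 k^3 and 256/5 k^5 appear as 2/3 L^2, 4/3 L^3 and 8/5 L^5.\<close>

lemma circle_lebesgue [simp, measurable]: "\<T> \<in> sets lebesgue"
  by (simp add: circle_def)

text \<open>As \<open>\<T>\<close> has length 1, integrals over it are mean values.\<close>

abbreviation mean :: "(real \<Rightarrow> real) \<Rightarrow> real" where
  "mean \<equiv> integral \<T>"

abbreviation sq :: "('a \<Rightarrow> real) \<Rightarrow> 'a \<Rightarrow> real" where
  "sq f \<equiv> \<lambda>x. (f x)\<^sup>2"

lemma LINT_circle: fixes f :: "real \<Rightarrow> real" shows "f absolutely_integrable_on \<T> \<Longrightarrow> (LINT x:\<T>|lebesgue. f x) = mean f"
  by (rule set_lebesgue_integral_eq_integral)

lemmas integral_split = Henstock_Kurzweil_Integration.integral_combine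

lemma has_integral_derivative:
  fixes F f :: "real \<Rightarrow> real"
  assumes "a \<le> b" "\<And>x. x \<in> {a..b} \<Longrightarrow> (F has_real_derivative f x) (at x within {a..b})"
  shows "(f has_integral F b - F a) {a..b}"
  using assms by (intro fundamental_theorem_of_calculus) (auto simp: has_real_derivative_iff_has_vector_derivative)

lemma continuous_on_Icc_bounded:
  fixes f :: "real \<Rightarrow> real"
  assumes "continuous_on {a..b} f"
  obtains K where "\<And>x. x \<in> {a..b} \<Longrightarrow> \<bar>f x\<bar> \<le> K"
  using compact_continuous_image[OF assms] by (metis compact_Icc compact_imp_bounded bounded_real image_eqI)

lemma derivative_of_even:
  fixes w y :: "real \<Rightarrow> real"
  assumes "\<And>x. (w has_real_derivative y x) (at x)" "\<And>x. w (- x) = w x"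
  shows "y (- x) = - y x"
proof -
  have "((\<lambda>x. w (- x)) has_real_derivative - y (- x)) (at x)"
    using assms(1)[of "-x"] by (rule DERIV_mirror[THEN iffD1])
  then have "(w has_real_derivative - y (- x)) (at x)" by (simp add: assms(2))
  from DERIV_unique[OF this assms(1)] show ?thesis by simp
qed

lemma AE_lebesgue_negligible:
  assumes "AE x in lebesgue. P x"
  obtains N where "negligible N" "\<And>x. x \<notin> N \<Longrightarrow> P x"
proof -
  from assms obtain N where "N \<in> null_sets lebesgue" "{x. \<not> P x} \<subseteq> N"
    unfolding eventually_ae_filter by auto
  then show ?thesis by (intro that[of N]) (auto simp: negligible_iff_null_sets)
qed

lemma absolutely_integrable_mult_L2:
  fixes f g :: "real \<Rightarrow> real"
  assumes "f \<in> borel_measurable lebesgue" "g \<in> borel_measurable lebesgue" "S \<in> sets lebesgue"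
    and "(sq f) absolutely_integrable_on S" "(sq g) absolutely_integrable_on S"
  shows "(\<lambda>x. f x * g x) absolutely_integrable_on S"
proof (rule measurable_bounded_by_integrable_imp_absolutely_integrable)
  show "(\<lambda>x. f x * g x) \<in> borel_measurable (lebesgue_on S)"
    using assms by (auto intro!: measurable_restrict_space1 borel_measurable_times)
  show "(\<lambda>x. (f x)\<^sup>2 + (g x)\<^sup>2) integrable_on S"
    using assms by (intro integrable_add) (auto simp: absolutely_integrable_on_def)
  show "norm (f x * g x) \<le> (f x)\<^sup>2 + (g x)\<^sup>2" for x
  proof -
    have "2 * (\<bar>f x\<bar> * \<bar>g x\<bar>) \<le> (f x)\<^sup>2 + (g x)\<^sup>2"
      using sum_squares_bound[of "\<bar>f x\<bar>" "\<bar>g x\<bar>"] by simp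
    moreover have "0 \<le> \<bar>f x\<bar> * \<bar>g x\<bar>" by simp
    ultimately show ?thesis unfolding real_norm_def abs_mult by linarith
  qed
qed (use assms in auto)

lemma integrable_on_shift1: "f integrable_on {a+c..b+c} \<Longrightarrow> (\<lambda>x. f (x + c)) integrable_on {a..b}" for f :: "real \<Rightarrow> real"
  using integrable_on_shift_cbox[of f c a b] by (simp add: o_def add.commute)

lemma integral_shift1: "integral {a..b} (\<lambda>x. f (x + c)) = integral {a+c..b+c} f" for f :: "real \<Rightarrow> real"
  using integral_shift_Icc_real[of a b f c] by (simp add: o_def add.commute)

lemma periodic1_add: "periodic1 f \<Longrightarrow> f (x + 1) = f x"
  by (simp add: periodic1_def)

lemma periodic1_of_nat: "periodic1 f \<Longrightarrow> f (x + real n) = f x"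
proof (induction n)
  case (Suc n)
  have "f (x + real (Suc n)) = f ((x + real n) + 1)" by (simp add: algebra_simps)
  with Suc show ?case by (simp add: periodic1_def)
qed simp

lemma periodic1_of_int: assumes "periodic1 f" shows "f (x + of_int n) = f x"
proof (cases "n \<ge> 0")
  case True then show ?thesis using periodic1_of_nat[OF assms, of x "nat n"] by simp
next
  case False then show ?thesis using periodic1_of_nat[OF assms, of "x + of_int n" "nat (-n)"] by simp
qed

lemma periodic1_integrable_on:
  fixes f :: "real \<Rightarrow> real"
  assumes "periodic1 f" "f integrable_on \<T>"
  shows "f integrable_on {a..b}"
proof -
  have unit: "f integrable_on {of_int n - 1/2 .. of_int n + 1/2}" for n
    using integrable_on_shift1[of f "of_int n - 1/2" "-of_int n" "of_int n + 1/2"] assms(2)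
      periodic1_of_int[OF assms(1), of _ "-n"] by (simp add: circle_def)
  have ext: "f integrable_on {of_int m - 1/2 .. of_int m + real k + 1/2}" for m k
  proof (induction k)
    case 0 show ?case using unit[of m] by simp
  next
    case (Suc k)
    have "f integrable_on {of_int m + real k + 1/2 .. of_int m + real (Suc k) + 1/2}"
      using unit[of "m + int k + 1"] by (simp add: algebra_simps)
    then show ?case
      by (intro Henstock_Kurzweil_Integration.integrable_combine[OF _ _ Suc.IH]) auto
  qed
  define m where "m = \<lfloor>a\<rfloor>"
  define k where "k = nat \<lceil>b - of_int m\<rceil>"
  have "of_int m - 1/2 \<le> a" "b \<le> of_int m + real k + 1/2"
    unfolding m_def k_def by linarith+
  then show ?thesis
    by (intro integrable_on_subinterval[OF ext[of m k]]) auto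
qed

lemma periodic1_absolutely_integrable_on:
  fixes f :: "real \<Rightarrow> real"
  assumes "periodic1 f" "f absolutely_integrable_on \<T>"
  shows "f absolutely_integrable_on {a..b}"
  using assms periodic1_integrable_on[of f a b] periodic1_integrable_on[of "\<lambda>x. norm (f x)" a b]
  by (auto simp: absolutely_integrable_on_def periodic1_def)

lemma periodic1_integral:
  fixes f :: "real \<Rightarrow> real"
  assumes "periodic1 f" "f integrable_on \<T>"
  shows "integral {a..a+1} f = mean f"
proof -
  note int = periodic1_integrable_on[OF assms]
  \<comment> \<open>The half-integer in [a, a + 1]: \<open>{c..c+1}\<close> is an integer translate
    of the circle, and the piece from a to c moves by 1 onto its end.\<close>
  define c where "c = of_int \<lceil>a + 1/2\<rceil> - (1/2 :: real)"
  have c: "a \<le> c" "c \<le> a + 1" unfolding c_def by linarith+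
  have "integral {a..c} f = integral {a..c} (\<lambda>x. f (x + 1))"
    using assms(1) by (simp add: periodic1_def)
  also have "\<dots> = integral {a+1..c+1} f" by (rule integral_shift1)
  finally have "integral {a..a+1} f = integral {c..c+1} f"
    using c integral_split[of a c "a+1" f]
      integral_split[of c "a+1" "c+1" f] int by simp
  also have "\<dots> = mean (\<lambda>x. f (x + of_int \<lceil>a + 1/2\<rceil>))"
    unfolding circle_def by (subst integral_shift1) (simp add: c_def algebra_simps)
  finally show ?thesis using periodic1_of_int[OF assms(1)] by simp
qed

section \<open>Smooth periodic functions and weak derivatives\<close>

lemma smooth_per_deriv:
  assumes "\<phi> \<in> smooth_per"
  shows "(\<phi> has_real_derivative deriv \<phi> x) (at x)" "deriv \<phi> \<in> smooth_per"
    "continuous_on S \<phi>" "periodic1 \<phi>"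
proof -
  have d: "\<And>n x. (deriv ^^ n) \<phi> differentiable (at x)" and per: "periodic1 \<phi>"
    using assms by (auto simp: smooth_per_def)
  show D: "(\<phi> has_real_derivative deriv \<phi> x) (at x)" for x
    using d[of 0 x] by (simp add: DERIV_deriv_iff_real_differentiable)
  show "continuous_on S \<phi>"
    using D by (intro continuous_at_imp_continuous_on) (auto intro: DERIV_isCont)
  have shift: "((\<lambda>x. \<phi> (x + 1)) has_real_derivative deriv \<phi> (x + 1)) (at x)" for x
    using D[of "x+1"] by (rule DERIV_shift[THEN iffD1])
  then have "deriv \<phi> (x + 1) = deriv \<phi> x" for x
  proof -
    have "(\<lambda>x. \<phi> (x + 1)) = \<phi>" using per by (auto simp: periodic1_def)
    then have "(\<phi> has_real_derivative deriv \<phi> (x + 1)) (at x)" using shift[of x] by simp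
    then show ?thesis using D[of x] by (rule DERIV_unique)
  qed
  then show "deriv \<phi> \<in> smooth_per"
    using d[of "Suc _"] by (auto simp: smooth_per_def periodic1_def funpow_swap1)
  show "periodic1 \<phi>" by fact
qed

section \<open>Trigonometric polynomials as test functions\<close>

inductive trig_poly :: "(real \<Rightarrow> real) \<Rightarrow> bool" where
  const: "trig_poly (\<lambda>x. c)"
| cos: "trig_poly (\<lambda>x. cos (2 * pi * x))"
| sin: "trig_poly (\<lambda>x. sin (2 * pi * x))"
| add: "trig_poly f \<Longrightarrow> trig_poly g \<Longrightarrow> trig_poly (\<lambda>x. f x + g x)"
| mult: "trig_poly f \<Longrightarrow> trig_poly g \<Longrightarrow> trig_poly (\<lambda>x. f x * g x)"

lemma trig_poly_DERIV: "trig_poly f \<Longrightarrow> \<exists>f'. trig_poly f' \<and> (\<forall>x. (f has_real_derivative f' x) (at x))"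
proof (induction rule: trig_poly.induct)
  case (const c)
  show ?case by (rule exI[of _ "\<lambda>x. 0"]) (auto intro: trig_poly.const)
next
  case cos
  show ?case
  proof (intro exI[of _ "\<lambda>x. (- 2 * pi) * sin (2 * pi * x)"] conjI)
    show "trig_poly (\<lambda>x. (- 2 * pi) * sin (2 * pi * x))" by (rule trig_poly.mult[OF trig_poly.const trig_poly.sin])
  qed (auto intro!: derivative_eq_intros)
next
  case sin
  show ?case
  proof (intro exI[of _ "\<lambda>x. (2 * pi) * cos (2 * pi * x)"] conjI)
    show "trig_poly (\<lambda>x. (2 * pi) * cos (2 * pi * x))" by (rule trig_poly.mult[OF trig_poly.const trig_poly.cos])
  qed (auto intro!: derivative_eq_intros)
next
  case (add f g)
  then obtain f' g' where "trig_poly f'" "trig_poly g'" "\<forall>x. (f has_real_derivative f' x) (at x)"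
    "\<forall>x. (g has_real_derivative g' x) (at x)" by auto
  then show ?case
    by (intro exI[of _ "\<lambda>x. f' x + g' x"]) (auto intro!: trig_poly.intros derivative_eq_intros)
next
  case (mult f g)
  then obtain f' g' where "trig_poly f'" "trig_poly g'" "\<forall>x. (f has_real_derivative f' x) (at x)"
    "\<forall>x. (g has_real_derivative g' x) (at x)" by auto
  then show ?case using mult.hyps
    by (intro exI[of _ "\<lambda>x. f' x * g x + g' x * f x"]) (auto intro!: trig_poly.intros derivative_eq_intros)
qed

lemma trig_poly_smooth_per:
  assumes "trig_poly f" shows "f \<in> smooth_per"
proof -
  have "trig_poly ((deriv ^^ n) f)" for n
  proof (induction n)
    case (Suc n)
    then obtain f' where "trig_poly f'" "\<forall>x. ((deriv ^^ n) f has_real_derivative f' x) (at x)"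
      using trig_poly_DERIV by blast
    then have "deriv ((deriv ^^ n) f) = f'" by (intro ext DERIV_imp_deriv) auto
    with \<open>trig_poly f'\<close> show ?case by simp
  qed (use assms in auto)
  then have "(deriv ^^ n) f differentiable (at x)" for n x
    using trig_poly_DERIV real_differentiable_def by blast
  moreover have "periodic1 f" using assms
    by (induction rule: trig_poly.induct) (auto simp: periodic1_def distrib_left)
  ultimately show ?thesis by (simp add: smooth_per_def)
qed

lemma trig_poly_real_polynomial_function:
  fixes p :: "complex \<Rightarrow> real"
  assumes "real_polynomial_function p"
  shows "trig_poly (\<lambda>x. p (cis (2 * pi * x)))"
  using assms
proof (induction rule: real_polynomial_function.induct)
  case (linear f)
  interpret bounded_linear f by fact
  have "f (cis t) = f 1 * cos t + f \<i> * sin t" for t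
  proof -
    have "cis t = cos t *\<^sub>R 1 + sin t *\<^sub>R \<i>" by (simp add: complex_eq_iff)
    then show ?thesis by (simp only: add scaleR) (simp add: mult.commute)
  qed
  then show ?case by (auto intro!: trig_poly.intros)
qed (auto intro!: trig_poly.intros)

text \<open>Stone-Weierstrass on the complex unit circle, to which \<open>\<psi>\<close> is carried
  by \<open>Arg\<close>. The zero values at both ends of the interval make the carried function
  continuous across the cut at -1; a real polynomial in the point \<open>cis (2 * pi * x)\<close> is
  a trigonometric polynomial in x.\<close>

lemma smooth_per_approx:
  fixes \<psi> :: "real \<Rightarrow> real"
  assumes "continuous_on \<T> \<psi>" "\<psi> (-1/2) = 0" "\<psi> (1/2) = 0" "e > 0"
  obtains \<phi> where "\<phi> \<in> smooth_per" "\<And>x. x \<in> \<T> \<Longrightarrow> \<bar>\<psi> x - \<phi> x\<bar> < e"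
proof -
  define f where "f = (\<lambda>z. \<psi> (Arg z / (2 * pi)))"
  have Arg_T: "Arg z / (2 * pi) \<in> \<T>" for z
    using Arg_bounded[of z] by (auto simp: circle_def field_simps)
  have cont: "continuous (at z within sphere 0 1) f" if z: "z \<in> sphere 0 1" for z
  proof (cases "z = -1")
    case False
    have nz: "z \<notin> \<real>\<^sub>\<le>\<^sub>0" 
    proof
      assume "z \<in> \<real>\<^sub>\<le>\<^sub>0"
      then obtain r where "z = of_real r" "r \<le> 0" by (auto elim: nonpos_Reals_cases)
      with z False show False by auto
    qed
    have "continuous (at z within sphere 0 1) (\<lambda>z. Arg z / (2 * pi))"
    proof (rule continuous_divide)
      show "continuous (at z within sphere 0 1) Arg"
        by (rule continuous_at_imp_continuous_at_within[OF continuous_at_Arg[OF nz]])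
    qed auto
    moreover have "continuous (at (Arg z / (2 * pi)) within (\<lambda>z. Arg z / (2 * pi)) ` sphere 0 1) \<psi>"
    proof (rule continuous_within_subset)
      show "continuous (at (Arg z / (2 * pi)) within \<T>) \<psi>"
        using assms(1) Arg_T[of z] by (simp add: continuous_on_eq_continuous_within)
    qed (use Arg_T in blast)
    ultimately show ?thesis
      using continuous_within_compose[of z "sphere 0 1" "\<lambda>z. Arg z / (2 * pi)" \<psi>] by (simp add: f_def o_def)
  next
    case True
    have "\<forall>\<^sub>F z in at z within sphere 0 1. \<bar>f z\<bar> < r" if r: "r > 0" for r
    proof -
      from assms(1) obtain d1 where d1: "d1 > 0" "\<And>x. x \<in> \<T> \<Longrightarrow> \<bar>x - 1/2\<bar> < d1 \<Longrightarrow> \<bar>\<psi> x\<bar> < r"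
        using assms(1)[unfolded continuous_on_iff, rule_format, of "1/2" r] r assms(3)
        by (auto simp: circle_def dist_real_def)
      from assms(1) obtain d2 where d2: "d2 > 0" "\<And>x. x \<in> \<T> \<Longrightarrow> \<bar>x + 1/2\<bar> < d2 \<Longrightarrow> \<bar>\<psi> x\<bar> < r"
        using assms(1)[unfolded continuous_on_iff, rule_format, of "-1/2" r] r assms(2)
        by (auto simp: circle_def dist_real_def)
      \<comment> \<open>Near -1 the real part is below \<open>cos th\<close>, hence |Arg z| > th,
        which places Arg z / (2 pi) within d of one of the two end points.\<close>
      define d where "d = min (1/2) (min d1 d2)"
      have d: "0 < d" "d \<le> 1/2" "d \<le> d1" "d \<le> d2" using d1 d2 by (auto simp: d_def)
      define th where "th = pi - 2 * pi * d"
      have th: "0 \<le> th" "th < pi" using d by (auto simp: th_def)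
      have "(Re \<longlongrightarrow> -1) (at z within sphere 0 1)"
        using True by (auto intro!: tendsto_eq_intros)
      moreover have "-1 < cos th" using cos_monotone_0_pi[of th pi] th by simp
      ultimately have ev: "\<forall>\<^sub>F z in at z within sphere 0 1. Re z < cos th"
        by (rule order_tendstoD)
      have "\<forall>\<^sub>F z in at z within sphere 0 1. z \<in> sphere (0::complex) 1"
        by (simp add: eventually_at_filter)
      with ev show ?thesis
      proof eventually_elim
        case (elim z)
        then have "cis (Arg z) = z" using cis_Arg[of z] by (force simp: sgn_eq)
        then have "cos \<bar>Arg z\<bar> < cos th" using elim by (metis cis.sel(1) cos_abs_real)
        then have "th < \<bar>Arg z\<bar>"
          using cos_monotone_0_pi_le[of "\<bar>Arg z\<bar>" th] th by fastforce
        then have "\<bar>Arg z / (2 * pi)\<bar> > 1/2 - d"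
          by (simp add: th_def field_simps)
        then have "\<bar>Arg z / (2 * pi) - 1/2\<bar> < d \<or> \<bar>Arg z / (2 * pi) + 1/2\<bar> < d"
          using Arg_T[of z] by (auto simp: circle_def abs_if split: if_splits)
        then show ?case using d d1(2) d2(2) Arg_T[of z] unfolding f_def by fastforce
      qed
    qed
    then have "(f \<longlongrightarrow> 0) (at z within sphere 0 1)"
      by (auto simp: tendsto_iff)
    moreover have "Arg (-1) = pi" using Arg_cis[of pi] by simp
    then have "f z = 0" using True assms by (simp add: f_def)
    ultimately show ?thesis by (simp add: continuous_within)
  qed
  then have "continuous_on (sphere 0 1) f"
    by (simp add: continuous_on_eq_continuous_within)
  then obtain g where g: "real_polynomial_function g" "\<And>z. z \<in> sphere 0 1 \<Longrightarrow> \<bar>f z - g z\<bar> < e"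
    using Stone_Weierstrass_real_polynomial_function[of "sphere (0::complex) 1" f e] \<open>e > 0\<close> by auto
  have "\<bar>\<psi> x - g (cis (2 * pi * x))\<bar> < e" if "x \<in> \<T>" for x
  proof (cases "x = -1/2")
    case True
    then have "cis (2 * pi * x) = -1" by (simp add: complex_eq_iff)
    moreover have "Arg (-1) = pi" using Arg_cis[of pi] by simp
    ultimately show ?thesis using g(2)[of "-1"] True assms by (simp add: f_def)
  next
    case False
    with that have "-1 < 2 * x" "2 * x \<le> 1" by (auto simp: circle_def)
    then have "pi * (-1) < pi * (2 * x)" "pi * (2 * x) \<le> pi * 1"
      by (intro mult_strict_left_mono mult_left_mono; simp)+
    then have "-pi < 2 * pi * x" "2 * pi * x \<le> pi" by (simp_all add: mult.assoc mult.left_commute)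
    then have "f (cis (2 * pi * x)) = \<psi> x"
      by (simp add: f_def Arg_cis)
    with g(2)[of "cis (2 * pi * x)"] show ?thesis by simp
  qed
  then show ?thesis
    using that trig_poly_smooth_per[OF trig_poly_real_polynomial_function[OF g(1)]] by blast
qed


lemma smooth_perI:
  assumes f: "\<And>x. (f has_real_derivative g x) (at x)" and g: "g \<in> smooth_per" and "periodic1 f"
  shows "f \<in> smooth_per" "deriv f = g"
proof -
  show eq: "deriv f = g" using f by (intro ext DERIV_imp_deriv)
  have "(deriv ^^ n) f differentiable (at x)" for n x
  proof (cases n)
    case 0 then show ?thesis using f real_differentiable_def by auto
  next
    case (Suc m)
    then have "(deriv ^^ n) f = (deriv ^^ m) g" by (simp add: funpow_Suc_right eq del: funpow.simps)
    then show ?thesis using g by (simp add: smooth_per_def)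
  qed
  then show "f \<in> smooth_per" using assms(3) by (simp add: smooth_per_def)
qed

lemma smooth_per_diff_const:
  assumes s: "\<phi> \<in> smooth_per"
  shows "(\<lambda>x. \<phi> x - c) \<in> smooth_per \<and> deriv (\<lambda>x. \<phi> x - c) = deriv \<phi>"
proof -
  have "((\<lambda>x. \<phi> x - c) has_real_derivative deriv \<phi> x) (at x)" for x
    using smooth_per_deriv(1)[OF s, of x] by (auto intro!: derivative_eq_intros)
  moreover have "periodic1 (\<lambda>x. \<phi> x - c)" using smooth_per_deriv(4)[OF s] by (simp add: periodic1_def)
  ultimately show ?thesis using smooth_perI[OF _ smooth_per_deriv(2)[OF s]] by blast
qed

lemma smooth_per_1: "(\<lambda>x. 1) \<in> smooth_per"
  by (intro trig_poly_smooth_per trig_poly.const)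

lemma absolutely_integrable_mult_cont:
  fixes z \<phi> :: "real \<Rightarrow> real"
  assumes "z absolutely_integrable_on {a..b}" "continuous_on {a..b} \<phi>"
  shows "(\<lambda>x. z x * \<phi> x) absolutely_integrable_on {a..b}"
proof -
  have "(\<lambda>x. \<phi> x * z x) absolutely_integrable_on {a..b}"
  proof (rule absolutely_integrable_bounded_measurable_product_real)
    show "\<phi> \<in> borel_measurable (lebesgue_on {a..b})"
      using assms(2) by (intro continuous_imp_measurable_on_sets_lebesgue) auto
    show "bounded (\<phi> ` {a..b})"
      using assms(2) by (intro compact_imp_bounded compact_continuous_image) auto
  qed (use assms in auto)
  then show ?thesis by (simp add: mult.commute)
qed

text \<open>Smooth functions bounded by 2 converge almost everywhere to the sign of h, so dominated
  convergence turns the orthogonality into \<integral> |h| = 0.\<close>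

lemma smooth_per_separates:
  fixes h :: "real \<Rightarrow> real"
  assumes h: "h absolutely_integrable_on \<T>"
    and ortho: "\<And>\<phi>. \<phi> \<in> smooth_per \<Longrightarrow> mean (\<lambda>x. h x * \<phi> x) = 0"
  shows "AE x in lebesgue. x \<in> \<T> \<longrightarrow> h x = 0"
proof -
  have hm: "h \<in> borel_measurable (lebesgue_on \<T>)"
    by (rule absolutely_integrable_imp_borel_measurable[OF h circle_lebesgue])
  then have "(\<lambda>x. sgn (h x)) \<in> borel_measurable (lebesgue_on \<T>)"
    by measurable
  then have "(\<lambda>x. sgn (h x)) measurable_on \<T>"
    by (simp add: measurable_on_iff_borel_measurable)
  then obtain N g where N: "negligible N" and g: "\<And>n. continuous_on UNIV (g n)"
    and lim: "\<And>x. x \<notin> N \<Longrightarrow> (\<lambda>n. g n x) \<longlonglongrightarrow> (if x \<in> \<T> then sgn (h x) else 0)"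
    unfolding measurable_on_def by blast
  \<comment> \<open>\<open>g n\<close> comes from the definition of measurability and may be
    unbounded: clipping gives a uniform bound. The second factor tends to 1 inside the circle and
    forces the zero end values that the approximation requires.\<close>
  define \<psi> where "\<psi> n x = max (-1) (min 1 (g n x)) * min 1 (real n * (1/2 - \<bar>x\<bar>))" for n :: nat and x :: real
  have "\<exists>\<phi>. \<phi> \<in> smooth_per \<and> (\<forall>x\<in>\<T>. \<bar>\<psi> n x - \<phi> x\<bar> < inverse (real (Suc n)))" for n
  proof -
    have "continuous_on \<T> (\<psi> n)" unfolding \<psi>_def
      by (intro continuous_intros continuous_on_subset[OF g]) auto
    moreover have "\<psi> n (-1/2) = 0" "\<psi> n (1/2) = 0" by (auto simp: \<psi>_def)
    moreover have "0 < inverse (real (Suc n))" by simp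
    ultimately show ?thesis by (rule smooth_per_approx) blast
  qed
  then obtain \<phi> where \<phi>: "\<And>n. \<phi> n \<in> smooth_per"
    and close: "\<And>n x. x \<in> \<T> \<Longrightarrow> \<bar>\<psi> n x - \<phi> n x\<bar> < inverse (real (Suc n))"
    by metis
  have bound: "\<bar>\<phi> n x\<bar> \<le> 2" if "x \<in> \<T>" for n x
  proof -
    have "\<bar>\<psi> n x\<bar> \<le> 1 * 1" unfolding \<psi>_def abs_mult
      using that by (intro mult_mono) (auto simp: circle_def)
    moreover have "inverse (real (Suc n)) \<le> 1" by (simp add: field_simps)
    ultimately show ?thesis using close[OF that, of n] by linarith
  qed
  have conv: "(\<lambda>n. \<phi> n x) \<longlonglongrightarrow> sgn (h x)" if x: "x \<in> \<T>" "x \<notin> N" "\<bar>x\<bar> \<noteq> 1/2" for x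
  proof -
    have pos: "1/2 - \<bar>x\<bar> > 0" using x by (auto simp: circle_def)
    have "\<forall>\<^sub>F n in sequentially. 1 / (1/2 - \<bar>x\<bar>) \<le> real n"
      using filterlim_real_sequentially by (simp add: filterlim_at_top)
    then have "\<forall>\<^sub>F n in sequentially. max (-1) (min 1 (g n x)) = \<psi> n x"
      by eventually_elim (use pos in \<open>simp add: \<psi>_def field_simps min_def\<close>)
    moreover have "(\<lambda>n. max (-1) (min 1 (g n x))) \<longlonglongrightarrow> max (-1) (min 1 (sgn (h x)))"
      using lim[OF x(2)] x(1) by (intro tendsto_intros) auto
    moreover have "max (-1) (min 1 (sgn (h x))) = sgn (h x)" by (auto simp: sgn_if)
    ultimately have 1: "(\<lambda>n. \<psi> n x) \<longlonglongrightarrow> sgn (h x)"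
      by (simp add: tendsto_cong)
    have "(\<lambda>n. \<psi> n x - \<phi> n x) \<longlonglongrightarrow> 0"
      by (rule Lim_null_comparison[OF _ LIMSEQ_inverse_real_of_nat])
        (use close[OF x(1)] in \<open>auto intro!: always_eventually less_imp_le\<close>)
    from tendsto_diff[OF 1 this] show ?thesis by simp
  qed
  let ?s = "\<lambda>n x. indicator \<T> x * (h x * \<phi> n x)"
  have hint: "integrable lebesgue (\<lambda>x. indicator \<T> x * h x)"
    using h by (simp add: set_integrable_def)
  have meas: "(\<lambda>x. indicator \<T> x * h x) \<in> borel_measurable lebesgue"
    using hint by (rule borel_measurable_integrable)
  have prodint: "(\<lambda>x. h x * \<phi> n x) absolutely_integrable_on \<T>" for n
    unfolding circle_def using h smooth_per_deriv(3)[OF \<phi>]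
    by (intro absolutely_integrable_mult_cont) (auto simp: circle_def)
  have "(\<lambda>n. integral\<^sup>L lebesgue (?s n)) \<longlonglongrightarrow> integral\<^sup>L lebesgue (\<lambda>x. \<bar>indicator \<T> x * h x\<bar>)"
  proof (rule integral_dominated_convergence)
    show "(\<lambda>x. \<bar>indicator \<T> x * h x\<bar>) \<in> borel_measurable lebesgue"
      using meas by measurable
    show "?s n \<in> borel_measurable lebesgue" for n
      using prodint[of n] by (auto simp: set_integrable_def dest: borel_measurable_integrable)
    show "integrable lebesgue (\<lambda>x. 2 * \<bar>indicator \<T> x * h x\<bar>)"
      using hint by auto
    have "negligible (N \<union> {1/2, -1/2})" using N by (intro negligible_Un) auto
    then have "AE x in lebesgue. x \<notin> N \<union> {1/2, -1/2}"
      by (intro AE_not_in) (simp add: negligible_iff_null_sets)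
    then show "AE x in lebesgue. (\<lambda>n. ?s n x) \<longlonglongrightarrow> \<bar>indicator \<T> x * h x\<bar>"
    proof eventually_elim
      case (elim x)
      show ?case
      proof (cases "x \<in> \<T>")
        case True
        then have "(\<lambda>n. h x * \<phi> n x) \<longlonglongrightarrow> h x * sgn (h x)"
          using elim by (intro tendsto_intros conv) auto
        then show ?thesis using True by (simp add: abs_sgn[symmetric])
      qed simp
    qed
    show "AE x in lebesgue. norm (?s n x) \<le> 2 * \<bar>indicator \<T> x * h x\<bar>" for n
      using bound[of _ n]
      by (intro AE_I2) (auto simp: indicator_def abs_mult mult.commute[of 2] intro!: mult_left_mono)
  qed
  moreover have "integral\<^sup>L lebesgue (?s n) = 0" for n
    using LINT_circle[OF prodint[of n]] ortho[OF \<phi>[of n]] by (simp add: set_lebesgue_integral_def)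
  ultimately have "integral\<^sup>L lebesgue (\<lambda>x. \<bar>indicator \<T> x * h x\<bar>) = 0"
    by (simp add: LIMSEQ_const_iff)
  then have "AE x in lebesgue. \<bar>indicator \<T> x * h x\<bar> = 0"
    using hint by (subst (asm) integral_nonneg_eq_0_iff_AE) auto
  then show ?thesis by eventually_elim (auto simp: indicator_def split: if_splits)
qed

section \<open>Absolutely continuous periodic functions and integration by parts\<close>

text \<open>The pair \<open>(w, z)\<close> represents an element of the periodic Sobolev space of order 1:
  \<open>w\<close> is the absolutely continuous representative and \<open>z\<close> its derivative.\<close>

definition H1 :: "(real \<Rightarrow> real) \<Rightarrow> (real \<Rightarrow> real) \<Rightarrow> bool" where
  "H1 w z \<longleftrightarrow> periodic1 w \<and> z \<in> L2_per \<and> (\<forall>x y. x \<le> y \<longrightarrow> (z has_integral w y - w x) {x..y})"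

lemma abs_integral_le:
  fixes f g :: "real \<Rightarrow> real"
  assumes "f integrable_on S" "g integrable_on S" "\<And>x. x \<in> S \<Longrightarrow> \<bar>f x\<bar> \<le> g x"
  shows "\<bar>integral S f\<bar> \<le> integral S g"
  using integral_norm_bound_integral[of f S g] assms by simp

lemma L2_perD:
  assumes "z \<in> L2_per"
  shows "periodic1 z" "z \<in> borel_measurable lebesgue" "sq z absolutely_integrable_on \<T>"
    "z absolutely_integrable_on \<T>" "z absolutely_integrable_on {a..b}"
    "sq z absolutely_integrable_on {a..b}"
proof -
  show *: "periodic1 z" "z \<in> borel_measurable lebesgue" "sq z absolutely_integrable_on \<T>"
    using assms by (auto simp: L2_per_def)
  show z: "z absolutely_integrable_on \<T>"
    using absolutely_integrable_mult_L2[of z "\<lambda>x. 1" "\<T>"] * by (simp add: circle_def)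
  show "z absolutely_integrable_on {a..b}"
    by (rule periodic1_absolutely_integrable_on[OF *(1) z])
  show "sq z absolutely_integrable_on {a..b}"
    using * by (intro periodic1_absolutely_integrable_on) (auto simp: periodic1_def)
qed

lemma L2_per_mult:
  assumes "f \<in> L2_per" "g \<in> L2_per"
  shows "(\<lambda>x. f x * g x) absolutely_integrable_on \<T>"
  using L2_perD[OF assms(1)] L2_perD[OF assms(2)] by (intro absolutely_integrable_mult_L2) auto

lemma continuous_L2_per:
  assumes "periodic1 f" "continuous_on UNIV f"
  shows "f \<in> L2_per"
proof -
  have "continuous_on {-1/2..1/2} (sq f)"
    by (intro continuous_intros continuous_on_subset[OF assms(2)]) auto
  then have "(sq f) absolutely_integrable_on \<T>"
    unfolding circle_def by (rule absolutely_integrable_continuous_real)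
  moreover have "f \<in> borel_measurable lborel"
    using borel_measurable_continuous_onI[OF assms(2)] by simp
  then have "f \<in> borel_measurable lebesgue" by (rule measurable_completion)
  ultimately show ?thesis using assms by (simp add: L2_per_def)
qed

lemma smooth_per_L2_per: "\<phi> \<in> smooth_per \<Longrightarrow> \<phi> \<in> L2_per"
  using smooth_per_deriv continuous_L2_per by blast

lemma L2_per_add: "f \<in> L2_per \<Longrightarrow> g \<in> L2_per \<Longrightarrow> (\<lambda>x. f x + g x) \<in> L2_per"
proof -
  assume fg: "f \<in> L2_per" "g \<in> L2_per"
  have "(\<lambda>x. (f x)\<^sup>2 + 2 * (f x * g x) + (g x)\<^sup>2) absolutely_integrable_on \<T>"
    using L2_perD[OF fg(1)] L2_perD[OF fg(2)] L2_per_mult[OF fg]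
    by (intro set_integral_add set_integrable_mult_right) auto
  moreover have "(f x)\<^sup>2 + 2 * (f x * g x) + (g x)\<^sup>2 = (f x + g x)\<^sup>2" for x
    by (simp add: power2_eq_square algebra_simps)
  ultimately show ?thesis using L2_perD[OF fg(1)] L2_perD[OF fg(2)]
    by (auto simp: L2_per_def periodic1_def intro!: borel_measurable_add)
qed

lemma L2_per_cmult: "f \<in> L2_per \<Longrightarrow> (\<lambda>x. c * f x) \<in> L2_per"
  by (auto simp: L2_per_def periodic1_def power_mult_distrib)

lemma L2_per_diff: "f \<in> L2_per \<Longrightarrow> g \<in> L2_per \<Longrightarrow> (\<lambda>x. f x - g x) \<in> L2_per"
  using L2_per_add[of f "\<lambda>x. -1 * g x"] L2_per_cmult[of g "-1"] by simp

lemma primitive_continuous: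
  fixes w z :: "real \<Rightarrow> real"
  assumes "\<And>x. a \<le> x \<Longrightarrow> x \<le> b \<Longrightarrow> (z has_integral w x - w a) {a..x}"
  shows "continuous_on {a..b} w"
proof (cases "a \<le> b")
  case True
  have "continuous_on {a..b} (\<lambda>x. w a + integral {a..x} z)"
    using assms[OF True] by (intro continuous_intros indefinite_integral_continuous_1) (auto simp: integrable_on_def)
  then show ?thesis
    by (rule continuous_on_eq) (simp add: integral_unique[OF assms])
qed auto

lemma H1_continuous:
  assumes "\<And>x y. x \<le> y \<Longrightarrow> (z has_integral w y - w x) {x..y :: real}"
  shows "continuous_on S (w :: real \<Rightarrow> real)"
proof -
  have "continuous_on {a..b} w" for a b
    by (rule primitive_continuous[of a b z]) (rule assms)
  then have "continuous_on {x-1<..<x+1} w" for x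
    using continuous_on_subset[of "{x-1..x+1}" w "{x-1<..<x+1}"] by force
  then have "isCont w x" for x
    using continuous_on_interior[of "{x-1<..<x+1}" w x] by simp
  then show ?thesis by (simp add: continuous_at_imp_continuous_on)
qed

lemma H1D:
  assumes "H1 w z"
  shows "periodic1 w" "z \<in> L2_per" "x \<le> y \<Longrightarrow> (z has_integral w y - w x) {x..y}"
    "continuous_on S w" "w \<in> L2_per" "mean z = 0"
proof -
  show *: "periodic1 w" "z \<in> L2_per"
    using assms by (auto simp: H1_def)
  have int: "\<And>x y. x \<le> y \<Longrightarrow> (z has_integral w y - w x) {x..y}"
    using assms by (auto simp: H1_def)
  show "x \<le> y \<Longrightarrow> (z has_integral w y - w x) {x..y}" by (rule int)
  have cont: "continuous_on S w" for S by (rule H1_continuous[OF int])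
  show "continuous_on S w" by (rule cont)
  show "w \<in> L2_per" by (rule continuous_L2_per[OF *(1) cont])
  show "mean z = 0"
    using int[of "-1/2" "1/2"] periodic1_add[OF *(1), of "-1/2"]
    by (simp add: circle_def integral_unique)
qed

text \<open>Integration by parts without differentiating w almost everywhere. The defect F satisfies
  |F y - F x| \<le> 2 C |y - x| |A y - A x| with A the primitive of |z|; as A is continuous, F has
  derivative 0 at every point.\<close>

lemma absolutely_continuous_mult_C1:
  fixes w z \<phi> \<phi>' :: "real \<Rightarrow> real"
  assumes z: "z absolutely_integrable_on {a..b}"
    and w: "\<And>x y. a \<le> x \<Longrightarrow> x \<le> y \<Longrightarrow> y \<le> b \<Longrightarrow> (z has_integral w y - w x) {x..y}"
    and \<phi>: "\<And>x. x \<in> {a..b} \<Longrightarrow> (\<phi> has_real_derivative \<phi>' x) (at x within {a..b})"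
    and \<phi>': "continuous_on {a..b} \<phi>'" and "a \<le> b"
  shows "((\<lambda>x. z x * \<phi> x + w x * \<phi>' x) has_integral w b * \<phi> b - w a * \<phi> a) {a..b}"
proof -
  have \<phi>c: "continuous_on {a..b} \<phi>" using \<phi> by (rule DERIV_continuous_on)
  have wc: "continuous_on {a..b} w"
    by (rule primitive_continuous[of a b z]) (use w in auto)
  let ?f = "\<lambda>x. z x * \<phi> x + w x * \<phi>' x"
  have fint: "?f integrable_on {a..b}"
    using absolutely_integrable_mult_cont[OF z \<phi>c] wc \<phi>'
    by (intro integrable_add[OF _ integrable_continuous_real] continuous_on_mult) (auto simp: absolutely_integrable_on_def)
  have nz: "(\<lambda>x. \<bar>z x\<bar>) integrable_on {a..b}" using z by (auto simp: absolutely_integrable_on_def)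
  define F where "F x = w x * \<phi> x - integral {a..x} ?f" for x
  define A where "A x = integral {a..x} (\<lambda>x. \<bar>z x\<bar>)" for x
  have Ac: "continuous_on {a..b} A" unfolding A_def
    by (rule indefinite_integral_continuous_1[OF nz])
  obtain C where C: "\<And>x. x \<in> {a..b} \<Longrightarrow> \<bar>\<phi>' x\<bar> \<le> C"
    using continuous_on_Icc_bounded[OF \<phi>'] by blast
  have C0: "C \<ge> 0" using C[of a] \<open>a \<le> b\<close> by (smt (verit) atLeastAtMost_iff)
  have est: "\<bar>F y - F x\<bar> \<le> 2 * C * (y - x) * (A y - A x)" if "a \<le> x" "x \<le> y" "y \<le> b" for x y
  proof -
    have sub: "{x..y} \<subseteq> {a..b}" using that by auto
    have fi: "?f integrable_on {x..y}" using fint sub integrable_on_subinterval by blast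
    have nzi: "(\<lambda>x. \<bar>z x\<bar>) integrable_on {x..y}" using nz sub integrable_on_subinterval by blast
    have Axy: "A y - A x = integral {x..y} (\<lambda>x. \<bar>z x\<bar>)"
      using integral_split[of a x y "\<lambda>x. \<bar>z x\<bar>"] that
        integrable_on_subinterval[OF nz, of a y] by (auto simp: A_def)
    have wb: "\<bar>w t - w x\<bar> \<le> A y - A x" if "t \<in> {x..y}" for t
    proof -
      have "w t - w x = integral {x..t} z" using w[of x t] that sub \<open>a \<le> x\<close> by (auto simp: integral_unique)
      also have "\<bar>\<dots>\<bar> \<le> integral {x..t} (\<lambda>x. \<bar>z x\<bar>)"
        using that sub \<open>a \<le> x\<close> w[of x t] integrable_on_subinterval[OF nz, of x t]
        by (intro abs_integral_le)  (auto simp: integrable_on_def)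
      also have "\<dots> \<le> A y - A x" unfolding Axy
        using that sub integrable_on_subinterval[OF nz, of x t] nzi by (intro integral_subset_le) auto
      finally show ?thesis .
    qed
    have pb: "\<bar>\<phi> y - \<phi> t\<bar> \<le> C * (y - x)" if t: "t \<in> {x..y}" for t
    proof -
      have "norm (\<phi> y - \<phi> t) \<le> C * norm (y - t)"
        using t sub C \<phi> by (intro field_differentiable_bound[of "{a..b}" \<phi> \<phi>']) auto
      also have "\<dots> \<le> C * (y - x)" using t C0 by (intro mult_left_mono) auto
      finally show ?thesis by simp
    qed
    have zi: "(z has_integral w y - w x) {x..y}" using w that by auto
    have "(\<phi>' has_integral \<phi> y - \<phi> x) {x..y}"
      using that \<phi> sub
      by (intro has_integral_derivative) (auto intro: DERIV_subset[OF _ sub])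
    then have "((\<lambda>t. w x * \<phi>' t) has_integral w x * (\<phi> y - \<phi> x)) {x..y}"
      by (rule has_integral_mult_right)
    moreover have "((\<lambda>t. z t * \<phi> y) has_integral (w y - w x) * \<phi> y) {x..y}"
      using zi by (rule has_integral_mult_left)
    ultimately have "((\<lambda>t. z t * \<phi> y + w x * \<phi>' t) has_integral (w y - w x) * \<phi> y + w x * (\<phi> y - \<phi> x)) {x..y}"
      by (rule has_integral_add[rotated])
    then have 1: "((\<lambda>t. z t * \<phi> y + w x * \<phi>' t) has_integral w y * \<phi> y - w x * \<phi> x) {x..y}"
      by (simp add: algebra_simps)
    have "F y - F x = (w y * \<phi> y - w x * \<phi> x) - integral {x..y} ?f"
      using integral_split[of a x y ?f] that
        integrable_on_subinterval[OF fint, of a y] by (auto simp: F_def)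
    then have 2: "((\<lambda>t. z t * \<phi> y + w x * \<phi>' t - ?f t) has_integral F y - F x) {x..y}"
      using has_integral_diff[OF 1 integrable_integral[OF fi]] by simp
    have "\<bar>F y - F x\<bar> = \<bar>integral {x..y} (\<lambda>t. z t * \<phi> y + w x * \<phi>' t - ?f t)\<bar>"
      using integral_unique[OF 2] by simp
    also have "\<dots> \<le> integral {x..y} (\<lambda>t. C * (y - x) * \<bar>z t\<bar> + C * (A y - A x))"
    proof (rule abs_integral_le)
      show "\<bar>z t * \<phi> y + w x * \<phi>' t - ?f t\<bar> \<le> C * (y - x) * \<bar>z t\<bar> + C * (A y - A x)" if t: "t \<in> {x..y}" for t
      proof -
        have "z t * \<phi> y + w x * \<phi>' t - ?f t = z t * (\<phi> y - \<phi> t) - \<phi>' t * (w t - w x)" by algebra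
        also have "\<bar>\<dots>\<bar> \<le> \<bar>z t\<bar> * \<bar>\<phi> y - \<phi> t\<bar> + \<bar>\<phi>' t\<bar> * \<bar>w t - w x\<bar>"
          by (metis abs_mult abs_triangle_ineq4)
        also have "\<dots> \<le> \<bar>z t\<bar> * (C * (y - x)) + C * (A y - A x)"
          using pb[OF t] wb[OF t] C[of t] t sub C0 by (intro add_mono mult_mono mult_left_mono) auto
        finally show ?thesis by (simp add: mult.commute)
      qed
      show "(\<lambda>t. C * (y - x) * \<bar>z t\<bar> + C * (A y - A x)) integrable_on {x..y}"
        using nzi by (intro integrable_add integrable_on_mult_right) auto
    qed (use 2 in \<open>auto simp: integrable_on_def\<close>)
    also have "\<dots> = C * (y - x) * (A y - A x) + C * (A y - A x) * (y - x)"
      using nzi that by (subst integral_add) (auto simp: Axy intro: integrable_on_mult_right)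
    finally show ?thesis by (simp add: algebra_simps)
  qed
  have est': "\<bar>F y - F x\<bar> \<le> 2 * C * \<bar>y - x\<bar> * \<bar>A y - A x\<bar>" if "x \<in> {a..b}" "y \<in> {a..b}" for x y
  proof (cases "x \<le> y")
    case True
    have "2 * C * (y - x) * (A y - A x) \<le> 2 * C * \<bar>y - x\<bar> * \<bar>A y - A x\<bar>"
      using True C0 mult_left_mono[OF abs_ge_self[of "A y - A x"], of "2 * C * (y - x)"] by simp
    then show ?thesis using est[of x y] True that by simp
  next
    case False
    have "2 * C * (x - y) * (A x - A y) \<le> 2 * C * \<bar>y - x\<bar> * \<bar>A y - A x\<bar>"
      using False C0 mult_left_mono[OF abs_ge_self[of "A x - A y"], of "2 * C * (x - y)"]
      by (simp add: abs_minus_commute)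
    then show ?thesis using est[of y x] False that by (simp add: abs_minus_commute)
  qed
  have "(F has_real_derivative 0) (at x within {a..b})" if x: "x \<in> {a..b}" for x
  proof -
    have "((\<lambda>y. 2 * C * \<bar>A y - A x\<bar>) \<longlongrightarrow> 2 * C * \<bar>A x - A x\<bar>) (at x within {a..b})"
      using Ac x by (intro tendsto_intros) (auto simp: continuous_on_def)
    then have "((\<lambda>y. (F y - F x) / (y - x)) \<longlongrightarrow> 0) (at x within {a..b})"
    proof (rule Lim_null_comparison[rotated, OF tendsto_eq_rhs])
      have "\<forall>\<^sub>F y in at x within {a..b}. y \<in> {a..b} \<and> y \<noteq> x" by (auto simp: eventually_at_filter)
      then show "\<forall>\<^sub>F y in at x within {a..b}. norm ((F y - F x) / (y - x)) \<le> 2 * C * \<bar>A y - A x\<bar>"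
        by eventually_elim (use est'[OF x] in \<open>auto simp: field_simps abs_divide\<close>)
    qed simp
    then show ?thesis by (simp add: has_field_derivative_iff)
  qed
  then obtain c where "\<And>x. x \<in> {a..b} \<Longrightarrow> F x = c"
    using has_field_derivative_zero_constant[of "{a..b}" F] by auto
  then have "F b = F a" using \<open>a \<le> b\<close> by simp
  then have "integral {a..b} ?f = w b * \<phi> b - w a * \<phi> a" by (simp add: F_def)
  with fint show ?thesis by (metis integrable_integral)
qed

lemma H1_by_parts:
  assumes "\<And>x y. x \<le> y \<Longrightarrow> (z has_integral w y - w x) {x..y}" "z \<in> L2_per" "periodic1 w" "\<phi> \<in> smooth_per"
  shows "mean (\<lambda>x. w x * deriv \<phi> x) = - mean (\<lambda>x. z x * \<phi> x)"
proof -
  note s = smooth_per_deriv[OF assms(4)]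
  have "((\<lambda>x. z x * \<phi> x + w x * deriv \<phi> x) has_integral w (1/2) * \<phi> (1/2) - w (-1/2) * \<phi> (-1/2)) {-1/2..1/2}"
    using assms s smooth_per_deriv(3)[OF s(2)] L2_perD[OF assms(2)]
    by (intro absolutely_continuous_mult_C1) (auto intro: has_field_derivative_at_within)
  moreover have "w (1/2) * \<phi> (1/2) - w (-1/2) * \<phi> (-1/2) = 0"
    using periodic1_add[OF assms(3), of "-1/2"] periodic1_add[OF s(4), of "-1/2"] by simp
  ultimately have 0: "((\<lambda>x. z x * \<phi> x + w x * deriv \<phi> x) has_integral 0) \<T>"
    by (simp add: circle_def)
  have 1: "(\<lambda>x. z x * \<phi> x) integrable_on \<T>"
    using L2_per_mult[OF assms(2) smooth_per_L2_per[OF assms(4)]] by (simp add: absolutely_integrable_on_def)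
  have 2: "(\<lambda>x. w x * deriv \<phi> x) integrable_on \<T>"
    using L2_per_mult[OF continuous_L2_per[OF assms(3) H1_continuous[OF assms(1)]] smooth_per_L2_per[OF s(2)]]
    by (simp add: absolutely_integrable_on_def)
  from has_integral_unique[OF has_integral_add[OF integrable_integral[OF 1] integrable_integral[OF 2]] 0]
  show ?thesis by simp
qed

lemma has_weak_deriv_iff:
  assumes "f \<in> L2_per" "g \<in> L2_per"
  shows "has_weak_deriv f g \<longleftrightarrow>
    (\<forall>\<phi>\<in>smooth_per. mean (\<lambda>x. f x * deriv \<phi> x) = - mean (\<lambda>x. g x * \<phi> x))"
  unfolding has_weak_deriv_def
  using L2_per_mult[OF assms(1) smooth_per_L2_per[OF smooth_per_deriv(2)]] L2_per_mult[OF assms(2) smooth_per_L2_per]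
  by (simp add: LINT_circle)

lemma H1_has_weak_deriv:
  assumes "H1 w z" shows "has_weak_deriv w z"
  unfolding has_weak_deriv_iff[OF H1D(5,2)[OF assms]]
  using H1_by_parts[OF H1D(3,2,1)[OF assms]] by blast

text \<open>One of the two intervals is empty or a point, where the integral is 0, so the difference
  is the signed integral from 0 to x; mean zero makes it periodic.\<close>

lemma H1_primitive:
  assumes z: "z \<in> L2_per" "mean z = 0"
  shows "H1 (\<lambda>x. c + integral {0..x} z - integral {x..0} z) z"
proof -
  let ?w = "\<lambda>x. c + integral {0..x} z - integral {x..0} z"
  have int: "z integrable_on {a..b}" for a b
    using L2_perD(5)[OF z(1)] by (simp add: absolutely_integrable_on_def)
  have d: "?w y - ?w x = integral {x..y} z" if "x \<le> y" for x y
  proof -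
    consider "0 \<le> x" | "x \<le> 0" "0 \<le> y" | "y \<le> 0" by linarith
    then show ?thesis
    proof cases
      case 1
      then have "integral {x..0} z = 0" "integral {y..0} z = 0"
        using that by (auto simp: atLeastatMost_empty' intro!: integral_unique has_integral_null_real)
      then show ?thesis using 1 that integral_split[of 0 x y z] int by simp
    next
      case 2
      then have "integral {0..x} z = 0" "integral {y..0} z = 0"
        by (auto intro!: integral_unique has_integral_null_real)
      then show ?thesis using 2 integral_split[of x 0 y z] int by simp
    next
      case 3
      then have "integral {0..x} z = 0" "integral {0..y} z = 0"
        using that by (auto intro!: integral_unique has_integral_null_real)
      then show ?thesis using 3 that integral_split[of x y 0 z] int by simp
    qed
  qed
  have "?w (x + 1) = ?w x" for x
    using d[of x "x+1"] periodic1_integral[OF L2_perD(1)[OF z(1)], of x] L2_perD(4)[OF z(1)] z(2)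
    by (simp add: absolutely_integrable_on_def)
  then show ?thesis unfolding H1_def periodic1_def
    using d int z(1) by (simp add: has_integral_integrable_integral)
qed

lemma H1_DERIV:
  assumes "H1 u v" "continuous_on UNIV v"
  shows "(u has_real_derivative v x) (at x)"
proof -
  have "((\<lambda>y. integral {x-1..y} v) has_real_derivative v x) (at x within {x-1..x+1})"
    using continuous_on_subset[OF assms(2)] by (intro integral_has_real_derivative) auto
  then have "((\<lambda>y. integral {x-1..y} v) has_real_derivative v x) (at x)"
    by (subst (asm) at_within_interior) auto
  then have "((\<lambda>y. u (x-1) + integral {x-1..y} v) has_real_derivative v x) (at x)"
    by (auto intro!: derivative_eq_intros)
  then show ?thesis
  proof (rule has_field_derivative_transform_within_open[where S="{x-1<..}"])
    show "u (x-1) + integral {x-1..y} v = u y" if "y \<in> {x-1<..}" for y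
      using H1D(3)[OF assms(1), of "x-1" y] that by (simp add: integral_unique)
  qed auto
qed

section \<open>Uniqueness of weak derivatives and continuous representatives\<close>

lemma AE_circle_imp_AE:
  assumes "periodic1 f" "periodic1 g" "AE x in lebesgue. x \<in> \<T> \<longrightarrow> f x = g x"
  shows "AE x in lebesgue. f x = g x"
proof -
  define N where "N = {x. x \<in> \<T> \<and> f x \<noteq> g x}"
  have N: "negligible N"
    using assms(3) unfolding N_def eventually_ae_filter
    by (auto simp: negligible_iff_null_sets intro: null_sets_completion_subset)
  \<comment> \<open>Equality almost everywhere on the circle passes to the line through countably
    many integer translates.\<close>
  have "{x. f x \<noteq> g x} \<subseteq> (\<Union>n::int. (\<lambda>x. x + of_int n) ` N)"
  proof safe
    fix x assume x: "f x \<noteq> g x"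
    define n where "n = \<lfloor>x + 1/2\<rfloor>"
    have "x - of_int n \<in> \<T>" unfolding circle_def n_def by (auto; linarith)
    moreover have "f (x - of_int n) = f x" "g (x - of_int n) = g x"
      using periodic1_of_int[OF assms(1), of "x" "-n"] periodic1_of_int[OF assms(2), of "x" "-n"] by auto
    ultimately have "x - of_int n \<in> N" using x by (simp add: N_def)
    then show "x \<in> (\<Union>n::int. (\<lambda>x. x + of_int n) ` N)" by force
  qed
  moreover have "negligible (\<Union>n::int. (\<lambda>x. x + of_int n) ` N)"
  proof (intro negligible_countable_Union)
    have "(\<lambda>x. x + of_int n) ` N = (+) (of_int n) ` N" for n :: int by (simp add: add.commute)
    then show "negligible s" if "s \<in> range (\<lambda>n::int. (\<lambda>x. x + of_int n) ` N)" for s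
      using negligible_translation[OF N] that by auto
  qed auto
  ultimately have "negligible {x. f x \<noteq> g x}" using negligible_subset by blast
  then have "AE x in lebesgue. x \<notin> {x. f x \<noteq> g x}"
    by (intro AE_not_in) (simp add: negligible_iff_null_sets)
  then show ?thesis by simp
qed

lemma weak_deriv_unique:
  assumes "f \<in> L2_per" "g1 \<in> L2_per" "g2 \<in> L2_per" "has_weak_deriv f g1" "has_weak_deriv f g2"
  shows "AE x in lebesgue. g1 x = g2 x"
proof -
  have "AE x in lebesgue. x \<in> \<T> \<longrightarrow> g1 x - g2 x = 0"
  proof (rule smooth_per_separates)
    show "(\<lambda>x. g1 x - g2 x) absolutely_integrable_on \<T>"
      using L2_per_diff[OF assms(2,3)] L2_perD(4) by blast
    show "mean (\<lambda>x. (g1 x - g2 x) * \<phi> x) = 0" if \<phi>: "\<phi> \<in> smooth_per" for \<phi>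
    proof -
      have "(\<lambda>x. g1 x * \<phi> x) integrable_on \<T>" "(\<lambda>x. g2 x * \<phi> x) integrable_on \<T>"
        using L2_per_mult[OF assms(2) smooth_per_L2_per[OF \<phi>]] L2_per_mult[OF assms(3) smooth_per_L2_per[OF \<phi>]]
        by (auto simp: absolutely_integrable_on_def)
      then show ?thesis using assms \<phi> by (simp add: left_diff_distrib integral_diff has_weak_deriv_iff)
    qed
  qed
  then have "AE x in lebesgue. x \<in> \<T> \<longrightarrow> g1 x = g2 x" by simp
  then show ?thesis using L2_perD(1)[OF assms(2)] L2_perD(1)[OF assms(3)] by (intro AE_circle_imp_AE)
qed

text \<open>The mean is the only obstruction to a periodic primitive, so derivatives of test
  functions are exactly the test functions of mean zero.\<close>

lemma smooth_per_primitive: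
  assumes "\<psi> \<in> smooth_per"
  obtains \<phi> where "\<phi> \<in> smooth_per" "deriv \<phi> = (\<lambda>x. \<psi> x - mean \<psi>)"
proof -
  define g where "g = (\<lambda>x. \<psi> x - mean \<psi>)"
  have gs: "g \<in> smooth_per" using smooth_per_diff_const[OF assms] by (simp add: g_def)
  have "\<psi> integrable_on \<T>" using L2_perD(4)[OF smooth_per_L2_per[OF assms]] by (simp add: absolutely_integrable_on_def)
  moreover have "(\<lambda>x. mean \<psi>) integrable_on \<T>"
    unfolding circle_def by (rule integrable_const_ivl)
  ultimately have "mean g = mean \<psi> - mean (\<lambda>x. mean \<psi>)"
    unfolding g_def by (rule integral_diff)
  also have "\<dots> = 0" by (simp add: circle_def)
  finally have "mean g = 0" .
  from H1_primitive[OF smooth_per_L2_per[OF gs] this, of 0] obtain \<phi> where \<phi>: "H1 \<phi> g" by blast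
  note p = H1D[OF \<phi>]
  have D: "(\<phi> has_real_derivative g x) (at x)" for x
    by (rule H1_DERIV[OF \<phi> smooth_per_deriv(3)[OF gs]])
  from smooth_perI[OF D gs p(1)] that show ?thesis by (simp add: g_def)
qed

text \<open>After subtracting a primitive of the weak derivative, the rest is
  orthogonal to all derivatives of test functions, that is, to all test functions of mean zero.\<close>

lemma du_Bois_Reymond:
  assumes f: "f \<in> L2_per" and g: "g \<in> L2_per" and fg: "has_weak_deriv f g"
  obtains w where "H1 w g" "AE x in lebesgue. f x = w x"
proof -
  have eq: "mean (\<lambda>x. f x * deriv \<phi> x) = - mean (\<lambda>x. g x * \<phi> x)" if "\<phi> \<in> smooth_per" for \<phi>
    using fg that by (simp add: has_weak_deriv_iff[OF f g])
  have "mean g = 0" using eq[OF smooth_per_1] by simp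
  from H1_primitive[OF g this, of 0] obtain v where v: "H1 v g" by blast
  note vD = H1D[OF v]
  define k where "k = (\<lambda>x. f x - v x)"
  have k: "k \<in> L2_per" unfolding k_def by (rule L2_per_diff[OF f vD(5)])
  have kD: "mean (\<lambda>x. k x * deriv \<phi> x) = 0" if \<phi>: "\<phi> \<in> smooth_per" for \<phi>
  proof -
    have "mean (\<lambda>x. v x * deriv \<phi> x) = - mean (\<lambda>x. g x * \<phi> x)"
      using vD \<phi> by (intro H1_by_parts) auto
    moreover have "(\<lambda>x. f x * deriv \<phi> x) integrable_on \<T>" "(\<lambda>x. v x * deriv \<phi> x) integrable_on \<T>"
      using L2_per_mult[OF f smooth_per_L2_per[OF smooth_per_deriv(2)[OF \<phi>]]]
        L2_per_mult[OF vD(5) smooth_per_L2_per[OF smooth_per_deriv(2)[OF \<phi>]]]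
      by (auto simp: absolutely_integrable_on_def)
    ultimately show ?thesis using eq[OF \<phi>] by (simp add: k_def left_diff_distrib integral_diff)
  qed
  define c where "c = mean k"
  have kint: "k integrable_on \<T>" using L2_perD(4)[OF k] by (simp add: absolutely_integrable_on_def)
  have "AE x in lebesgue. x \<in> \<T> \<longrightarrow> k x - c = 0"
  proof (rule smooth_per_separates)
    show "(\<lambda>x. k x - c) absolutely_integrable_on \<T>"
      using L2_perD(4)[OF L2_per_diff[OF k continuous_L2_per[of "\<lambda>x. c"]]] by (simp add: periodic1_def)
    fix \<psi> assume \<psi>: "\<psi> \<in> smooth_per"
    from smooth_per_primitive[OF \<psi>] obtain \<phi> where \<phi>: "\<phi> \<in> smooth_per" "deriv \<phi> = (\<lambda>x. \<psi> x - mean \<psi>)" .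
    have i: "(\<lambda>x. k x * \<psi> x) integrable_on \<T>" "\<psi> integrable_on \<T>"
      using L2_per_mult[OF k smooth_per_L2_per[OF \<psi>]] L2_perD(4)[OF smooth_per_L2_per[OF \<psi>]] by (auto simp: absolutely_integrable_on_def)
    have "0 = mean (\<lambda>x. k x * \<psi> x - k x * mean \<psi>)"
      using kD[OF \<phi>(1)] by (simp add: \<phi>(2) right_diff_distrib)
    also have "\<dots> = mean (\<lambda>x. k x * \<psi> x) - c * mean \<psi>"
      using i kint by (subst integral_diff) (auto simp: c_def intro: integrable_on_mult_left)
    also have "\<dots> = mean (\<lambda>x. (k x - c) * \<psi> x)"
      using i by (simp add: left_diff_distrib) (subst integral_diff, auto intro: integrable_on_mult_right)
    finally show "mean (\<lambda>x. (k x - c) * \<psi> x) = 0" by simp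
  qed
  then have "AE x in lebesgue. x \<in> \<T> \<longrightarrow> f x = v x + c"
    by eventually_elim (auto simp: k_def)
  then have "AE x in lebesgue. f x = v x + c"
    using L2_perD(1)[OF f] vD(1) by (intro AE_circle_imp_AE) (auto simp: periodic1_def)
  moreover have "H1 (\<lambda>x. v x + c) g" using v by (auto simp: H1_def periodic1_def)
  ultimately show ?thesis using that by blast
qed

lemma has_weak_deriv_cong_AE:
  assumes "AE x in lebesgue. f x = f' x" "f \<in> L2_per" "f' \<in> L2_per"
  shows "has_weak_deriv f g \<longleftrightarrow> has_weak_deriv f' g"
proof -
  have "(LINT x:\<T>|lebesgue. f x * deriv \<phi> x) = (LINT x:\<T>|lebesgue. f' x * deriv \<phi> x)" if "\<phi> \<in> smooth_per" for \<phi>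
    using L2_perD(2) assms smooth_per_L2_per[OF smooth_per_deriv(2)[OF that]]
    by (intro set_lebesgue_integral_cong_AE borel_measurable_times) auto
  then show ?thesis by (simp add: has_weak_deriv_def)
qed

text \<open>f is only required to agree with w almost everywhere because the lemma is applied twice:
  for the second derivative, f is itself the chosen version \<open>weak_deriv u\<close>.\<close>

lemma weak_deriv_H1:
  assumes "H1 w z" "AE x in lebesgue. f x = w x" "f \<in> L2_per"
  shows "weak_deriv f \<in> L2_per" "AE x in lebesgue. weak_deriv f x = z x"
proof -
  note w = H1D[OF assms(1)]
  have hz: "has_weak_deriv f z"
    using has_weak_deriv_cong_AE[OF assms(2,3) w(5)] H1_has_weak_deriv[OF assms(1)] by simp
  have *: "weak_deriv f \<in> L2_per \<and> has_weak_deriv f (weak_deriv f)"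
    unfolding weak_deriv_def using someI[of "\<lambda>g. g \<in> L2_per \<and> has_weak_deriv f g"] hz w(2) by blast
  then show "weak_deriv f \<in> L2_per" by simp
  show "AE x in lebesgue. weak_deriv f x = z x"
    using weak_deriv_unique[OF assms(3) _ w(2) _ hz] * by blast
qed

lemma H1_cong_AE:
  assumes "H1 w z" "z' \<in> L2_per" "AE x in lebesgue. z' x = z x"
  shows "H1 w z'"
proof -
  obtain N where N: "negligible N" "\<And>x. x \<notin> N \<Longrightarrow> z' x = z x"
    using AE_lebesgue_negligible[OF assms(3)] by blast
  have "(z' has_integral w y - w x) {x..y}" if "x \<le> y" for x y
    using N(1) by (rule has_integral_spike[OF _ _ H1D(3)[OF assms(1) that]]) (use N in auto)
  then show ?thesis using assms by (auto simp: H1_def)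
qed

text \<open>Two applications of du Bois-Reymond's lemma, to u and to its weak derivative; the v on
  the right is the continuous version of that derivative. Continuity of u upgrades equality almost
  everywhere with a primitive to equality, since a closed set of full measure is everything.\<close>

theorem H2_per_iff: "u \<in> H2_per \<longleftrightarrow> (\<exists>v z. H1 u v \<and> H1 v z)"
proof
  assume "u \<in> H2_per"
  then obtain v w where u: "u \<in> L2_per" "continuous_on UNIV u" "v \<in> L2_per" "w \<in> L2_per"
    "has_weak_deriv u v" "has_weak_deriv v w" by (auto simp: H2_per_def)
  from du_Bois_Reymond[OF u(1,3,5)] obtain u' where u': "H1 u' v" "AE x in lebesgue. u x = u' x" .
  from du_Bois_Reymond[OF u(3,4,6)] obtain v' where v': "H1 v' w" "AE x in lebesgue. v x = v' x" .
  have "H1 u' v'"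
    using v'(2) H1D(5)[OF v'(1)] by (intro H1_cong_AE[OF u'(1)]) auto
  moreover have "u = u'"
  proof
    fix x
    have "closed {x. u x - u' x = 0}"
      using u(2) H1D(4)[OF u'(1), of UNIV] by (intro closed_Collect_eq continuous_intros)
    moreover have "AE x in lebesgue. x \<in> {x. u x - u' x = 0}" using u'(2) by simp
    ultimately have "x \<in> {x. u x - u' x = 0}" by (rule mem_closed_if_AE_lebesgue)
    then show "u x = u' x" by auto
  qed
  ultimately show "\<exists>v z. H1 u v \<and> H1 v z" using v'(1) by blast
next
  assume "\<exists>v z. H1 u v \<and> H1 v z"
  then obtain v z where uv: "H1 u v" "H1 v z" by blast
  show "u \<in> H2_per"
    using H1D[OF uv(1)] H1D[OF uv(2)] uv[THEN H1_has_weak_deriv] by (auto simp: H2_per_def)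
qed

lemma functionals_H1:
  assumes "H1 u v" "H1 v z"
  shows "Kfun u = 1/2 * mean (sq u)"
    and "Efun u = 1/2 * mean (sq v)"
    and "Rfun u = - mean (sq z) - mean (\<lambda>x. v x ^ 3)"
proof -
  note u = H1D[OF assms(1)] and v = H1D[OF assms(2)]
  show "Kfun u = 1/2 * mean (sq u)"
    unfolding Kfun_def using LINT_circle L2_perD(3)[OF u(5)] by simp
  have 1: "weak_deriv u \<in> L2_per" "AE x in lebesgue. weak_deriv u x = v x"
    using weak_deriv_H1[OF assms(1) _ u(5)] by auto
  have 2: "weak_deriv (weak_deriv u) \<in> L2_per" "AE x in lebesgue. weak_deriv (weak_deriv u) x = z x"
    using weak_deriv_H1[OF assms(2) 1(2) 1(1)] by auto
  note meas = L2_perD(2)[OF u(2)] L2_perD(2)[OF v(2)] L2_perD(2)[OF 1(1)] L2_perD(2)[OF 2(1)]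
  have "(LINT x:\<T>|lebesgue. (weak_deriv u x)\<^sup>2) = (LINT x:\<T>|lebesgue. (v x)\<^sup>2)"
    using 1(2) meas by (intro set_lebesgue_integral_cong_AE borel_measurable_power) (auto elim: eventually_mono)
  then show "Efun u = 1/2 * mean (sq v)"
    unfolding Efun_def using LINT_circle L2_perD(3)[OF v(5)] by simp
  have v3: "(\<lambda>x. v x ^ 3) absolutely_integrable_on \<T>"
    unfolding circle_def using v(4) by (intro absolutely_integrable_continuous_real continuous_intros)
  have "(LINT x:\<T>|lebesgue. (weak_deriv (weak_deriv u) x)\<^sup>2 + (weak_deriv u x) ^ 3) = (LINT x:\<T>|lebesgue. (z x)\<^sup>2 + v x ^ 3)"
    using AE_conjI[OF 1(2) 2(2)] meas
    by (intro set_lebesgue_integral_cong_AE borel_measurable_add borel_measurable_power) (auto elim: eventually_mono)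
  also have "\<dots> = mean (\<lambda>x. (z x)\<^sup>2 + v x ^ 3)"
    by (intro LINT_circle set_integral_add L2_perD(3)[OF v(2)] v3)
  also have "\<dots> = mean (sq z) + mean (\<lambda>x. v x ^ 3)"
    using L2_perD(3)[OF v(2)] v3 by (intro integral_add) (auto simp: absolutely_integrable_on_def)
  finally show "Rfun u = - mean (sq z) - mean (\<lambda>x. v x ^ 3)"
    by (simp add: Rfun_def)
qed

section \<open>Existence of a maximizer\<close>

definition admissible :: "real \<Rightarrow> (real \<Rightarrow> real) \<Rightarrow> (real \<Rightarrow> real) \<Rightarrow> bool" where
  "admissible e w z \<longleftrightarrow> H1 w z \<and> mean w = 0 \<and> mean (sq w) = e"

definition objective :: "(real \<Rightarrow> real) \<Rightarrow> (real \<Rightarrow> real) \<Rightarrow> real" where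
  "objective w z = mean (\<lambda>x. w x ^ 3) - mean (sq z)"

definition max_pair :: "real \<Rightarrow> (real \<Rightarrow> real) \<Rightarrow> (real \<Rightarrow> real) \<Rightarrow> bool" where
  "max_pair e w z \<longleftrightarrow> admissible e w z \<and> (\<forall>w' z'. admissible e w' z' \<longrightarrow> objective w' z' \<le> objective w z)"

lemma admissibleD:
  assumes "admissible e w z"
  shows "H1 w z" "mean w = 0" "mean (sq w) = e"
  using assms by (auto simp: admissible_def)

lemma max_pairD:
  assumes "max_pair e w z"
  shows "admissible e w z" "admissible e w' z' \<Longrightarrow> objective w' z' \<le> objective w z"
  using assms by (auto simp: max_pair_def)

lemma circle_integrable: "continuous_on \<T> f \<Longrightarrow> (f :: real \<Rightarrow> real) integrable_on \<T>"
  unfolding circle_def by (rule integrable_continuous_real)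

lemma mean_const [simp]: "mean (\<lambda>x. c) = c"
  by (simp add: circle_def)

lemma L2_per_integrable:
  assumes "f \<in> L2_per" "g \<in> L2_per"
  shows "(\<lambda>x. f x * g x) integrable_on \<T>" "(sq f) integrable_on \<T>"
    "f integrable_on \<T>" "(\<lambda>x. \<bar>f x\<bar>) integrable_on \<T>"
  using L2_per_mult[OF assms] L2_perD(3,4)[OF assms(1)] by (auto simp: absolutely_integrable_on_def)

lemma integral_square_add:
  assumes "f \<in> L2_per" "g \<in> L2_per"
  shows "mean (\<lambda>x. (a * f x + b * g x)\<^sup>2) =
    a\<^sup>2 * mean (sq f) + 2 * a * b * mean (\<lambda>x. f x * g x) + b\<^sup>2 * mean (sq g)"
proof -
  note i = L2_per_integrable[OF assms] L2_per_integrable[OF assms(2,1)]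
  have "((\<lambda>x. a\<^sup>2 * (f x)\<^sup>2 + 2 * a * b * (f x * g x) + b\<^sup>2 * (g x)\<^sup>2) has_integral
     a\<^sup>2 * mean (sq f) + 2 * a * b * mean (\<lambda>x. f x * g x) + b\<^sup>2 * mean (sq g)) \<T>"
    using i by (intro has_integral_add has_integral_mult_right integrable_integral) auto
  then show ?thesis
    by (intro integral_unique) (simp add: power2_eq_square algebra_simps)
qed

text \<open>Cauchy-Schwarz, from \<integral> (|z| - c)^2 \<ge> 0 at the minimizing constant c, the
  average of |z|.\<close>

lemma abs_integral_square_le:
  assumes z: "z \<in> L2_per" and "a \<le> b"
  shows "(integral {a..b} (\<lambda>x. \<bar>z x\<bar>))\<^sup>2 \<le> (b - a) * integral {a..b} (sq z)"
proof (cases "a = b")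
  case False
  define A where "A = integral {a..b} (\<lambda>x. \<bar>z x\<bar>)"
  define c where "c = A / (b - a)"
  have i: "(\<lambda>x. \<bar>z x\<bar>) integrable_on {a..b}" "sq z integrable_on {a..b}"
    using L2_perD(5,6)[OF z] by (auto simp: absolutely_integrable_on_def)
  have "((\<lambda>x. (z x)\<^sup>2 - 2 * c * \<bar>z x\<bar> + c\<^sup>2) has_integral
     integral {a..b} (sq z) - 2 * c * A + (b - a) * c\<^sup>2) {a..b}"
    unfolding A_def using i \<open>a \<le> b\<close> has_integral_const_real[of "c\<^sup>2" a b]
    by (intro has_integral_add has_integral_diff has_integral_mult_right integrable_integral) auto
  moreover have "(z x)\<^sup>2 - 2 * c * \<bar>z x\<bar> + c\<^sup>2 \<ge> 0" for x
    using zero_le_power2[of "\<bar>z x\<bar> - c"] by (simp add: power2_diff algebra_simps)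
  ultimately have "0 \<le> integral {a..b} (sq z) - 2 * c * A + (b - a) * c\<^sup>2"
    by (rule has_integral_nonneg)
  also have "\<dots> = integral {a..b} (sq z) - A\<^sup>2 / (b - a)"
  proof -
    have "b - a \<noteq> 0" using False by simp
    then have "- 2 * (A / (b - a)) * A + (b - a) * (A / (b - a))\<^sup>2 = - A\<^sup>2 / (b - a)"
      by (simp add: power2_eq_square)
    then show ?thesis by (simp add: c_def)
  qed
  finally show ?thesis using False \<open>a \<le> b\<close> by (simp add: A_def field_simps)
qed simp

lemma H1_diff_le:
  assumes "H1 w z" "x \<le> y" "{x..y} \<subseteq> {a..b}"
  shows "\<bar>w y - w x\<bar> \<le> integral {a..b} (\<lambda>x. \<bar>z x\<bar>)"
proof -
  have i: "(\<lambda>x. \<bar>z x\<bar>) integrable_on {a..b}" for a b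
    using L2_perD(5)[OF H1D(2)[OF assms(1)]] by (auto simp: absolutely_integrable_on_def)
  have "\<bar>w y - w x\<bar> = \<bar>integral {x..y} z\<bar>"
    using H1D(3)[OF assms(1,2)] by (simp add: integral_unique)
  also have "\<dots> \<le> integral {x..y} (\<lambda>x. \<bar>z x\<bar>)"
    using H1D(3)[OF assms(1,2)] i by (intro abs_integral_le) auto
  also have "\<dots> \<le> integral {a..b} (\<lambda>x. \<bar>z x\<bar>)"
    using i assms by (intro integral_subset_le) auto
  finally show ?thesis .
qed

lemma H1_Hoelder:
  assumes "H1 w z" "x \<in> \<T>" "y \<in> \<T>"
  shows "(w x - w y)\<^sup>2 \<le> \<bar>x - y\<bar> * mean (sq z)"
proof -
  have *: "(w y - w x)\<^sup>2 \<le> (y - x) * mean (sq z)" if "x \<le> y" "x \<in> \<T>" "y \<in> \<T>" for x y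
  proof -
    have z2: "sq z integrable_on {a..b}" for a b
      using L2_perD(6)[OF H1D(2)[OF assms(1)]] by (auto simp: absolutely_integrable_on_def)
    have "(w y - w x)\<^sup>2 \<le> (integral {x..y} (\<lambda>x. \<bar>z x\<bar>))\<^sup>2"
      using power_mono[OF H1_diff_le[OF assms(1) that(1), of x y], of 2] by simp
    also have "\<dots> \<le> (y - x) * integral {x..y} (sq z)"
      by (rule abs_integral_square_le[OF H1D(2)[OF assms(1)] that(1)])
    also have "\<dots> \<le> (y - x) * mean (sq z)"
      unfolding circle_def using that z2
      by (intro mult_left_mono integral_subset_le) (auto simp: circle_def)
    finally show ?thesis .
  qed
  then show ?thesis using *[of x y] *[of y x] assms by (cases "x \<le> y") (auto simp: power2_commute abs_minus_commute)
qed

text \<open>As w has mean zero, w x is the mean over y of w x - w y, and each of these is at most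
  \<integral> |z| in absolute value. The circle has length 1, so no constant appears.\<close>

lemma H1_sup_bound:
  assumes "H1 w z" "mean w = 0" "x \<in> \<T>"
  shows "(w x)\<^sup>2 \<le> mean (sq z)"
proof -
  let ?A = "mean (\<lambda>x. \<bar>z x\<bar>)"
  have wi: "w integrable_on \<T>" using H1D(4)[OF assms(1)] by (rule circle_integrable)
  have "w x = mean (\<lambda>y. w x) - mean w" using assms by simp
  also have "\<dots> = mean (\<lambda>y. w x - w y)"
    using wi by (subst integral_diff) (auto simp: circle_def)
  also have "\<bar>\<dots>\<bar> \<le> mean (\<lambda>y. ?A)"
  proof (rule abs_integral_le)
    show "(\<lambda>y. w x - w y) integrable_on \<T>" using H1D(4)[OF assms(1)] by (intro circle_integrable continuous_intros)
    show "\<bar>w x - w y\<bar> \<le> ?A" if "y \<in> \<T>" for y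
      using H1_diff_le[OF assms(1), of x y "-1/2" "1/2"] H1_diff_le[OF assms(1), of y x "-1/2" "1/2"] that assms(3)
      by (cases "x \<le> y") (auto simp: circle_def abs_minus_commute)
  qed (auto simp: circle_def)
  finally have "\<bar>w x\<bar> \<le> ?A" by simp
  from power_mono[OF this, of 2] have "(w x)\<^sup>2 \<le> ?A\<^sup>2" by simp
  also have "\<dots> \<le> mean (sq z)"
    using abs_integral_square_le[OF H1D(2)[OF assms(1)], of "-1/2" "1/2"] by (simp add: circle_def)
  finally show ?thesis .
qed

lemma integral_circle_nonneg:
  "(\<And>x. x \<in> \<T> \<Longrightarrow> 0 \<le> f x) \<Longrightarrow> f integrable_on \<T> \<Longrightarrow> 0 \<le> mean (f :: real \<Rightarrow> real)"
  by (rule Henstock_Kurzweil_Integration.integral_nonneg)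

text \<open>Bounding one factor of w^3 by the supremum makes the cubic term linear in the L2 norm of
  z, while the negative term is quadratic in it.\<close>

lemma objective_le:
  assumes "admissible e w z"
  shows "objective w z \<le> e * sqrt (mean (sq z)) - mean (sq z)"
proof -
  let ?D = "mean (sq z)"
  note w = admissibleD[OF assms]
  have "mean (\<lambda>x. w x ^ 3) \<le> mean (\<lambda>x. sqrt ?D * (w x)\<^sup>2)"
  proof (rule integral_le)
    show "w x ^ 3 \<le> sqrt ?D * (w x)\<^sup>2" if "x \<in> \<T>" for x
    proof -
      have "w x \<le> sqrt ?D" using H1_sup_bound[OF w(1,2) that] real_le_rsqrt by blast
      then have "w x * (w x)\<^sup>2 \<le> sqrt ?D * (w x)\<^sup>2" by (intro mult_right_mono) auto
      then show ?thesis by (simp add: power3_eq_cube power2_eq_square mult.assoc)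
    qed
  qed (use H1D(4)[OF w(1)] in \<open>auto intro!: circle_integrable continuous_intros\<close>)
  also have "\<dots> = e * sqrt ?D" using w(3) by simp
  finally show ?thesis by (simp add: objective_def)
qed

lemma smooth_per_H1:
  assumes "\<phi> \<in> smooth_per" shows "H1 \<phi> (deriv \<phi>)"
proof -
  note s = smooth_per_deriv[OF assms]
  have "(deriv \<phi> has_integral \<phi> y - \<phi> x) {x..y}" if "x \<le> y" for x y
    using that s(1)
    by (intro has_integral_derivative) (auto intro: has_field_derivative_at_within)
  then show ?thesis using s smooth_per_L2_per by (auto simp: H1_def)
qed

lemma H1_linear:
  assumes "H1 w z" "H1 w' z'"
  shows "H1 (\<lambda>x. a * w x + b * w' x) (\<lambda>x. a * z x + b * z' x)"
  unfolding H1_def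
proof (intro conjI allI impI)
  show "(\<lambda>x. a * z x + b * z' x) \<in> L2_per"
    using H1D(2)[OF assms(1)] H1D(2)[OF assms(2)] by (intro L2_per_add L2_per_cmult)
  show "((\<lambda>x. a * z x + b * z' x) has_integral a * w y + b * w' y - (a * w x + b * w' x)) {x..y}" if "x \<le> y" for x y
    using has_integral_add[OF has_integral_mult_right[OF H1D(3)[OF assms(1) that], of a] has_integral_mult_right[OF H1D(3)[OF assms(2) that], of b]]
    by (simp add: algebra_simps)
qed (use H1D(1)[OF assms(1)] H1D(1)[OF assms(2)] in \<open>auto simp: periodic1_def\<close>)

lemma H1_cmult: "H1 w z \<Longrightarrow> H1 (\<lambda>x. a * w x) (\<lambda>x. a * z x)"
  using H1_linear[of w z w z a 0] by simp

lemma admissible_exists: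
  assumes "e \<ge> 0" obtains w z where "admissible e w z"
proof -
  define \<phi> \<psi> where "\<phi> = (\<lambda>x. cos (2 * pi * x))" and "\<psi> = (\<lambda>x. sin (2 * pi * x))"
  have s: "\<phi> \<in> smooth_per" "\<psi> \<in> smooth_per" "(\<lambda>x. \<psi> x * \<phi> x) \<in> smooth_per"
    unfolding \<phi>_def \<psi>_def by (intro trig_poly_smooth_per trig_poly.intros)+
  have "(\<psi> has_real_derivative 2 * pi * \<phi> x) (at x)" for x
    unfolding \<phi>_def \<psi>_def by (auto intro!: derivative_eq_intros)
  then have "deriv \<psi> = (\<lambda>x. 2 * pi * \<phi> x)" by (intro ext DERIV_imp_deriv)
  then have m1: "mean \<phi> = 0" using H1D(6)[OF smooth_per_H1[OF s(2)]] by simp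
  \<comment> \<open>The derivative of a periodic function has mean zero; applied to sin * cos this
    gives mean 1/2 for cos^2, whence the amplitude \<open>sqrt (2 * e)\<close> below.\<close>
  have "((\<lambda>x. \<psi> x * \<phi> x) has_real_derivative 2 * pi * (2 * (\<phi> x)\<^sup>2 - 1)) (at x)" for x
    unfolding \<phi>_def \<psi>_def by (auto intro!: derivative_eq_intros simp: cos_squared_eq power2_eq_square[symmetric] algebra_simps)
  then have "deriv (\<lambda>x. \<psi> x * \<phi> x) = (\<lambda>x. 2 * pi * (2 * (\<phi> x)\<^sup>2 - 1))" by (intro ext DERIV_imp_deriv)
  then have "mean (\<lambda>x. 2 * (\<phi> x)\<^sup>2 - 1) = 0" using H1D(6)[OF smooth_per_H1[OF s(3)]] by simp
  moreover have "mean (\<lambda>x. 2 * (\<phi> x)\<^sup>2 - 1) = 2 * mean (sq \<phi>) - 1"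
    using smooth_per_deriv(3)[OF s(1)] by (subst integral_diff) (auto intro!: circle_integrable continuous_intros)
  ultimately have "mean (sq \<phi>) = 1/2" by simp
  then have "admissible e (\<lambda>x. sqrt (2 * e) * \<phi> x) (\<lambda>x. sqrt (2 * e) * deriv \<phi> x)"
    using H1_cmult[OF smooth_per_H1[OF s(1)]] m1 assms by (simp add: admissible_def power_mult_distrib)
  then show ?thesis by (rule that)
qed

text \<open>Every nonzero function of mean zero becomes a competitor after scaling, so that
  comparison functions need not satisfy the energy constraint. The midpoint argument for existence
  and the first variation both go through this inequality.\<close>

lemma objective_rescaled_le:
  assumes "max": "\<And>w z. admissible e w z \<Longrightarrow> objective w z \<le> M" and "e \<ge> 0"
    and v: "H1 v y" "mean v = 0" and q: "mean (sq v) > 0"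
  shows "(sqrt (e / mean (sq v))) ^ 3 * mean (\<lambda>x. v x ^ 3)
    - (e / mean (sq v)) * mean (sq y) \<le> M"
proof -
  define s where "s = sqrt (e / mean (sq v))"
  have s2: "s\<^sup>2 = e / mean (sq v)" using assms by (simp add: s_def)
  have "admissible e (\<lambda>x. s * v x) (\<lambda>x. s * y x)"
    using H1_cmult[OF v(1)] v(2) q by (simp add: admissible_def power_mult_distrib s2)
  from max[OF this] show ?thesis
    by (simp add: objective_def power_mult_distrib s2 flip: s_def)
qed

section \<open>Passage to the limit along a maximizing sequence\<close>

lemma integral_circle_power_tendsto:
  fixes f :: "nat \<Rightarrow> real \<Rightarrow> real"
  assumes "\<And>n. continuous_on \<T> (f n)" "\<And>n x. x \<in> \<T> \<Longrightarrow> \<bar>f n x\<bar> \<le> B"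
    "\<And>x. x \<in> \<T> \<Longrightarrow> (\<lambda>n. f n x) \<longlonglongrightarrow> g x"
  shows "(\<lambda>n. mean (\<lambda>x. f n x ^ k)) \<longlonglongrightarrow> mean (\<lambda>x. g x ^ k)"
proof (rule dominated_convergence)
  show "(\<lambda>x. f n x ^ k) integrable_on \<T>" for n
    using assms(1) by (intro circle_integrable continuous_intros)
  show "(\<lambda>x. B ^ k) integrable_on \<T>" by (rule circle_integrable[OF continuous_on_const])
  show "norm (f n x ^ k) \<le> B ^ k" if "x \<in> \<T>" for n x
    using assms(2)[OF that, of n] by (simp add: power_abs power_mono)
  show "(\<lambda>n. f n x ^ k) \<longlonglongrightarrow> g x ^ k" if "x \<in> \<T>" for x
    using assms(3)[OF that] by (intro tendsto_intros)
qed

lemma L2_per_Fatou: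
  fixes f :: "nat \<Rightarrow> real \<Rightarrow> real"
  assumes f: "\<And>n. f n \<in> L2_per" and g: "periodic1 g" "g \<in> borel_measurable lebesgue"
    and conv: "AE x in lebesgue_on \<T>. (\<lambda>n. f n x) \<longlonglongrightarrow> g x"
    and C: "\<And>n. mean (sq (f n)) \<le> C"
  shows "g \<in> L2_per \<and> mean (sq g) \<le> C"
proof -
  let ?M = "lebesgue_on \<T>"
  have fi: "integrable ?M (sq (f n))" for n
    using L2_perD(3)[OF f[of n]] by (simp add: integrable_restrict_space set_integrable_def)
  have C0: "0 \<le> C" using C[of 0] L2_per_integrable(2)[OF f f, of 0] integral_circle_nonneg[of "\<lambda>x. (f 0 x)\<^sup>2"] by simp
  have gm: "g \<in> borel_measurable ?M" by (rule measurable_restrict_space1[OF g(2)])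
  have "(\<integral>\<^sup>+x. ennreal ((g x)\<^sup>2) \<partial>?M) = (\<integral>\<^sup>+x. liminf (\<lambda>n. ennreal ((f n x)\<^sup>2)) \<partial>?M)"
  proof (rule nn_integral_cong_AE)
    show "AE x in ?M. ennreal ((g x)\<^sup>2) = liminf (\<lambda>n. ennreal ((f n x)\<^sup>2))"
      using conv
    proof eventually_elim
      case (elim x)
      then have "(\<lambda>n. ennreal ((f n x)\<^sup>2)) \<longlonglongrightarrow> ennreal ((g x)\<^sup>2)"
        by (intro tendsto_ennrealI tendsto_intros)
      then show ?case by (rule lim_imp_Liminf[OF sequentially_bot, symmetric])
    qed
  qed
  also have "\<dots> \<le> liminf (\<lambda>n. \<integral>\<^sup>+x. ennreal ((f n x)\<^sup>2) \<partial>?M)"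
    using fi by (intro nn_integral_liminf) (auto intro!: measurable_compose[OF _ measurable_ennreal] dest: borel_measurable_integrable)
  also have "\<dots> \<le> ennreal C"
  proof -
    have "(\<integral>\<^sup>+x. ennreal ((f n x)\<^sup>2) \<partial>?M) \<le> ennreal C" for n
    proof -
      have "(\<integral>\<^sup>+x. ennreal ((f n x)\<^sup>2) \<partial>?M) = ennreal (integral\<^sup>L ?M (sq (f n)))"
        by (rule nn_integral_eq_integral[OF fi]) auto
      also have "integral\<^sup>L ?M (sq (f n)) = mean (sq (f n))"
        by (rule lebesgue_integral_eq_integral[OF fi]) auto
      finally show ?thesis using C[of n] by (simp add: ennreal_leI)
    qed
    then have "liminf (\<lambda>n. \<integral>\<^sup>+x. ennreal ((f n x)\<^sup>2) \<partial>?M) \<le> liminf (\<lambda>n::nat. ennreal C)"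
      by (intro Liminf_mono always_eventually) auto
    then show ?thesis by (simp add: Liminf_const)
  qed
  finally have le: "(\<integral>\<^sup>+x. ennreal ((g x)\<^sup>2) \<partial>?M) \<le> ennreal C" .
  have gi: "integrable ?M (sq g)"
    using le gm by (intro integrableI_bounded) (auto simp: le_less_trans[OF _ ennreal_less_top])
  then have "(sq g) absolutely_integrable_on \<T>"
    by (simp add: integrable_restrict_space set_integrable_def)
  moreover have "mean (sq g) \<le> C"
  proof -
    have "ennreal (integral\<^sup>L ?M (sq g)) \<le> ennreal C"
      using le nn_integral_eq_integral[OF gi] by simp
    then show ?thesis using C0 lebesgue_integral_eq_integral[OF gi] by simp
  qed
  ultimately show ?thesis using g by (simp add: L2_per_def)
qed

text \<open>On a space of mass 1, L2-Cauchy implies L1-Cauchy, which provides an almost everywhere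
  convergent subsequence; an L2 bound on a tail passes to the limit by Fatou. Applied to the
  differences with a fixed member, this gives convergence of the whole sequence.\<close>

lemma L2_per_complete:
  fixes f :: "nat \<Rightarrow> real \<Rightarrow> real"
  assumes f: "\<And>n. f n \<in> L2_per"
    and cauchy: "\<And>eps. eps > 0 \<Longrightarrow> \<exists>N. \<forall>i\<ge>N. \<forall>j\<ge>N. mean (\<lambda>x. (f i x - f j x)\<^sup>2) < eps"
  obtains g where "g \<in> L2_per"
    "\<And>C N. (\<And>n. n \<ge> N \<Longrightarrow> mean (sq (f n)) \<le> C) \<Longrightarrow> mean (sq g) \<le> C"
    "\<And>eps. eps > 0 \<Longrightarrow> \<exists>N. \<forall>n\<ge>N. mean (\<lambda>x. (f n x - g x)\<^sup>2) \<le> eps"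
proof -
  let ?M = "lebesgue_on \<T>"
  have fi: "integrable ?M (f n)" for n
    using L2_perD(4)[OF f[of n]] by (simp add: integrable_restrict_space set_integrable_def)
  have "\<exists>N. \<forall>i\<ge>N. \<forall>j\<ge>N. (LINT x|?M. norm (f i x - f j x)) < e" if "e > 0" for e
  proof -
    from cauchy[of "e\<^sup>2"] that obtain N where N: "\<And>i j. i \<ge> N \<Longrightarrow> j \<ge> N \<Longrightarrow> mean (\<lambda>x. (f i x - f j x)\<^sup>2) < e\<^sup>2"
      by auto
    have "(LINT x|?M. norm (f i x - f j x)) < e" if ij: "i \<ge> N" "j \<ge> N" for i j
    proof -
      have "integrable ?M (\<lambda>x. norm (f i x - f j x))" using fi by auto
      from lebesgue_integral_eq_integral[OF this]
      have "(LINT x|?M. norm (f i x - f j x)) = mean (\<lambda>x. \<bar>f i x - f j x\<bar>)" by simp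
      moreover have "(mean (\<lambda>x. \<bar>f i x - f j x\<bar>))\<^sup>2 \<le> mean (\<lambda>x. (f i x - f j x)\<^sup>2)"
        using abs_integral_square_le[OF L2_per_diff[OF f f], of "-1/2" "1/2"] by (simp add: circle_def)
      ultimately have "(LINT x|?M. norm (f i x - f j x))\<^sup>2 < e\<^sup>2" using N[OF ij] by simp
      then show ?thesis using \<open>e > 0\<close> by (simp add: power2_less_imp_less)
    qed
    then show ?thesis by blast
  qed
  then obtain r where r: "strict_mono r" "AE x in ?M. Cauchy (\<lambda>i. f (r i) x)"
    by (rule cauchy_L1_AE_cauchy_subseq[of ?M f, OF fi]) auto
  \<comment> \<open>Even at points without convergence \<open>lim\<close> depends only on the
    sequence, which is the same at x and x + 1; so g is periodic everywhere.\<close>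
  define g where "g = (\<lambda>x. lim (\<lambda>i. f (r i) x))"
  have conv: "AE x in ?M. (\<lambda>i. f (r i) x) \<longlonglongrightarrow> g x"
    using r(2) by eventually_elim (simp add: g_def Cauchy_convergent_iff convergent_LIMSEQ_iff)
  have gper: "periodic1 g" unfolding g_def using L2_perD(1)[OF f] by (simp add: periodic1_def)
  have gmeas: "g \<in> borel_measurable lebesgue" unfolding g_def
    using L2_perD(2)[OF f] by (intro borel_measurable_lim_metric)
  have shift: "AE x in ?M. (\<lambda>i. f (r (i + N)) x) \<longlonglongrightarrow> g x" for N
    using conv by eventually_elim (rule LIMSEQ_ignore_initial_segment)
  have rge: "r (i + N) \<ge> N" for i N
    using strict_mono_imp_increasing[OF r(1), of "i + N"] by linarith
  have gL2: "g \<in> L2_per"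
  proof -
    from cauchy[of 1] obtain N where N: "\<And>i. i \<ge> N \<Longrightarrow> mean (\<lambda>x. (f i x - f N x)\<^sup>2) < 1" by auto
    have "mean (sq (f i)) \<le> 2 + 2 * mean (sq (f N))" if "i \<ge> N" for i
    proof -
      have d: "(\<lambda>x. f i x - f N x) \<in> L2_per" by (rule L2_per_diff[OF f f])
      have "mean (sq (f i)) \<le> mean (\<lambda>x. 2 * (f i x - f N x)\<^sup>2 + 2 * (f N x)\<^sup>2)"
      proof (rule integral_le)
        show "(f i x)\<^sup>2 \<le> 2 * (f i x - f N x)\<^sup>2 + 2 * (f N x)\<^sup>2" for x
          using zero_le_power2[of "f i x - 2 * f N x"] by (simp add: power2_eq_square algebra_simps)
      qed (use L2_per_integrable(2)[OF f f] L2_per_integrable(2)[OF d d] in \<open>auto intro!: integrable_add\<close>)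
      also have "\<dots> = 2 * mean (\<lambda>x. (f i x - f N x)\<^sup>2) + 2 * mean (sq (f N))"
        using L2_per_integrable(2)[OF f f] L2_per_integrable(2)[OF d d] by (subst integral_add) auto
      finally show ?thesis using N[OF that] by linarith
    qed
    then have "mean (\<lambda>x. (f (r (i + N)) x)\<^sup>2) \<le> 2 + 2 * mean (sq (f N))" for i
      using rge[of N i] by blast
    from L2_per_Fatou[OF f gper gmeas shift[of N] this] show ?thesis by simp
  qed
  show ?thesis
  proof (rule that[OF gL2])
    show "mean (sq g) \<le> C" if "\<And>n. n \<ge> N \<Longrightarrow> mean (sq (f n)) \<le> C" for C N
      using L2_per_Fatou[OF f gper gmeas shift[of N] that[OF rge]] by simp
    show "\<exists>N. \<forall>n\<ge>N. mean (\<lambda>x. (f n x - g x)\<^sup>2) \<le> eps" if "eps > 0" for eps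
    proof -
      from cauchy[OF that] obtain N where N: "\<And>i j. i \<ge> N \<Longrightarrow> j \<ge> N \<Longrightarrow> mean (\<lambda>x. (f i x - f j x)\<^sup>2) < eps"
        by auto
      have "mean (\<lambda>x. (f n x - g x)\<^sup>2) \<le> eps" if n: "n \<ge> N" for n
      proof -
        have "AE x in ?M. (\<lambda>i. f n x - f (r (i + N)) x) \<longlonglongrightarrow> f n x - g x"
          using shift[of N] by eventually_elim (intro tendsto_intros)
        moreover have "mean (\<lambda>x. (f n x - f (r (i + N)) x)\<^sup>2) \<le> eps" for i
          using N[OF n rge[of N i]] by simp
        ultimately show ?thesis
          using L2_per_Fatou[OF L2_per_diff[OF f f] L2_perD(1,2)[OF L2_per_diff[OF f gL2]],
            of "\<lambda>i. n" "\<lambda>i. r (i + N)" n eps] by simp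
      qed
      then show ?thesis by blast
    qed
  qed
qed

text \<open>With d the L2 norm of z, \<open>e * d - d\<^sup>2\<close> is at most (e^2 - d^2) / 2.
  This one inequality bounds the supremum and controls the derivatives along a maximizing
  sequence.\<close>

lemma objective_bound: "admissible e w z \<Longrightarrow> objective w z \<le> e\<^sup>2"
  and Dirichlet_bound: "admissible e w z \<Longrightarrow> mean (sq z) \<le> e\<^sup>2 - 2 * objective w z"
proof -
  assume a: "admissible e w z"
  define d where "d = sqrt (mean (sq z))"
  have z: "z \<in> L2_per" using a H1D(2) by (auto simp: admissible_def)
  have "mean (sq z) \<ge> 0" using L2_per_integrable(2)[OF z z] by (intro integral_circle_nonneg) auto
  then have d2: "mean (sq z) = d\<^sup>2" by (simp add: d_def)
  have *: "objective w z \<le> e * d - d\<^sup>2" using objective_le[OF a] unfolding d2[symmetric] d_def[symmetric] .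
  have "2 * (e * d) \<le> e\<^sup>2 + d\<^sup>2" using sum_squares_bound[of e d] by (simp only: mult.assoc)
  with * have **: "2 * objective w z \<le> e\<^sup>2 - d\<^sup>2" by linarith
  show "objective w z \<le> e\<^sup>2"
    using ** zero_le_power2[of e] zero_le_power2[of d] by linarith
  show "mean (sq z) \<le> e\<^sup>2 - 2 * objective w z"
    unfolding d2 using ** by linarith
qed

theorem max_pair_exists:
  assumes "e > 0"
  obtains w z where "max_pair e w z"
proof -
  define S where "S = {objective w z | w z. admissible e w z}"
  define M where "M = Sup S"
  have bdd: "bdd_above S" unfolding S_def by (rule bdd_aboveI[of _ "e\<^sup>2"]) (auto dest: objective_bound)
  have ne: "S \<noteq> {}" using admissible_exists[of e] assms unfolding S_def by fastforce
  have mx: "objective w z \<le> M" if "admissible e w z" for w z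
    unfolding M_def using that by (intro cSup_upper[OF _ bdd]) (auto simp: S_def)
  have "\<exists>w z. admissible e w z \<and> M - inverse (real (Suc n)) < objective w z" for n
  proof -
    have "M - inverse (real (Suc n)) < Sup S" by (simp add: M_def)
    from less_cSupD[OF ne this] show ?thesis by (auto simp: S_def)
  qed
  then obtain w z where adm: "\<And>n. admissible e (w n) (z n)"
    and close: "\<And>n. M - inverse (real (Suc n)) < objective (w n) (z n)" by metis
  note H = admissibleD[OF adm]
  define B where "B = e\<^sup>2 - 2 * (M - 1)"
  have DB: "mean (sq (z n)) \<le> B" for n
  proof -
    have "inverse (real (Suc n)) \<le> 1" by (simp add: field_simps)
    then show ?thesis using Dirichlet_bound[OF adm[of n]] close[of n] by (simp add: B_def)
  qed
  have B0: "B \<ge> 0"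
    using DB[of 0] integral_circle_nonneg[of "\<lambda>x. (z 0 x)\<^sup>2"] L2_per_integrable(2)[OF H1D(2)[OF H(1)] H1D(2)[OF H(1)], of 0]
    by simp
  have wB: "\<bar>w n x\<bar> \<le> sqrt B" if "x \<in> \<T>" for n x
    using H1_sup_bound[OF H(1,2) that, of n] DB[of n] by (intro real_le_rsqrt) simp
  \<comment> \<open>Arzela-Ascoli: the Hoelder bound with the common Dirichlet bound B is the
    equicontinuity.\<close>
  obtain g k where g: "continuous_on \<T> g" "strict_mono (k :: nat \<Rightarrow> nat)"
    and unif: "\<And>eps. 0 < eps \<Longrightarrow> \<exists>N. \<forall>n x. n \<ge> N \<and> x \<in> \<T> \<longrightarrow> norm (w (k n) x - g x) < eps"
  proof (rule Arzela_Ascoli[of \<T> w "sqrt B"])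
    show "compact \<T>" by (simp add: circle_def)
    show "norm (w n x) \<le> sqrt B" if "x \<in> \<T>" for n x using wB[OF that] by simp
    show "\<exists>d. 0 < d \<and> (\<forall>n y. y \<in> \<T> \<and> norm (x - y) < d \<longrightarrow> norm (w n x - w n y) < eps)"
      if x: "x \<in> \<T>" and eps: "0 < eps" for x eps
    proof (intro exI[of _ "eps\<^sup>2 / (B + 1)"] conjI allI impI)
      show "0 < eps\<^sup>2 / (B + 1)" using eps B0 by simp
      fix n y assume y: "y \<in> \<T> \<and> norm (x - y) < eps\<^sup>2 / (B + 1)"
      have "(w n x - w n y)\<^sup>2 \<le> \<bar>x - y\<bar> * mean (sq (z n))"
        using H1_Hoelder[OF H(1) x] y by simp
      also have "\<dots> \<le> \<bar>x - y\<bar> * (B + 1)" using DB[of n] by (intro mult_left_mono) auto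
      also have "\<dots> < eps\<^sup>2" using y B0 by (simp add: field_simps)
      finally have "\<bar>w n x - w n y\<bar>\<^sup>2 < eps\<^sup>2" by simp
      then show "norm (w n x - w n y) < eps" using eps by (simp only: real_norm_def) (rule power2_less_imp_less, auto)
    qed
  qed (rule that)
  define W where "W = (\<lambda>n. w (k n))"
  define Z where "Z = (\<lambda>n. z (k n))"
  have HW: "H1 (W n) (Z n)" "mean (W n) = 0" "mean (sq (W n)) = e" "Z n \<in> L2_per" for n
    using H H1D(2)[OF H(1)] by (auto simp: W_def Z_def)
  have Wc: "continuous_on \<T> (W n)" for n by (rule H1D(4)[OF HW(1)])
  have WB: "\<bar>W n x\<bar> \<le> sqrt B" if "x \<in> \<T>" for n x using wB[OF that] by (simp add: W_def)
  have conv: "(\<lambda>n. W n x) \<longlonglongrightarrow> g x" if "x \<in> \<T>" for x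
    unfolding LIMSEQ_iff W_def using unif that by blast
  define Tg where "Tg = mean (\<lambda>x. g x ^ 3)"
  define I where "I = Tg - M"
  have lim_pow: "(\<lambda>n. mean (\<lambda>x. W n x ^ j)) \<longlonglongrightarrow> mean (\<lambda>x. g x ^ j)" for j
    by (rule integral_circle_power_tendsto[OF Wc WB conv])
  have g1: "mean g = 0" using lim_pow[of 1] HW(2) by (simp add: LIMSEQ_const_iff)
  have g2: "mean (sq g) = e" using lim_pow[of 2] HW(3) by (simp add: LIMSEQ_const_iff)
  define Dn where "Dn = (\<lambda>n. mean (sq (Z n)))"
  have objlim: "(\<lambda>n. objective (W n) (Z n)) \<longlonglongrightarrow> M"
  proof (rule tendsto_sandwich)
    show "\<forall>\<^sub>F n in sequentially. M - inverse (real (Suc n)) \<le> objective (W n) (Z n)"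
    proof (intro always_eventually allI)
      fix n
      have "inverse (real (Suc (k n))) \<le> inverse (real (Suc n))"
        using strict_mono_imp_increasing[OF g(2), of n] by (intro le_imp_inverse_le) auto
      with close[of "k n"] show "M - inverse (real (Suc n)) \<le> objective (W n) (Z n)"
        unfolding W_def Z_def by linarith
    qed
    show "\<forall>\<^sub>F n in sequentially. objective (W n) (Z n) \<le> M"
      using mx[OF adm] by (auto simp: W_def Z_def)
    show "(\<lambda>n. M - inverse (real (Suc n))) \<longlonglongrightarrow> M"
      using tendsto_diff[OF tendsto_const[of M] LIMSEQ_inverse_real_of_nat] by simp
  qed auto
  \<comment> \<open>Cubic terms and objectives converge, so the Dirichlet integrals do as well,
    although nothing is known yet about convergence of the derivatives themselves.\<close>
  have Dlim: "Dn \<longlonglongrightarrow> I"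
    using tendsto_diff[OF lim_pow[of 3] objlim] by (simp add: objective_def Dn_def I_def Tg_def)
  have cauchy: "\<exists>N. \<forall>i\<ge>N. \<forall>j\<ge>N. mean (\<lambda>x. (Z i x - Z j x)\<^sup>2) < eps" if "eps > 0" for eps
  proof (rule ccontr)
    assume "\<not> ?thesis"
    then have "\<forall>N. \<exists>i j. i \<ge> N \<and> j \<ge> N \<and> eps \<le> mean (\<lambda>x. (Z i x - Z j x)\<^sup>2)" by (meson not_le)
    then obtain a b where ab: "\<And>N. a N \<ge> N" "\<And>N. b N \<ge> N"
      and big: "\<And>N. eps \<le> mean (\<lambda>x. (Z (a N) x - Z (b N) x)\<^sup>2)" by metis
    have fa: "filterlim a at_top sequentially" and fb: "filterlim b at_top sequentially"
      using ab by (auto intro!: filterlim_at_top_mono[OF filterlim_ident])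
    define V where "V = (\<lambda>n x. 1/2 * W (a n) x + 1/2 * W (b n) x)"
    define Y where "Y = (\<lambda>n x. 1/2 * Z (a n) x + 1/2 * Z (b n) x)"
    have VY: "H1 (V n) (Y n)" for n
      unfolding V_def Y_def by (rule H1_linear[OF HW(1) HW(1)])
    have Vc: "continuous_on \<T> (V n)" for n by (rule H1D(4)[OF VY])
    have V0: "mean (V n) = 0" for n
    proof -
      have i: "W j integrable_on \<T>" for j by (rule circle_integrable[OF Wc])
      then have "mean (V n) = 1/2 * mean (W (a n)) + 1/2 * mean (W (b n))"
        unfolding V_def by (subst integral_add) (auto intro: integrable_on_mult_right)
      then show ?thesis by (simp add: HW)
    qed
    have VB: "\<bar>V n x\<bar> \<le> sqrt B" if "x \<in> \<T>" for n x
      using WB[OF that, of "a n"] WB[OF that, of "b n"] by (simp add: V_def abs_le_iff)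
    have Vconv: "(\<lambda>n. V n x) \<longlonglongrightarrow> g x" if "x \<in> \<T>" for x
    proof -
      have "(\<lambda>n. W (a n) x) \<longlonglongrightarrow> g x" "(\<lambda>n. W (b n) x) \<longlonglongrightarrow> g x"
        using filterlim_compose[OF conv[OF that] fa] filterlim_compose[OF conv[OF that] fb] by auto
      from tendsto_add[OF tendsto_mult[OF tendsto_const[of "1/2"] this(1)] tendsto_mult[OF tendsto_const[of "1/2"] this(2)]]
      show ?thesis by (simp add: V_def)
    qed
    define q where "q = (\<lambda>n. mean (sq (V n)))"
    have qlim: "q \<longlonglongrightarrow> e"
      using integral_circle_power_tendsto[OF Vc VB Vconv, of 2] g2 by (simp add: q_def)
    have Tlim: "(\<lambda>n. mean (\<lambda>x. V n x ^ 3)) \<longlonglongrightarrow> Tg"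
      using integral_circle_power_tendsto[OF Vc VB Vconv, of 3] by (simp add: Tg_def)
    have X: "mean (\<lambda>x. (Z (a n) x - Z (b n) x)\<^sup>2) = 2 * Dn (a n) + 2 * Dn (b n) - 4 * mean (sq (Y n))" for n
      using integral_square_add[OF HW(4) HW(4), of 1 "a n" "-1" "b n"]
        integral_square_add[OF HW(4) HW(4), of "1/2" "a n" "1/2" "b n"]
      by (simp add: Y_def Dn_def power2_eq_square)
    \<comment> \<open>\<open>?L n\<close> is the lower bound for the Dirichlet integral of the
      midpoint, obtained by solving the rescaled inequality for it. It tends to
      \<open>Tg - M\<close>, that is \<open>I\<close>, so the parallelogram identity
      \<open>X\<close> is squeezed between eps and a limit 2 I + 2 I - 4 I = 0.\<close>
    let ?L = "\<lambda>n. (sqrt (e / q n) ^ 3 * mean (\<lambda>x. V n x ^ 3) - M) * (q n / e)"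
    have "(\<lambda>n. 2 * Dn (a n) + 2 * Dn (b n) - 4 * ?L n) \<longlonglongrightarrow> 2 * I + 2 * I - 4 * ((sqrt (e / e) ^ 3 * Tg - M) * (e / e))"
      using assms by (intro tendsto_intros qlim Tlim filterlim_compose[OF Dlim fa] filterlim_compose[OF Dlim fb]) auto
    then have lim0: "(\<lambda>n. 2 * Dn (a n) + 2 * Dn (b n) - 4 * ?L n) \<longlonglongrightarrow> 0"
      using assms by (simp add: I_def)
    have "\<forall>\<^sub>F n in sequentially. q n > 0" using order_tendstoD(1)[OF qlim assms] .
    then have "\<forall>\<^sub>F n in sequentially. eps \<le> 2 * Dn (a n) + 2 * Dn (b n) - 4 * ?L n"
    proof eventually_elim
      case (elim n)
      have "sqrt (e / q n) ^ 3 * mean (\<lambda>x. V n x ^ 3) - (e / q n) * mean (sq (Y n)) \<le> M"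
        unfolding q_def using elim assms by (intro objective_rescaled_le[OF mx _ VY V0]) (auto simp: q_def)
      then have "?L n \<le> ((e / q n) * mean (sq (Y n))) * (q n / e)"
        using elim assms by (intro mult_right_mono) auto
      also have "\<dots> = mean (sq (Y n))" using elim assms by simp
      finally show ?case using big[of n] X[of n] by linarith
    qed
    then have "eps \<le> 0" by (rule tendsto_lowerbound[OF lim0]) simp
    with that show False by simp
  qed
  obtain y where y: "y \<in> L2_per"
    and ybound: "\<And>C N. (\<And>n. n \<ge> N \<Longrightarrow> mean (sq (Z n)) \<le> C) \<Longrightarrow> mean (sq y) \<le> C"
    and yconv: "\<And>eps. eps > 0 \<Longrightarrow> \<exists>N. \<forall>n\<ge>N. mean (\<lambda>x. (Z n x - y x)\<^sup>2) \<le> eps"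
    by (rule L2_per_complete[OF HW(4) cauchy]) auto
  have yI: "mean (sq y) \<le> I"
  proof (rule field_le_epsilon)
    fix eps :: real assume "eps > 0"
    then have "\<forall>\<^sub>F n in sequentially. Dn n < I + eps" using order_tendstoD(2)[OF Dlim] by simp
    then obtain N where "\<And>n. n \<ge> N \<Longrightarrow> Dn n < I + eps" by (auto simp: eventually_sequentially)
    then show "mean (sq y) \<le> I + eps" by (intro ybound[of N]) (auto simp: Dn_def less_imp_le)
  qed
  \<comment> \<open>L2 convergence of the derivatives implies L1 convergence, which passes to
    integrals over subintervals; so y is the derivative of the uniform limit g.\<close>
  have prim: "integral {a..b} y = g b - g a" if ab: "a \<le> b" "a \<in> \<T>" "b \<in> \<T>" for a b
  proof -
    have "(\<lambda>n. W n b - W n a) \<longlonglongrightarrow> integral {a..b} y"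
    proof (rule LIMSEQ_I)
      fix eps :: real assume eps: "eps > 0"
      then obtain N where N: "\<And>n. n \<ge> N \<Longrightarrow> mean (\<lambda>x. (Z n x - y x)\<^sup>2) \<le> (eps/2)\<^sup>2" using yconv[of "(eps/2)\<^sup>2"] by auto
      have "norm (W n b - W n a - integral {a..b} y) < eps" if "n \<ge> N" for n
      proof -
        have d: "(\<lambda>x. Z n x - y x) \<in> L2_per" by (rule L2_per_diff[OF HW(4) y])
        have i: "f integrable_on {s..t}" "(\<lambda>x. \<bar>f x\<bar>) integrable_on {s..t}" if "f \<in> L2_per" for f s t
          using L2_perD(5)[OF that] by (auto simp: absolutely_integrable_on_def)
        have "W n b - W n a - integral {a..b} y = integral {a..b} (\<lambda>x. Z n x - y x)"
          using H1D(3)[OF HW(1) ab(1), of n] i[OF y] i[OF HW(4)] by (simp add: integral_diff integral_unique)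
        also have "\<bar>\<dots>\<bar> \<le> integral {a..b} (\<lambda>x. \<bar>Z n x - y x\<bar>)"
          using i[OF d] by (intro abs_integral_le) auto
        also have "\<dots> \<le> mean (\<lambda>x. \<bar>Z n x - y x\<bar>)"
          unfolding circle_def using i[OF d] ab by (intro integral_subset_le) (auto simp: circle_def)
        also have "\<dots> \<le> eps/2"
        proof (rule power2_le_imp_le)
          have "(mean (\<lambda>x. \<bar>Z n x - y x\<bar>))\<^sup>2 \<le> mean (\<lambda>x. (Z n x - y x)\<^sup>2)"
            using abs_integral_square_le[OF d, of "-1/2" "1/2"] by (simp add: circle_def)
          then show "(mean (\<lambda>x. \<bar>Z n x - y x\<bar>))\<^sup>2 \<le> (eps/2)\<^sup>2" using N[OF that] by linarith
        qed (use eps in simp)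
        also have "\<dots> < eps" using eps by simp
        finally show ?thesis by simp
      qed
      then show "\<exists>N. \<forall>n\<ge>N. norm (W n b - W n a - integral {a..b} y) < eps" by blast
    qed
    moreover have "(\<lambda>n. W n b - W n a) \<longlonglongrightarrow> g b - g a" using ab by (intro tendsto_diff conv)
    ultimately show ?thesis by (rule LIMSEQ_unique)
  qed
  have "W n (1/2) = W n (-1/2)" for n using periodic1_add[OF H1D(1)[OF HW(1)], of n "-1/2"] by simp
  then have "g (1/2) = g (-1/2)"
    using conv[of "1/2"] conv[of "-1/2"] LIMSEQ_unique by (auto simp: circle_def)
  then have "mean y = 0" using prim[of "-1/2" "1/2"] by (simp add: circle_def)
  define w0 where "w0 = (\<lambda>c x. c + integral {0..x} y - integral {x..0} y)"
  \<comment> \<open>The properties of g are known on the circle only; v is the periodic primitive of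
    y that agrees with g there.\<close>
  define v where "v = w0 (g (-1/2) - w0 0 (-1/2))"
  have v: "H1 v y" unfolding v_def w0_def by (rule H1_primitive[OF y \<open>mean y = 0\<close>])
  have v0: "v (-1/2) = g (-1/2)" by (simp add: v_def w0_def)
  have vg: "v x = g x" if "x \<in> \<T>" for x
    using H1D(3)[OF v, of "-1/2" x] prim[of "-1/2" x] that v0 by (auto simp: circle_def integral_unique)
  have "mean (\<lambda>x. v x ^ j) = mean (\<lambda>x. g x ^ j)" for j
    by (rule integral_cong) (simp add: vg)
  from this[of 1] this[of 2] this[of 3]
  have adm: "admissible e v y" and "objective v y = Tg - mean (sq y)"
    using v g1 g2 by (auto simp: admissible_def objective_def Tg_def)
  then have "objective v y \<ge> M" using yI by (simp add: I_def)
  then have "max_pair e v y" using adm mx unfolding max_pair_def by force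
  then show ?thesis by (rule that)
qed

section \<open>The Euler--Lagrange equation\<close>

definition quad_ode :: "real \<Rightarrow> real \<Rightarrow> real \<Rightarrow> (real \<Rightarrow> real) \<Rightarrow> (real \<Rightarrow> real) \<Rightarrow> bool" where
  "quad_ode A B C w y \<longleftrightarrow> (\<forall>x. (w has_real_derivative y x) (at x) \<and>
     (y has_real_derivative A * (w x)\<^sup>2 + B * w x + C) (at x))"

lemma quad_odeD:
  assumes "quad_ode A B C w y"
  shows "(w has_real_derivative y x) (at x)" "(y has_real_derivative A * (w x)\<^sup>2 + B * w x + C) (at x)"
    "continuous_on S w" "continuous_on S y"
  using assms unfolding quad_ode_def
  by (auto intro!: continuous_at_imp_continuous_on DERIV_isCont)

text \<open>The multiplier of the energy constraint comes from differentiating the rescaling factor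
  \<open>sqrt (e / \<integral> (w + t \<phi>)\<^sup>2)\<close> at \<open>t = 0\<close>.\<close>

lemma max_pair_first_variation:
  assumes m: "max_pair e w z" and e: "e > 0" and \<phi>: "\<phi> \<in> smooth_per" "mean \<phi> = 0"
  shows "2 * mean (\<lambda>x. z x * deriv \<phi> x) = 3 * mean (\<lambda>x. (w x)\<^sup>2 * \<phi> x)
    - (3 * mean (\<lambda>x. w x ^ 3) - 2 * mean (sq z)) / e * mean (\<lambda>x. w x * \<phi> x)"
proof -
  note mx = max_pairD(2)[OF m]
  note w = admissibleD[OF max_pairD(1)[OF m]]
  note wD = H1D[OF w(1)]
  note pD = H1D[OF smooth_per_H1[OF \<phi>(1)]]
  define \<alpha> where "\<alpha> = mean (\<lambda>x. w x * \<phi> x)"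
  define \<beta> where "\<beta> = mean (sq \<phi>)"
  define T where "T = mean (\<lambda>x. w x ^ 3)"
  define T1 where "T1 = mean (\<lambda>x. (w x)\<^sup>2 * \<phi> x)"
  define T2 where "T2 = mean (\<lambda>x. w x * (\<phi> x)\<^sup>2)"
  define T3 where "T3 = mean (\<lambda>x. \<phi> x ^ 3)"
  define D where "D = mean (sq z)"
  define D1 where "D1 = mean (\<lambda>x. z x * deriv \<phi> x)"
  define D2 where "D2 = mean (\<lambda>x. (deriv \<phi> x)\<^sup>2)"
  \<comment> \<open>\<open>q t\<close> is the mean of (w + t \<phi>)^2, and \<open>G t\<close> is
    the objective of w + t \<phi> after rescaling to the constraint, written as an explicit function
    of t so that it can be differentiated.\<close>
  define q where "q = (\<lambda>t. e + 2 * t * \<alpha> + t\<^sup>2 * \<beta>)"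
  define G where "G = (\<lambda>t. (sqrt (e / q t)) ^ 3 * (T + 3 * t * T1 + 3 * t\<^sup>2 * T2 + t ^ 3 * T3)
    - (e / q t) * (D + 2 * t * D1 + t\<^sup>2 * D2))"
  have Gle: "G t \<le> G 0" if "q t > 0" for t
  proof -
    let ?v = "\<lambda>x. 1 * w x + t * \<phi> x" and ?y = "\<lambda>x. 1 * z x + t * deriv \<phi> x"
    have v: "H1 ?v ?y" by (rule H1_linear[OF w(1) smooth_per_H1[OF \<phi>(1)]])
    have cont: "continuous_on \<T> w" "continuous_on \<T> \<phi>" using wD(4) pD(4) by auto
    have v0: "mean ?v = 0"
      using cont w(2) \<phi>(2) by (subst integral_add) (auto intro!: circle_integrable continuous_intros)
    have vq: "mean (\<lambda>x. (?v x)\<^sup>2) = q t"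
      unfolding integral_square_add[OF wD(5) pD(5)] by (simp add: q_def w(3) \<alpha>_def \<beta>_def)
    have vD: "mean (\<lambda>x. (?y x)\<^sup>2) = D + 2 * t * D1 + t\<^sup>2 * D2"
      unfolding integral_square_add[OF wD(2) pD(2)] by (simp add: D_def D1_def D2_def)
    have vT: "mean (\<lambda>x. ?v x ^ 3) = T + 3 * t * T1 + 3 * t\<^sup>2 * T2 + t ^ 3 * T3"
    proof -
      have "((\<lambda>x. w x ^ 3 + (3 * t) * ((w x)\<^sup>2 * \<phi> x) + (3 * t\<^sup>2) * (w x * (\<phi> x)\<^sup>2) + t ^ 3 * \<phi> x ^ 3) has_integral
         T + 3 * t * T1 + 3 * t\<^sup>2 * T2 + t ^ 3 * T3) \<T>"
        unfolding T_def T1_def T2_def T3_def using cont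
        by (intro has_integral_add has_integral_mult_right integrable_integral circle_integrable continuous_intros)
      then show ?thesis
        by (intro integral_unique) (simp add: power3_eq_cube power2_eq_square algebra_simps)
    qed
    have "(sqrt (e / q t)) ^ 3 * mean (\<lambda>x. ?v x ^ 3) - (e / q t) * mean (\<lambda>x. (?y x)\<^sup>2) \<le> objective w z"
      using objective_rescaled_le[OF mx less_imp_le[OF e] v v0] that vq by simp
    moreover have "objective w z = G 0" using e by (simp add: objective_def G_def q_def T_def D_def)
    ultimately show ?thesis unfolding vD vT by (simp add: G_def)
  qed
  have "(q \<longlongrightarrow> q 0) (at 0)" unfolding q_def by (intro tendsto_intros)
  then have "\<forall>\<^sub>F t in at 0. q t > 0" by (rule order_tendstoD) (simp add: q_def e)
  then obtain d where d: "d > 0" "\<And>t. t \<noteq> 0 \<Longrightarrow> dist t 0 < d \<Longrightarrow> q t > 0" by (auto simp: eventually_at)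
  have q0: "q 0 = e" by (simp add: q_def)
  have qd: "(q has_real_derivative 2 * \<alpha>) (at 0)"
    unfolding q_def by (auto intro!: derivative_eq_intros)
  have rd: "((\<lambda>t. e / q t) has_real_derivative - (2 * \<alpha> / e)) (at 0)"
    using e by (auto intro!: derivative_eq_intros qd simp: q0 field_simps)
  have sd: "((\<lambda>t. sqrt (e / q t)) has_real_derivative - (\<alpha> / e)) (at 0)"
  proof -
    have "(sqrt has_real_derivative inverse (sqrt 1) / 2) (at (e / q 0))"
      using e DERIV_real_sqrt[of 1] by (simp add: q0)
    from DERIV_chain2[OF this rd] show ?thesis by simp
  qed
  have s3d: "((\<lambda>t. sqrt (e / q t) ^ 3) has_real_derivative - (3 * \<alpha> / e)) (at 0)"
    using DERIV_power[OF sd, of 3] e by (simp add: q0 mult.commute)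
  have "(G has_real_derivative (- (3 * \<alpha> / e) * T + 3 * T1) - (- (2 * \<alpha> / e) * D + 2 * D1)) (at 0)"
  proof -
    have "((\<lambda>t. T + 3 * t * T1 + 3 * t\<^sup>2 * T2 + t ^ 3 * T3) has_real_derivative 3 * T1) (at 0)"
      "((\<lambda>t. D + 2 * t * D1 + t\<^sup>2 * D2) has_real_derivative 2 * D1) (at 0)"
      by (auto intro!: derivative_eq_intros)
    from DERIV_diff[OF DERIV_mult[OF s3d this(1)] DERIV_mult[OF rd this(2)]] show ?thesis
      using e by (simp add: G_def q0)
  qed
  then have "(- (3 * \<alpha> / e) * T + 3 * T1) - (- (2 * \<alpha> / e) * D + 2 * D1) = 0"
  proof (rule DERIV_local_max[OF _ d(1)]; intro allI impI)
    fix t :: real assume "\<bar>0 - t\<bar> < d"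
    then show "G t \<le> G 0" using d(2)[of t] Gle[of t] by (cases "t = 0") (auto simp: dist_real_def)
  qed
  moreover have "(3 * T - 2 * D) / e * \<alpha> = (3 * \<alpha> / e) * T - (2 * \<alpha> / e) * D"
    by (simp add: diff_divide_distrib algebra_simps)
  ultimately have "2 * D1 = 3 * T1 - (3 * T - 2 * D) / e * \<alpha>" by linarith
  then show ?thesis by (simp only: \<alpha>_def T_def T1_def D_def D1_def)
qed

text \<open>A test function has an arbitrary mean c; subtracting it reduces to the first variation.
  The terms with c contribute only through the mean e of w^2, because w has mean zero, so the
  multiplier of the mean constraint is explicit and gives the constant 3 e / 2. The weak derivative
  z agrees almost everywhere with a C^1 function y, which replaces it.\<close>

lemma max_pair_ODE:
  assumes m: "max_pair e w z" and e: "e > 0"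
  obtains y B where "max_pair e w y" "quad_ode (-3/2) B (3 * e / 2) w y"
proof -
  note mx = max_pairD(2)[OF m]
  note w = admissibleD[OF max_pairD(1)[OF m]]
  note wD = H1D[OF w(1)]
  define L where "L = (3 * mean (\<lambda>x. w x ^ 3) - 2 * mean (sq z)) / e"
  define g where "g = (\<lambda>x. (-3/2) * (w x)\<^sup>2 + (L/2) * w x + 3 * e / 2)"
  have gc: "continuous_on S g" for S unfolding g_def using wD(4) by (intro continuous_intros)
  have gL2: "g \<in> L2_per" using wD(1) gc by (intro continuous_L2_per) (simp_all add: g_def periodic1_def)
  have "has_weak_deriv z g"
    unfolding has_weak_deriv_iff[OF wD(2) gL2]
  proof
    fix \<phi> assume \<phi>: "\<phi> \<in> smooth_per"
    define c where "c = mean \<phi>"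
    note pD = H1D[OF smooth_per_H1[OF \<phi>]]
    have cont: "continuous_on \<T> w" "continuous_on \<T> \<phi>" using wD(4) pD(4) by auto
    have \<phi>c: "(\<lambda>x. \<phi> x - c) \<in> smooth_per" "deriv (\<lambda>x. \<phi> x - c) = deriv \<phi>" using smooth_per_diff_const[OF \<phi>] by auto
    have "mean (\<lambda>x. \<phi> x - c) = 0"
      using cont by (subst integral_diff) (auto simp: c_def intro!: circle_integrable continuous_intros)
    from max_pair_first_variation[OF m e \<phi>c(1) this]
    have "2 * mean (\<lambda>x. z x * deriv \<phi> x) = 3 * mean (\<lambda>x. (w x)\<^sup>2 * (\<phi> x - c)) - L * mean (\<lambda>x. w x * (\<phi> x - c))"
      by (simp add: \<phi>c(2) L_def)
    moreover have "mean (\<lambda>x. (w x)\<^sup>2 * (\<phi> x - c)) = mean (\<lambda>x. (w x)\<^sup>2 * \<phi> x) - e * c"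
      using cont w(3) unfolding right_diff_distrib
      by (subst integral_diff) (auto intro!: circle_integrable continuous_intros)
    moreover have "mean (\<lambda>x. w x * (\<phi> x - c)) = mean (\<lambda>x. w x * \<phi> x)"
      using cont w(2) unfolding right_diff_distrib
      by (subst integral_diff) (auto intro!: circle_integrable continuous_intros)
    moreover have "mean (\<lambda>x. g x * \<phi> x) =
       (-3/2) * mean (\<lambda>x. (w x)\<^sup>2 * \<phi> x) + (L/2) * mean (\<lambda>x. w x * \<phi> x) + (3 * e / 2) * c"
    proof (rule integral_unique)
      have "((\<lambda>x. (-3/2) * ((w x)\<^sup>2 * \<phi> x) + (L/2) * (w x * \<phi> x) + (3 * e / 2) * \<phi> x) has_integral
        (-3/2) * mean (\<lambda>x. (w x)\<^sup>2 * \<phi> x) + (L/2) * mean (\<lambda>x. w x * \<phi> x) + (3 * e / 2) * c) \<T>"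
        unfolding c_def using cont
        by (intro has_integral_add has_integral_mult_right integrable_integral circle_integrable continuous_intros)
      then show "((\<lambda>x. g x * \<phi> x) has_integral
        (-3/2) * mean (\<lambda>x. (w x)\<^sup>2 * \<phi> x) + (L/2) * mean (\<lambda>x. w x * \<phi> x) + (3 * e / 2) * c) \<T>"
        by (simp add: g_def algebra_simps)
    qed
    ultimately show "mean (\<lambda>x. z x * deriv \<phi> x) = - mean (\<lambda>x. g x * \<phi> x)"
      by simp
  qed
  from du_Bois_Reymond[OF wD(2) gL2 this] obtain y where y: "H1 y g" "AE x in lebesgue. z x = y x" .
  have wy: "H1 w y"
    by (rule H1_cong_AE[OF w(1) H1D(5)[OF y(1)]]) (use y(2) in \<open>auto elim: eventually_mono\<close>)
  have "quad_ode (-3/2) (L/2) (3 * e / 2) w y"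
    unfolding quad_ode_def
    using H1_DERIV[OF wy H1D(4)[OF y(1)]] H1_DERIV[OF y(1) gc] by (simp add: g_def)
  moreover have "mean (sq z) = mean (sq y)"
  proof -
    obtain N where N: "negligible N" "\<And>x. x \<notin> N \<Longrightarrow> z x = y x"
      using AE_lebesgue_negligible[OF y(2)] by blast
    from N(1) show ?thesis by (rule integral_spike) (use N(2) in auto)
  qed
  then have "max_pair e w y" using m wy by (simp add: max_pair_def admissible_def objective_def)
  ultimately show ?thesis using that by blast
qed

text \<open>Gronwall: the difference d of the solutions solves the linear equation d'' = \<kappa> d
  with |\<kappa>| \<le> K on the interval, and the exponential weight makes d^2 + d'^2
  nonincreasing.\<close>

lemma quad_ode_unique_right:
  assumes "quad_ode A B C w1 y1" "quad_ode A B C w2 y2" "w1 a = w2 a" "y1 a = y2 a" "a \<le> x"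
  shows "w1 x = w2 x"
proof -
  note o1 = quad_odeD[OF assms(1)] and o2 = quad_odeD[OF assms(2)]
  define \<kappa> where "\<kappa> = (\<lambda>t. A * (w1 t + w2 t) + B)"
  define d where "d = (\<lambda>t. w1 t - w2 t)"
  define p where "p = (\<lambda>t. y1 t - y2 t)"
  have "continuous_on {a..x} \<kappa>" unfolding \<kappa>_def using o1 o2 by (intro continuous_intros)
  then obtain K where K: "\<And>t. t \<in> {a..x} \<Longrightarrow> \<bar>\<kappa> t\<bar> \<le> K"
    using continuous_on_Icc_bounded by blast
  define F where "F = (\<lambda>t. ((d t)\<^sup>2 + (p t)\<^sup>2) * exp (- (1 + K) * (t - a)))"
  have dd: "(d has_real_derivative p t) (at t)" for t
    unfolding d_def p_def by (auto intro!: derivative_eq_intros o1 o2)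
  have pd: "(p has_real_derivative \<kappa> t * d t) (at t)" for t
    unfolding p_def d_def \<kappa>_def
    by (auto intro!: derivative_eq_intros o1(2) o2(2) simp: power2_eq_square algebra_simps)
  have "F x \<le> F a"
  proof (rule DERIV_nonpos_imp_nonincreasing[OF \<open>a \<le> x\<close>])
    fix t assume t: "a \<le> t" "t \<le> x"
    let ?D = "(2 * d t * p t + 2 * p t * (\<kappa> t * d t) - (1 + K) * ((d t)\<^sup>2 + (p t)\<^sup>2)) * exp (- (1 + K) * (t - a))"
    have "(F has_real_derivative ?D) (at t)"
      unfolding F_def by (auto intro!: derivative_eq_intros dd pd simp: algebra_simps power2_eq_square)
    moreover have "?D \<le> 0"
    proof (rule mult_nonpos_nonneg)
      have "2 * d t * p t + 2 * p t * (\<kappa> t * d t) = (1 + \<kappa> t) * (2 * d t * p t)" by (simp add: algebra_simps)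
      also have "\<dots> \<le> \<bar>1 + \<kappa> t\<bar> * \<bar>2 * d t * p t\<bar>" by (metis abs_ge_self abs_mult)
      also have "\<dots> \<le> (1 + K) * ((d t)\<^sup>2 + (p t)\<^sup>2)"
      proof (rule mult_mono)
        show "\<bar>1 + \<kappa> t\<bar> \<le> 1 + K" "0 \<le> 1 + K" using K[of t] t by auto
        show "\<bar>2 * d t * p t\<bar> \<le> (d t)\<^sup>2 + (p t)\<^sup>2"
          using sum_squares_bound[of "\<bar>d t\<bar>" "\<bar>p t\<bar>"] by (simp add: abs_mult)
      qed auto
      finally show "2 * d t * p t + 2 * p t * (\<kappa> t * d t) - (1 + K) * ((d t)\<^sup>2 + (p t)\<^sup>2) \<le> 0" by simp
    qed simp
    ultimately show "\<exists>y. (F has_real_derivative y) (at t) \<and> y \<le> 0" by blast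
  qed
  also have "F a = 0" using assms by (simp add: F_def d_def p_def)
  finally have "(d x)\<^sup>2 + (p x)\<^sup>2 \<le> 0" by (simp add: F_def mult_le_0_iff)
  then have "d x = 0" by (simp add: sum_power2_le_zero_iff)
  then show ?thesis by (simp add: d_def)
qed

lemma quad_ode_reflect:
  assumes "quad_ode A B C w y"
  shows "quad_ode A B C (\<lambda>x. w (2 * a - x)) (\<lambda>x. - y (2 * a - x))"
proof -
  have r: "((\<lambda>x. 2 * a - x) has_real_derivative -1) (at x)" for x
    by (auto intro!: derivative_eq_intros)
  show ?thesis unfolding quad_ode_def
    using DERIV_chain2[OF quad_odeD(1)[OF assms] r] DERIV_minus[OF DERIV_chain2[OF quad_odeD(2)[OF assms] r]]
    by (simp add: algebra_simps)
qed

lemma quad_ode_unique: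
  assumes "quad_ode A B C w1 y1" "quad_ode A B C w2 y2" "w1 a = w2 a" "y1 a = y2 a"
  shows "w1 = w2"
proof
  fix x
  show "w1 x = w2 x"
  proof (cases "a \<le> x")
    case False
    note unique = quad_ode_unique_right[OF quad_ode_reflect[OF assms(1), of a] quad_ode_reflect[OF assms(2), of a]]
    show ?thesis
      using unique[of a "2 * a - x"] False assms(3,4) by simp
  qed (rule quad_ode_unique_right[OF assms])
qed

text \<open>The equation is autonomous without a first-order term, so reflection preserves it; at a
  critical point the reflected solution has the same initial data.\<close>

lemma quad_ode_symmetric:
  assumes "quad_ode A B C w y" "y a = 0"
  shows "w (2 * a - x) = w x"
  using fun_cong[OF quad_ode_unique[OF quad_ode_reflect[OF assms(1), of a] assms(1), of a], of x] assms(2) by simp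

lemma quad_ode_constant:
  assumes "quad_ode A B C w y" "y a = 0" "A * (w a)\<^sup>2 + B * w a + C = 0"
  shows "w x = w a"
proof -
  have "quad_ode A B C (\<lambda>x. w a) (\<lambda>x. 0)" using assms(3) by (simp add: quad_ode_def)
  from fun_cong[OF quad_ode_unique[OF assms(1) this, of a], of x] assms(2) show ?thesis by simp
qed

section \<open>Critical points and the minimal period\<close>

lemma max_pair_nonconstant:
  assumes "max_pair e w z" "e > 0" "\<And>x. w x = c"
  shows False
proof -
  have "w = (\<lambda>x. c)" using assms(3) by auto
  then show False using assms(1,2) by (auto simp: max_pair_def admissible_def)
qed

text \<open>Otherwise w would coincide with a constant solution, and a constant of mean zero has e =
  0.\<close>

lemma max_pair_critical_nondegenerate:
  assumes "max_pair e w z" "e > 0" "quad_ode A B C w y" "y a = 0"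
  shows "A * (w a)\<^sup>2 + B * w a + C \<noteq> 0"
  using quad_ode_constant[OF assms(3,4)] max_pair_nonconstant[OF assms(1,2)] by blast

lemma max_pair_shift:
  assumes m: "max_pair e w y" and o: "quad_ode A B C w y"
  shows "max_pair e (\<lambda>x. w (x + c)) (\<lambda>x. y (x + c))"
proof -
  note w = admissibleD[OF max_pairD(1)[OF m]]
  note oD = quad_odeD[OF o]
  have yper: "periodic1 y" using L2_perD(1)[OF H1D(2)[OF w(1)]] .
  have sh: "mean (\<lambda>x. f (x + c)) = mean f" if "periodic1 f" "continuous_on UNIV f" for f :: "real \<Rightarrow> real"
  proof -
    have "mean (\<lambda>x. f (x + c)) = integral {-1/2 + c..1/2 + c} f"
      unfolding circle_def by (rule integral_shift1)
    also have "\<dots> = mean f"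
      using periodic1_integral[OF that(1) circle_integrable[OF continuous_on_subset[OF that(2)]], of "-1/2 + c"] by simp
    finally show ?thesis .
  qed
  have per: "periodic1 (\<lambda>x. w x ^ k)" "periodic1 (sq y)" for k
    using H1D(1)[OF w(1)] yper by (auto simp: periodic1_def)
  have cont: "continuous_on UNIV (\<lambda>x. w x ^ k)" "continuous_on UNIV (sq y)" for k
    using oD(3,4) by (intro continuous_intros; simp)+
  have ints: "mean (\<lambda>x. w (x + c) ^ k) = mean (\<lambda>x. w x ^ k)"
    "mean (\<lambda>x. (y (x + c))\<^sup>2) = mean (sq y)" for k
    using sh[OF per(1) cont(1)] sh[OF per(2) cont(2)] by auto
  have "H1 (\<lambda>x. w (x + c)) (\<lambda>x. y (x + c))"
    unfolding H1_def
  proof (intro conjI allI impI)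
    have eq: "x + 1 + c = (x + c) + 1" for x by simp
    show "periodic1 (\<lambda>x. w (x + c))" unfolding periodic1_def eq using H1D(1)[OF w(1)] by (simp add: periodic1_add)
    have "periodic1 (\<lambda>x. y (x + c))" unfolding periodic1_def eq using yper by (simp add: periodic1_add)
    then show "(\<lambda>x. y (x + c)) \<in> L2_per"
      by (intro continuous_L2_per continuous_on_compose2[OF oD(4)[of UNIV]] continuous_intros) auto
    fix a b :: real assume "a \<le> b"
    then show "((\<lambda>x. y (x + c)) has_integral w (b + c) - w (a + c)) {a..b}"
      using has_integral_shift_cbox[OF H1D(3)[OF w(1), of "a + c" "b + c", unfolded cbox_interval[symmetric]], of c] by simp
  qed
  then show ?thesis using m w ints(1)[of 1] ints(1)[of 2] ints(1)[of 3] ints(2)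
    by (simp add: max_pair_def admissible_def objective_def)
qed

text \<open>On [a, a + l) the integral of g is that of f over the window moved back by s. What the
  window gains on the left, [a - s, a], equals under the period l what it loses on the
  right.\<close>

lemma integral_exchange:
  fixes f g :: "real \<Rightarrow> real"
  assumes f: "continuous_on UNIV f" "periodic1 f" "\<And>x. f (x + l) = f x"
    and g: "periodic1 g" "g integrable_on \<T>"
    and gf: "\<And>x. a \<le> x \<Longrightarrow> x < a + l \<Longrightarrow> g x = f (x - s)" "\<And>x. a + l \<le> x \<Longrightarrow> x < a + 1 \<Longrightarrow> g x = f x"
    and l: "0 \<le> s" "s \<le> l" "l \<le> 1"
  shows "mean g = mean f"
proof -
  have fi: "f integrable_on {u..v}" for u v by (rule integrable_continuous_real[OF continuous_on_subset[OF f(1)]]) simp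
  have gi: "g integrable_on {u..v}" for u v by (rule periodic1_integrable_on[OF g])
  note comb = integral_split
  have "mean g = integral {a..a+l} g + integral {a+l..a+1} g"
    using periodic1_integral[OF g, of a] comb[of a "a+l" "a+1" g] gi l by simp
  also have "integral {a..a+l} g = integral {a..a+l} (\<lambda>x. f (x + (-s)))"
    by (rule integral_spike[of "{a+l}"]) (use gf in auto)
  also have "\<dots> = integral {a-s..a+l-s} f" by (subst integral_shift1) simp
  also have "\<dots> = integral {a-s..a} f + integral {a..a+l-s} f"
    using comb[of "a-s" a "a+l-s" f] fi l by simp
  also have "integral {a-s..a} f = integral {a-s..a} (\<lambda>x. f (x + l))" by (simp add: f(3))
  also have "\<dots> = integral {a+l-s..a+l} f" by (subst integral_shift1) (simp add: algebra_simps)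
  also have "integral {a+l-s..a+l} f + integral {a..a+l-s} f = integral {a..a+l} f"
    using comb[of a "a+l-s" "a+l" f] fi l by simp
  also have "integral {a+l..a+1} g = integral {a+l..a+1} f"
    by (rule integral_spike[of "{a+1}"]) (use gf in auto)
  also have "integral {a..a+l} f + integral {a+l..a+1} f = mean f"
    using periodic1_integral[OF f(2) circle_integrable[OF continuous_on_subset[OF f(1)]], of a] comb[of a "a+l" "a+1" f] fi l by simp
  finally show ?thesis .
qed

text \<open>If \<open>w\<close> had a period \<open>l < 1\<close>, one could translate one period of \<open>w\<close> within the circle and
  leave the rest unchanged. All integrals stay the same, so that the result is again a maximizer, but it
  has a kink at the junction, which contradicts the Euler--Lagrange equation.\<close>

lemma max_pair_no_smaller_period:
  assumes m: "max_pair e w y" and e: "e > 0" and o: "quad_ode A B C w y" and y0: "y 0 = 0"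
    and l: "0 < l" "l < 1" and per: "\<And>x. w (x + l) = w x"
  shows False
proof -
  note w = admissibleD[OF max_pairD(1)[OF m]]
  note oD = quad_odeD[OF o]
  have yper: "periodic1 y" using L2_perD(1)[OF H1D(2)[OF w(1)]] .
  have even: "w (- x) = w x" for x using quad_ode_symmetric[OF o y0, of x] by simp
  have odd: "y (- x) = - y x" for x by (rule derivative_of_even[OF oD(1) even])
  have yl: "y (x + l) = y x" for x
  proof -
    have "((\<lambda>x. w (x + l)) has_real_derivative y (x + l)) (at x)"
      using oD(1)[of "x + l"] by (rule DERIV_shift[THEN iffD1])
    then show ?thesis using DERIV_unique[OF _ oD(1)[of x]] by (simp add: per)
  qed
  \<comment> \<open>If y vanished on an interval, so would its derivative, and the critical points
    there would be degenerate.\<close>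
  have "\<exists>t. 0 < t \<and> t < l/2 \<and> y t \<noteq> 0"
  proof (rule ccontr)
    assume "\<not> ?thesis"
    then have z: "y t = 0" if "0 < t" "t < l/2" for t using that by auto
    have "(y has_real_derivative 0) (at (l/4))"
      by (rule has_field_derivative_transform_within_open[of "\<lambda>x. 0" _ _ "{0<..<l/2}"]) (use z l in auto)
    then have "A * (w (l/4))\<^sup>2 + B * w (l/4) + C = 0" using DERIV_unique oD(2) by blast
    then show False using max_pair_critical_nondegenerate[OF m e o, of "l/4"] z[of "l/4"] l by simp
  qed
  then obtain a where a: "0 < a" "a < l/2" "y a \<noteq> 0" by blast
  define b where "b = a + l"
  \<comment> \<open>Translating by 2 a carries -a to a. Since w is even, the translated piece has
    the right values at both ends, while the slope at -a is minus that at a;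
    \<open>y a \<noteq> 0\<close> therefore makes a kink at the junction b.\<close>
  define s where "s = 2 * a"
  have ab: "a < b" "b < a + 1" "0 \<le> s" "s \<le> l" using a l by (auto simp: b_def s_def)
  have as: "a - s = - a" "b - s = - a + l" by (simp_all add: s_def b_def)
  have wvals: "w (a - s) = w a" "w (b - s) = w a" "w b = w a" "w (a + 1) = w a"
    unfolding as even per using per[of a] periodic1_add[OF H1D(1)[OF w(1)]] by (simp_all add: b_def even)
  \<comment> \<open>The floor reduces x to the fundamental domain [a, a + 1), so the piecewise
    derivative is periodic by construction.\<close>
  define zt where "zt = (\<lambda>x. if x - of_int \<lfloor>x - a\<rfloor> < b then y (x - of_int \<lfloor>x - a\<rfloor> - s) else y (x - of_int \<lfloor>x - a\<rfloor>))"
  have zper: "periodic1 zt"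
  proof -
    have "\<lfloor>x + 1 - a\<rfloor> = \<lfloor>x - a\<rfloor> + 1" for x by linarith
    then have "x + 1 - of_int \<lfloor>x + 1 - a\<rfloor> = x - of_int \<lfloor>x - a\<rfloor>" for x by simp
    then show ?thesis unfolding periodic1_def zt_def by (simp only: simp_thms)
  qed
  have fl: "\<lfloor>x - a\<rfloor> = 0" if "a \<le> x" "x < a + 1" for x using that by (simp add: floor_eq_iff)
  have zt1: "zt x = y (x - s)" if "a \<le> x" "x < b" for x using that ab fl[of x] by (simp add: zt_def)
  have zt2: "zt x = y x" if "b \<le> x" "x < a + 1" for x using that ab fl[of x] by (simp add: zt_def)
  have ym: "y \<in> borel_measurable borel" using oD(4) by (rule borel_measurable_continuous_onI)
  have "zt \<in> borel_measurable borel" unfolding zt_def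
    by (intro measurable_If borel_measurable_diff measurable_compose[OF _ ym]) measurable
  then have zm: "zt \<in> borel_measurable lebesgue" by (intro measurable_completion) simp
  obtain K where K: "\<And>x. x \<in> {a - s..a + 1} \<Longrightarrow> \<bar>y x\<bar> \<le> K"
    using continuous_on_Icc_bounded[OF oD(4)] by blast
  have zK: "\<bar>zt x\<bar> \<le> K" for x
  proof -
    have "a \<le> x - of_int \<lfloor>x - a\<rfloor>" "x - of_int \<lfloor>x - a\<rfloor> < a + 1" by linarith+
    then show ?thesis unfolding zt_def using ab by (auto intro!: K)
  qed
  have "(sq zt) absolutely_integrable_on \<T>"
  proof (rule measurable_bounded_by_integrable_imp_absolutely_integrable)
    show "(sq zt) \<in> borel_measurable (lebesgue_on \<T>)"
      using zm by (intro measurable_restrict_space1 borel_measurable_power)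
    show "(\<lambda>x. K\<^sup>2) integrable_on \<T>" by (rule circle_integrable[OF continuous_on_const])
    show "norm ((zt x)\<^sup>2) \<le> K\<^sup>2" for x using power_mono[OF zK[of x], of 2] by simp
  qed simp
  then have zL2: "zt \<in> L2_per" using zper zm by (simp add: L2_per_def)
  have ftc: "((\<lambda>t. y (t + c)) has_integral w (v + c) - w (u + c)) {u..v}" if "u \<le> v" for u v c
    using has_integral_shift_cbox[OF H1D(3)[OF w(1), of "u + c" "v + c", unfolded cbox_interval[symmetric]], of c] that by simp
  have i1: "(zt has_integral w (x - s) - w a) {a..x}" if "a \<le> x" "x \<le> b" for x
    by (rule has_integral_spike_finite[OF _ _ ftc[OF that(1), of "-s", simplified, unfolded wvals(1)], of "{b}"])
      (use that zt1 in auto)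
  have i2: "(zt has_integral w x - w a) {b..x}" if "b \<le> x" "x \<le> a + 1" for x
    by (rule has_integral_spike_finite[OF _ _ ftc[OF that(1), of 0, simplified, unfolded wvals(3)], of "{a+1}"])
      (use that zt2 in auto)
  have zi: "zt integrable_on \<T>" using L2_perD(4)[OF zL2] by (simp add: absolutely_integrable_on_def)
  have "mean zt = integral {a..b} zt + integral {b..a+1} zt"
    using periodic1_integral[OF zper zi, of a] integral_split[of a b "a+1" zt]
      periodic1_integrable_on[OF zper zi] ab by simp
  also have "\<dots> = 0" using i1[of b] i2[of "a+1"] ab wvals by (simp add: integral_unique)
  finally have z0: "mean zt = 0" .
  define w0 where "w0 = (\<lambda>c x. c + integral {0..x} zt - integral {x..0} zt)"
  define W where "W = w0 (w a - w0 0 a)"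
  have W: "H1 W zt" unfolding W_def w0_def by (rule H1_primitive[OF zL2 z0])
  have Wa: "W a = w a" by (simp add: W_def w0_def)
  have W1: "W x = w (x - s)" if "a \<le> x" "x \<le> b" for x
    using has_integral_unique[OF H1D(3)[OF W that(1)] i1[OF that]] Wa by simp
  have W2: "W x = w x" if "b \<le> x" "x \<le> a + 1" for x
    using has_integral_unique[OF H1D(3)[OF W that(1)] i2[OF that]] W1[of b] ab wvals by simp
  note ex = integral_exchange[where a=a and l=l and s=s]
  have pw: "mean (\<lambda>x. W x ^ k) = mean (\<lambda>x. w x ^ k)" for k
  proof (rule ex)
    show "continuous_on UNIV (\<lambda>x. w x ^ k)" using oD(3) by (intro continuous_intros)
    show "(\<lambda>x. W x ^ k) integrable_on \<T>" using H1D(4)[OF W] by (intro circle_integrable continuous_intros)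
  qed (use H1D(1)[OF w(1)] H1D(1)[OF W] per W1 W2 ab l in \<open>auto simp: periodic1_def b_def\<close>)
  have pz: "mean (sq zt) = mean (sq y)"
  proof (rule ex)
    show "continuous_on UNIV (sq y)" using oD(4) by (intro continuous_intros)
    show "(sq zt) integrable_on \<T>" using L2_per_integrable(2)[OF zL2 zL2] .
  qed (use yper zper yl zt1 zt2 ab l in \<open>auto simp: periodic1_def b_def\<close>)
  have "max_pair e W zt"
    using m W pw[of 1] pw[of 2] pw[of 3] pz w by (simp add: max_pair_def admissible_def objective_def)
  from max_pair_ODE[OF this e] obtain y' B' where "quad_ode (-3/2) B' (3*e/2) W y'" by blast
  then have D: "(W has_real_derivative y' b) (at b within S)" for S
    using quad_odeD(1) has_field_derivative_at_within by blast
  have "(W has_real_derivative y (b - s)) (at b within {a..b})"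
  proof (rule has_field_derivative_transform_within[of _ _ _ _ 1])
    have "((\<lambda>x. w (x + - s)) has_real_derivative y (b + - s)) (at b)"
      using oD(1)[of "b + -s"] by (rule DERIV_shift[THEN iffD1])
    then show "((\<lambda>x. w (x - s)) has_real_derivative y (b - s)) (at b within {a..b})"
      by (simp add: has_field_derivative_at_within)
  qed (use W1 ab in auto)
  moreover have "at b within {a..b} \<noteq> bot" using ab by (simp add: at_within_Icc_at_left)
  ultimately have 1: "y' b = y (b - s)" using has_field_derivative_unique[OF D] by blast
  have "(W has_real_derivative y b) (at b within {b..a+1})"
    by (rule has_field_derivative_transform_within[OF has_field_derivative_at_within[OF oD(1)], of 1])
      (use W2 ab in auto)
  moreover have "at b within {b..a+1} \<noteq> bot" using ab by (simp add: at_within_Icc_at_right)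
  ultimately have 2: "y' b = y b" using has_field_derivative_unique[OF D] by blast
  have "y (b - s) = - y a" "y b = y a" unfolding as(2) using yl[of "-a"] yl[of a] odd by (simp_all add: b_def)
  with 1 2 a(3) show False by simp
qed

text \<open>The reflections about the critical points 0 and x would compose to a translation by 2 x,
  which is less than 1.\<close>

lemma max_pair_derivative_nonzero:
  assumes m: "max_pair e w y" and e: "e > 0" and o: "quad_ode A B C w y" and y0: "y 0 = 0"
    and x: "0 < x" "x < 1/2"
  shows "y x \<noteq> 0"
proof
  assume yx: "y x = 0"
  have "w (t + 2 * x) = w t" for t
    using quad_ode_symmetric[OF o yx, of "-t"] quad_ode_symmetric[OF o y0, of t] by (simp add: add.commute)
  from max_pair_no_smaller_period[OF m e o y0 _ _ this] x show False by simp
qed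

section \<open>The profile of a maximizer\<close>

text \<open>With \<open>f = w + m\<close> the first integral reads \<open>f'\<^sup>2 = f * (f + p) * (h - f)\<close>, where
  \<open>f\<close> decreases from \<open>h\<close> to \<open>0\<close> on half a period.\<close>

definition profile :: "real \<Rightarrow> real \<Rightarrow> real \<Rightarrow> (real \<Rightarrow> real) \<Rightarrow> (real \<Rightarrow> real) \<Rightarrow> bool" where
  "profile h p m w y \<longleftrightarrow> h > 0 \<and> p > 0 \<and> w 0 = h - m \<and> w (1/2) = - m \<and>
     (\<forall>x. (w has_real_derivative y x) (at x)) \<and> (\<forall>x. w (- x) = w x) \<and> continuous_on UNIV y \<and>
     (\<forall>x. 0 < x \<longrightarrow> x < 1/2 \<longrightarrow> y x < 0) \<and>
     (\<forall>x. (y x)\<^sup>2 = (w x + m) * (w x + m + p) * (h - (w x + m)))"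

lemma max_pair_half_period:
  assumes "max_pair e w y" "quad_ode A B C w y" "y 0 = 0"
  shows "y (1/2) = 0"
proof -
  have H: "H1 w y" using assms(1) by (simp add: max_pair_def admissible_def)
  have yper: "periodic1 y" using L2_perD(1)[OF H1D(2)[OF H]] .
  note oD = quad_odeD[OF assms(2)]
  have even: "w (- x) = w x" for x using quad_ode_symmetric[OF assms(2,3), of x] by simp
  have "y (-(1/2)) = - y (1/2)" by (rule derivative_of_even[OF oD(1) even])
  then show ?thesis using periodic1_add[OF yper, of "-(1/2)"] by simp
qed

lemma integral_circle_even:
  fixes g :: "real \<Rightarrow> real"
  assumes "continuous_on \<T> g" "\<And>x. g (- x) = g x"
  shows "mean g = 2 * integral {0..1/2} g"
proof -
  have i: "g integrable_on {-1/2..1/2}" using circle_integrable[OF assms(1)] by (simp add: circle_def)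
  have "mean g = integral {-1/2..0} g + integral {0..1/2} g"
    unfolding circle_def using i by (intro integral_split[symmetric]) auto
  also have "integral {-1/2..0} g = integral {0..1/2} g"
    using Henstock_Kurzweil_Integration.integral_reflect_real[of "1/2" 0 g] assms(2) by simp
  finally show ?thesis by simp
qed

text \<open>The first integral is a cubic in w that vanishes at the extreme values b and c, and its
  third root follows from the sum of the roots. The work lies in placing this root strictly below b,
  which is p > 0.\<close>

lemma max_pair_profile:
  assumes m: "max_pair e w y" and e: "e > 0" and o: "quad_ode (-3/2) B (3 * e / 2) w y"
    and y0: "y 0 = 0" and w0: "w 0 > 0"
  obtains h p m where "profile h p m w y" "B = h - 3 * m - p"
proof -
  note w = admissibleD[OF max_pairD(1)[OF m]]
  note oD = quad_odeD[OF o]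
  note nz = max_pair_derivative_nonzero[OF m e o y0]
  have even: "w (- x) = w x" for x using quad_ode_symmetric[OF o y0, of x] by simp
  \<comment> \<open>A sign change would produce a zero, so y has one sign on the half period. If it
    were positive, w would be at least w 0 > 0 on the circle, contrary to mean zero.\<close>
  have yneg: "y x < 0" if x: "0 < x" "x < 1/2" for x
  proof (rule ccontr)
    assume "\<not> y x < 0"
    then have yx: "y x > 0" using nz[OF x] by simp
    have ypos: "y t > 0" if t: "0 < t" "t < 1/2" for t
    proof (rule ccontr)
      assume "\<not> y t > 0"
      then have "y t < 0" using nz[OF t] by simp
      have "\<exists>s. min t x \<le> s \<and> s \<le> max t x \<and> y s = 0"
      proof (cases "t \<le> x")
        case True
        then show ?thesis using IVT'[of y t 0 x] \<open>y t < 0\<close> yx oD(4) by (auto simp: min_def max_def)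
      next
        case False
        then show ?thesis using IVT2'[of y t 0 x] \<open>y t < 0\<close> yx oD(4) by (auto simp: min_def max_def)
      qed
      then show False using nz x t by (auto simp: min_def max_def split: if_splits)
    qed
    have pos: "w t \<ge> w 0" if t: "0 \<le> t" "t \<le> 1/2" for t
    proof (rule DERIV_nonneg_imp_increasing_open[OF t(1)])
      show "\<exists>y. (w has_real_derivative y) (at s) \<and> 0 \<le> y" if "0 < s" "s < t" for s
        using oD(1) ypos[of s] that t by (intro exI[of _ "y s"]) auto
    qed (rule oD(3))
    have "w t \<ge> w 0" if "t \<in> \<T>" for t
      using pos[of "\<bar>t\<bar>"] that even[of t] by (cases "t \<ge> 0") (auto simp: circle_def)
    then have "mean (\<lambda>t. w 0) \<le> mean w"
      using oD(3) by (intro integral_le circle_integrable) auto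
    then show False using w w0 by simp
  qed
  define b where "b = w (1/2)"
  define c where "c = w 0"
  \<comment> \<open>The third root: the roots of \<open>Q s - Q c\<close> in s add up to B.\<close>
  define a where "a = B - b - c"
  define Q where "Q = (\<lambda>s. - (s ^ 3) + B * s\<^sup>2 + 3 * e * s)"
  have dec: "w u < w v" if "0 \<le> v" "v < u" "u \<le> 1/2" for u v
    by (rule DERIV_neg_imp_decreasing_open[OF that(2)]) (use oD that yneg in \<open>auto intro!: exI[of _ "y _"]\<close>)
  have bc: "b < c" using dec[of 0 "1/2"] by (simp add: b_def c_def)
  have fi: "(y x)\<^sup>2 = Q (w x) - Q c" for x
  proof -
    have "((\<lambda>x. (y x)\<^sup>2 - Q (w x)) has_real_derivative 0) (at x)" for x
      unfolding Q_def
      by (auto intro!: derivative_eq_intros oD(1,2)) (simp add: power2_eq_square power3_eq_cube algebra_simps)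
    then have "(y x)\<^sup>2 - Q (w x) = (y 0)\<^sup>2 - Q (w 0)" using DERIV_isconst_all[of "\<lambda>x. (y x)\<^sup>2 - Q (w x)" x 0] by blast
    then show ?thesis using y0 by (simp add: c_def)
  qed
  have "Q b = Q c" using fi[of "1/2"] max_pair_half_period[OF m o y0] by (simp add: b_def)
  then have "(b - c) * (- (b\<^sup>2 + b * c + c\<^sup>2) + B * (b + c) + 3 * e) = 0"
    by (simp add: Q_def power2_eq_square power3_eq_cube algebra_simps)
  then have eqe: "3 * e = b\<^sup>2 + b * c + c\<^sup>2 - B * (b + c)" using bc by simp
  have fact: "(y x)\<^sup>2 = (w x - b) * (w x - a) * (c - w x)" for x
    unfolding fi Q_def a_def eqe by (simp add: power2_eq_square power3_eq_cube algebra_simps)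
  have aw: "a < w x" if "0 < x" "x < 1/2" for x
  proof -
    have "w x - b > 0" "c - w x > 0" using dec[of 0 x] dec[of x "1/2"] that by (auto simp: b_def c_def)
    moreover have "(w x - b) * (w x - a) * (c - w x) > 0" using fact[of x] yneg[OF that] by (metis zero_less_power2 less_irrefl)
    ultimately show ?thesis by (simp add: zero_less_mult_iff)
  qed
  \<comment> \<open>Otherwise w would, by the intermediate value theorem, take a value strictly
    between b and \<open>min a c\<close>, where the cubic is negative although it equals
    y^2.\<close>
  have "a \<le> b"
  proof (rule ccontr)
    assume "\<not> a \<le> b"
    then have "min a c > b" using bc by simp
    then have "\<exists>x\<ge>0. x \<le> 1/2 \<and> w x = (b + min a c) / 2"
      using bc oD(3) by (intro IVT2') (auto simp: b_def[symmetric] c_def[symmetric] min_def)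
    then obtain x where x: "0 \<le> x" "x \<le> 1/2" "w x = (b + min a c) / 2" by blast
    have "w x \<noteq> b" "w x \<noteq> c" "w x < a" using x(3) \<open>min a c > b\<close> bc by (auto simp: min_def split: if_splits)
    then have "x \<noteq> 0" "x \<noteq> 1/2" unfolding b_def c_def by metis+
    then show False using aw[of x] x(1,2) \<open>w x < a\<close> by auto
  qed
  \<comment> \<open>A double root at b means that the second derivative of w vanishes at the
    critical point 1/2.\<close>
  moreover have "a \<noteq> b"
  proof
    assume "a = b"
    then have B: "B = 2 * b + c" by (simp add: a_def)
    have "3 * e = - b\<^sup>2 - 2 * b * c"
      unfolding eqe B by (simp add: power2_eq_square algebra_simps)
    then have e': "3 * e / 2 = (- b\<^sup>2 - 2 * b * c) / 2" by simp
    have "(-3/2) * b\<^sup>2 + B * b + 3 * e / 2 = 0"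
      unfolding e' B by (simp add: power2_eq_square field_simps)
    then show False
      using max_pair_critical_nondegenerate[OF m e o max_pair_half_period[OF m o y0]] unfolding b_def by blast
  qed
  ultimately have "a < b" by simp
  have "profile (c - b) (b - a) (- b) w y"
    unfolding profile_def using \<open>a < b\<close> bc oD even yneg fact
    by (auto simp: b_def[symmetric] c_def[symmetric] algebra_simps)
  then show ?thesis by (rule that) (simp add: a_def)
qed

lemma profileD:
  assumes P: "profile h p m w y" and f_def: "f = (\<lambda>x. w x + m)"
  shows "h > 0" "p > 0" "f 0 = h" "f (1/2) = 0" "(f has_real_derivative y x) (at x)" "continuous_on S f"
    "0 < x \<Longrightarrow> x < 1/2 \<Longrightarrow> y x < 0" "(y x)\<^sup>2 = f x * (f x + p) * (h - f x)" "f (- x) = f x"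
    "0 < x \<Longrightarrow> x < 1/2 \<Longrightarrow> 0 < f x \<and> f x < h" "x \<in> {0..1/2} \<Longrightarrow> 0 \<le> f x \<and> f x \<le> h"
proof -
  show f: "h > 0" "p > 0" "f 0 = h" "f (1/2) = 0" "(y x)\<^sup>2 = f x * (f x + p) * (h - f x)" "f (- x) = f x"
    using P by (auto simp: profile_def f_def)
  have D: "(f has_real_derivative y x) (at x)" for x
    using P by (auto simp: profile_def f_def intro!: derivative_eq_intros)
  then show "(f has_real_derivative y x) (at x)" .
  have fc: "continuous_on S f" for S
    using D by (intro continuous_at_imp_continuous_on) (auto intro: DERIV_isCont)
  then show "continuous_on S f" .
  have yneg: "y x < 0" if "0 < x" "x < 1/2" for x using P that by (simp add: profile_def)
  then show "0 < x \<Longrightarrow> x < 1/2 \<Longrightarrow> y x < 0" .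
  have dec: "f u < f v" if "0 \<le> v" "v < u" "u \<le> 1/2" for u v
    by (rule DERIV_neg_imp_decreasing_open[OF that(2)]) (use D that yneg fc in \<open>auto intro!: exI[of _ "y _"]\<close>)
  show *: "0 < f x \<and> f x < h" if "0 < x" "x < 1/2" for x
    using dec[of 0 x] dec[of x "1/2"] that f by simp
  show "x \<in> {0..1/2} \<Longrightarrow> 0 \<le> f x \<and> f x \<le> h"
    using *[of x] f by (cases "x = 0"; cases "x = 1/2"; force)
qed

text \<open>Substitution f = h cos^2 t. For \<open>th x = arccos (sqrt (f x / h))\<close> the
  vanishing factors of f' cancel and th' = sqrt (f + p) / 2 stays away from 0. Since arccos and sqrt
  are singular at the two end points, the fundamental theorem is used with differentiability in the
  interior only.\<close>

lemma profile_integral: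
  assumes P: "profile h p m w y" and \<Phi>: "continuous_on {0..h} \<Phi>"
  shows "((\<lambda>x. \<Phi> (w x + m)) has_integral
    integral {0..pi/2} (\<lambda>t. \<Phi> (h * (cos t)\<^sup>2) * (2 / sqrt (h * (cos t)\<^sup>2 + p)))) {0..1/2}"
proof -
  define f where "f = (\<lambda>x. w x + m)"
  note h = profileD(1)[OF P f_def] and p = profileD(2)[OF P f_def]
  note f0 = profileD(3)[OF P f_def] and f1 = profileD(4)[OF P f_def] and D = profileD(5)[OF P f_def]
    and fc = profileD(6)[OF P f_def] and yneg = profileD(7)[OF P f_def] and y2 = profileD(8)[OF P f_def]
    and f01 = profileD(11)[OF P f_def]
  define k where "k = (\<lambda>t. \<Phi> (h * (cos t)\<^sup>2) * (2 / sqrt (h * (cos t)\<^sup>2 + p)))"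
  have hc: "0 \<le> h * (cos t)\<^sup>2" "h * (cos t)\<^sup>2 \<le> h" for t
    using h by (auto simp: mult_le_cancel_left1 abs_square_le_1)
  have kc: "continuous_on {0..pi/2} k" unfolding k_def
  proof (intro continuous_intros continuous_on_compose2[OF \<Phi>])
    show "\<forall>t\<in>{0..pi/2}. sqrt (h * (cos t)\<^sup>2 + p) \<noteq> 0" using hc(1) p by (simp add: add_nonneg_eq_0_iff)
  qed (use hc in auto)
  define A where "A = (\<lambda>t. integral {0..t} k)"
  define th where "th = (\<lambda>x. arccos (sqrt (f x / h)))"
  have r01: "0 \<le> sqrt (f x / h)" "sqrt (f x / h) \<le> 1" if "x \<in> {0..1/2}" for x
    using f01[OF that] h by (auto simp: divide_le_eq_1)
  have th01: "th x \<in> {0..pi/2}" if "x \<in> {0..1/2}" for x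
  proof -
    have "-1 \<le> sqrt (f x / h)" using r01(1)[OF that] by linarith
    then show ?thesis using arccos_lbound arccos_le_pi2[OF r01(1)[OF that]] r01(2)[OF that] by (simp add: th_def)
  qed
  have thc: "continuous_on {0..1/2} th" unfolding th_def
    using r01 h by (intro continuous_on_arccos continuous_on_real_sqrt continuous_on_divide fc continuous_on_const)
      (auto intro: order_trans[of "-1" 0])
  have Ac: "continuous_on {0..pi/2} A" unfolding A_def
    by (intro indefinite_integral_continuous_1 integrable_continuous_real kc)
  have "((\<lambda>x. \<Phi> (f x)) has_integral A (th (1/2)) - A (th 0)) {0..1/2}"
  proof (rule fundamental_theorem_of_calculus_interior)
    show "continuous_on {0..1/2} (\<lambda>x. A (th x))"
      by (rule continuous_on_compose2[OF Ac thc]) (use th01 in auto)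
    fix x :: real assume x: "x \<in> {0<..<1/2}"
    have fx: "0 < f x" "f x < h" using profileD(10)[OF P f_def] x by auto
    define r where "r = sqrt (f x / h)"
    have r: "0 < r" "r < 1" "r\<^sup>2 = f x / h" using fx h by (auto simp: r_def)
    have cos_th: "h * (cos (th x))\<^sup>2 = f x"
      using r h by (simp add: th_def r_def[symmetric])
    have thx: "th x \<in> {0<..<pi/2}"
    proof -
      have "th x = arccos r" by (simp add: th_def r_def)
      then have "cos (th x) = r" using r by simp
      moreover have "cos (pi/2) \<noteq> r" "cos 0 \<noteq> r" using r by auto
      ultimately have "th x \<noteq> 0" "th x \<noteq> pi/2" by metis+
      then show ?thesis using th01[of x] x by auto
    qed
    have rd: "((\<lambda>x. sqrt (f x / h)) has_real_derivative inverse r / 2 * (y x / h)) (at x)"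
      unfolding r_def by (rule DERIV_chain2[OF DERIV_real_sqrt]) (use fx h in \<open>auto intro!: derivative_eq_intros D\<close>)
    have "(arccos has_real_derivative inverse (- sqrt (1 - r\<^sup>2))) (at (sqrt (f x / h)))"
      unfolding r_def[symmetric] using r by (intro DERIV_arccos) auto
    from DERIV_chain2[OF this rd] have thd: "(th has_real_derivative inverse (- sqrt (1 - r\<^sup>2)) * (inverse r / 2 * (y x / h))) (at x)"
      by (simp add: th_def)
    have eq: "inverse (- sqrt (1 - r\<^sup>2)) * (inverse r / 2 * (y x / h)) = sqrt (f x + p) / 2"
    proof -
      have "- y x = sqrt ((y x)\<^sup>2)" using yneg[of x] x by simp
      also have "\<dots> = sqrt (f x) * sqrt (f x + p) * sqrt (h - f x)" by (simp add: y2 real_sqrt_mult)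
      finally have yx: "y x = - (sqrt (f x) * sqrt (f x + p) * sqrt (h - f x))" by simp
      have "1 - r\<^sup>2 = (h - f x) / h" using r h by (simp add: field_simps)
      then have 1: "sqrt (1 - r\<^sup>2) * sqrt h = sqrt (h - f x)" using h by (simp add: real_sqrt_divide)
      have 2: "r * sqrt h = sqrt (f x)" using h by (simp add: r_def real_sqrt_divide)
      have "(r * sqrt h) * (sqrt (1 - r\<^sup>2) * sqrt h) = (sqrt h * sqrt h) * (r * sqrt (1 - r\<^sup>2))"
        by (simp only: mult_ac)
      then have prod: "h * (r * sqrt (1 - r\<^sup>2)) = sqrt (f x) * sqrt (h - f x)"
        using h by (simp add: 1 2)
      have "inverse (- sqrt (1 - r\<^sup>2)) * (inverse r / 2 * (y x / h)) = - y x / (2 * (h * (r * sqrt (1 - r\<^sup>2))))"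
      proof -
        have "inverse (- S) * (inverse u / 2 * (v / h)) = - v / (2 * (h * (u * S)))" for S u v :: real
          by (simp add: field_simps)
        then show ?thesis .
      qed
      also have "\<dots> = sqrt (f x + p) / 2"
      proof -
        have "- (- (u * v * s)) / (2 * (u * s)) = v / 2" if "u > 0" "s > 0" for u v s :: real
          using that by simp
        then show ?thesis unfolding prod yx using fx by simp
      qed
      finally show ?thesis .
    qed
    have thd': "(th has_real_derivative sqrt (f x + p) / 2) (at x)" using thd unfolding eq .
    have "(A has_real_derivative k (th x)) (at (th x) within {0..pi/2})"
      unfolding A_def using thx by (intro integral_has_real_derivative kc) auto
    then have "(A has_real_derivative k (th x)) (at (th x))"
      using thx by (subst (asm) at_within_interior) auto
    from DERIV_chain2[OF this thd']
    have "((\<lambda>x. A (th x)) has_real_derivative k (th x) * (sqrt (f x + p) / 2)) (at x)" .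
    also have "k (th x) * (sqrt (f x + p) / 2) = \<Phi> (f x)"
      unfolding k_def cos_th using fx p by simp
    finally show "((\<lambda>x. A (th x)) has_vector_derivative \<Phi> (f x)) (at x)"
      by (simp add: has_real_derivative_iff_has_vector_derivative)
  qed auto
  moreover have "th (1/2) = pi/2" "th 0 = 0" using f0 f1 h by (auto simp: th_def)
  ultimately show ?thesis by (simp add: A_def f_def k_def)
qed

text \<open>For i = 0 this is the complete elliptic integral of the first kind with k^2 = 1 / (1 +
  eps), divided by sqrt (1 + eps).\<close>

definition ell_moment :: "nat \<Rightarrow> real \<Rightarrow> real" where
  "ell_moment i eps = integral {0..pi/2} (\<lambda>t. (cos t) ^ (2 * i) / sqrt ((cos t)\<^sup>2 + eps))"

lemma ell_moment_continuous:
  assumes "eps > 0"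
  shows "continuous_on S (\<lambda>t::real. (cos t) ^ k / sqrt ((cos t)\<^sup>2 + eps))"
proof (intro continuous_intros ballI)
  show "sqrt ((cos t)\<^sup>2 + eps) \<noteq> 0" for t :: real
    using assms zero_le_power2[of "cos t"] by (simp add: add_nonneg_eq_0_iff)
qed

lemma profile_moment:
  assumes P: "profile h p m w y"
  shows "mean (\<lambda>x. (w x + m) ^ i) = 4 * h ^ i / sqrt h * ell_moment i (p / h)"
proof -
  have h: "h > 0" "p > 0" and even: "\<And>x. w (- x) = w x" and D: "\<And>x. (w has_real_derivative y x) (at x)"
    using P by (auto simp: profile_def)
  have wc: "continuous_on S w" for S using D by (intro continuous_at_imp_continuous_on) (auto intro: DERIV_isCont)
  have "mean (\<lambda>x. (w x + m) ^ i) = 2 * integral {0..1/2} (\<lambda>x. (w x + m) ^ i)"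
    using wc even by (intro integral_circle_even continuous_intros) auto
  also have "integral {0..1/2} (\<lambda>x. (w x + m) ^ i) =
     integral {0..pi/2} (\<lambda>t. (h * (cos t)\<^sup>2) ^ i * (2 / sqrt (h * (cos t)\<^sup>2 + p)))"
    by (rule integral_unique[OF profile_integral[OF P, of "\<lambda>s. s ^ i"]]) (intro continuous_intros)
  also have "\<dots> = integral {0..pi/2} (\<lambda>t. (2 * h ^ i / sqrt h) * ((cos t) ^ (2 * i) / sqrt ((cos t)\<^sup>2 + p / h)))"
  proof (rule integral_cong)
    fix t
    have "sqrt (h * (cos t)\<^sup>2 + p) = sqrt h * sqrt ((cos t)\<^sup>2 + p / h)"
      using h by (simp flip: real_sqrt_mult) (simp add: field_simps)
    then show "(h * (cos t)\<^sup>2) ^ i * (2 / sqrt (h * (cos t)\<^sup>2 + p)) =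
      (2 * h ^ i / sqrt h) * ((cos t) ^ (2 * i) / sqrt ((cos t)\<^sup>2 + p / h))"
      by (simp add: power_mult_distrib power_mult)
  qed
  also have "\<dots> = (2 * h ^ i / sqrt h) * ell_moment i (p / h)"
    unfolding ell_moment_def by (rule integral_mult_right)
  finally show ?thesis by simp
qed

section \<open>Uniqueness\<close>

lemma ell_moment_pos:
  assumes "eps > 0" shows "ell_moment 0 eps > 0"
proof -
  have "integral {0..pi/2} (\<lambda>t. 0 :: real) < integral {0..pi/2} (\<lambda>t. (cos t) ^ (2 * 0) / sqrt ((cos t)\<^sup>2 + eps))"
  proof (rule integral_less_real)
    show "0 < cos t ^ (2 * 0) / sqrt ((cos t)\<^sup>2 + eps)" for t
      using assms zero_le_power2[of "cos t"] by (simp add: add_nonneg_pos)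
    show "{0<..<pi/2} \<noteq> {}" using pi_half_gt_zero by (simp only: greaterThanLessThan_empty_iff not_le not_False_eq_True)
  qed (use ell_moment_continuous[OF assms, of _ 0] in auto)
  then show ?thesis by (simp add: ell_moment_def)
qed

lemma ell_weight_less:
  assumes "0 < eps1" "eps1 < eps2"
  shows "1 / sqrt ((cos t)\<^sup>2 + eps2) < 1 / sqrt ((cos t)\<^sup>2 + eps1)"
  using assms zero_le_power2[of "cos t"] by (intro divide_strict_left_mono mult_pos_pos) (auto simp: add_nonneg_pos)

lemma ell_moment_0_less:
  assumes "0 < eps1" "eps1 < eps2"
  shows "ell_moment 0 eps2 < ell_moment 0 eps1"
  unfolding ell_moment_def
proof (rule integral_less_real)
  show "cos t ^ (2 * 0) / sqrt ((cos t)\<^sup>2 + eps2) < cos t ^ (2 * 0) / sqrt ((cos t)\<^sup>2 + eps1)" for t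
    using ell_weight_less[OF assms, of t] by simp
  show "{0<..<pi/2} \<noteq> {}" using pi_half_gt_zero by (simp only: greaterThanLessThan_empty_iff not_le not_False_eq_True)
qed (use ell_moment_continuous[of eps1 _ 0] ell_moment_continuous[of eps2 _ 0] assms in auto)

text \<open>Eliminating h and m from the moment relations leaves 256 times this expression for e. It
  is the fourth power of \<open>ell_moment 0 eps\<close> times the variance of cos^2 under the
  normalized weight 1 / sqrt (cos^2 + eps).\<close>

definition ell_variance :: "real \<Rightarrow> real" where
  "ell_variance eps = (ell_moment 0 eps)\<^sup>2 *
     (ell_moment 0 eps * ell_moment 2 eps - (ell_moment 1 eps)\<^sup>2)"

lemma ell_second_moment:
  assumes "eps > 0"
  shows "((\<lambda>t. ((cos t)\<^sup>2 - c)\<^sup>2 / sqrt ((cos t)\<^sup>2 + eps)) has_integral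
    ell_moment 2 eps - 2 * c * ell_moment 1 eps + c\<^sup>2 * ell_moment 0 eps) {0..pi/2}"
proof -
  have i: "((\<lambda>t. (cos t) ^ (2 * k) / sqrt ((cos t)\<^sup>2 + eps)) has_integral ell_moment k eps) {0..pi/2}" for k
    unfolding ell_moment_def
    by (intro integrable_integral integrable_continuous_real ell_moment_continuous assms)
  have "((\<lambda>t. cos t ^ (2 * 2) / sqrt ((cos t)\<^sup>2 + eps) - 2 * c * (cos t ^ (2 * 1) / sqrt ((cos t)\<^sup>2 + eps))
       + c\<^sup>2 * (cos t ^ (2 * 0) / sqrt ((cos t)\<^sup>2 + eps))) has_integral
    ell_moment 2 eps - 2 * c * ell_moment 1 eps + c\<^sup>2 * ell_moment 0 eps) {0..pi/2}"
    by (intro has_integral_add has_integral_diff has_integral_mult_right i)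
  moreover have "cos t ^ (2 * 2) / sqrt ((cos t)\<^sup>2 + eps) - 2 * c * (cos t ^ (2 * 1) / sqrt ((cos t)\<^sup>2 + eps))
       + c\<^sup>2 * (cos t ^ (2 * 0) / sqrt ((cos t)\<^sup>2 + eps)) = ((cos t)\<^sup>2 - c)\<^sup>2 / sqrt ((cos t)\<^sup>2 + eps)" for t
    by (simp add: power2_eq_square diff_divide_distrib add_divide_distrib algebra_simps numeral_eq_Suc)
  ultimately show ?thesis by simp
qed

text \<open>Up to the factor \<open>(ell_moment 0)\<^sup>2\<close> this is the minimum over \<open>c\<close> of
  \<open>(\<integral> \<rho>) * (\<integral> \<rho> * (cos\<^sup>2 - c)\<^sup>2)\<close> with \<open>\<rho> = 1 / sqrt (cos\<^sup>2 + eps)\<close>, hence monotone in the weight \<open>\<rho>\<close>.\<close>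

lemma ell_variance_less:
  assumes eps: "0 < eps1" "eps1 < eps2" and pos: "ell_variance eps1 > 0"
  shows "ell_variance eps2 < ell_variance eps1"
proof -
  let ?j = ell_moment
  \<comment> \<open>Optimal for eps1, hence equality there; for eps2 it is just some constant, which
    can only increase the quadratic expression above its minimum.\<close>
  define c where "c = ?j 1 eps1 / ?j 0 eps1"
  define V1 where "V1 = ?j 2 eps1 - 2 * c * ?j 1 eps1 + c\<^sup>2 * ?j 0 eps1"
  define V2 where "V2 = ?j 2 eps2 - 2 * c * ?j 1 eps2 + c\<^sup>2 * ?j 0 eps2"
  have j: "0 < ?j 0 eps2" "?j 0 eps2 < ?j 0 eps1" "0 < ?j 0 eps1"
    using ell_moment_pos[of eps1] ell_moment_pos[of eps2] ell_moment_0_less[OF eps] eps by auto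
  have V21: "V2 \<le> V1" unfolding V1_def V2_def
  proof (rule has_integral_le[OF ell_second_moment ell_second_moment])
    show "((cos t)\<^sup>2 - c)\<^sup>2 / sqrt ((cos t)\<^sup>2 + eps2) \<le> ((cos t)\<^sup>2 - c)\<^sup>2 / sqrt ((cos t)\<^sup>2 + eps1)" for t
      using mult_left_mono[OF less_imp_le[OF ell_weight_less[OF eps, of t]], of "((cos t)\<^sup>2 - c)\<^sup>2"] by simp
  qed (use eps in auto)
  have "?j 0 eps1 * V1 = ?j 0 eps1 * ?j 2 eps1 - (?j 1 eps1)\<^sup>2"
    unfolding V1_def c_def using j by (simp add: field_simps power2_eq_square)
  then have e1: "ell_variance eps1 = (?j 0 eps1) ^ 3 * V1"
    by (simp add: ell_variance_def power2_eq_square power3_eq_cube)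
  have V1: "V1 > 0" using pos j unfolding e1 by (simp add: zero_less_mult_iff)
  have "?j 0 eps2 * V2 = ?j 0 eps2 * ?j 2 eps2 - (?j 1 eps2)\<^sup>2 + (?j 1 eps2 - c * ?j 0 eps2)\<^sup>2"
    unfolding V2_def by (simp add: power2_eq_square algebra_simps)
  then have "?j 0 eps2 * ?j 2 eps2 - (?j 1 eps2)\<^sup>2 \<le> ?j 0 eps2 * V2" by simp
  then have "ell_variance eps2 \<le> (?j 0 eps2)\<^sup>2 * (?j 0 eps2 * V2)"
    unfolding ell_variance_def by (intro mult_left_mono) auto
  also have "\<dots> = (?j 0 eps2) ^ 3 * V2" by (simp add: power2_eq_square power3_eq_cube)
  also have "\<dots> \<le> (?j 0 eps2) ^ 3 * V1" using V21 j by (intro mult_left_mono) auto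
  also have "\<dots> < (?j 0 eps1) ^ 3 * V1" using V1 j by (intro mult_strict_right_mono power_strict_mono) auto
  finally show ?thesis unfolding e1 .
qed

text \<open>\<open>profile_moment\<close> for the exponents 0 to 3. For exponent 0 the left side is
  1, and this turns the length of the circle into an equation for h.\<close>

lemma profile_relations:
  assumes P: "profile h p m w y" and a: "admissible e w y"
  shows "sqrt h = 4 * ell_moment 0 (p / h)"
    and "m = 4 * sqrt h * ell_moment 1 (p / h)"
    and "e = 4 * sqrt h ^ 3 * ell_moment 2 (p / h) - m\<^sup>2"
    and "mean (\<lambda>x. (w x + m) ^ 3) = 4 * sqrt h ^ 5 * ell_moment 3 (p / h)"
proof -
  have h: "h > 0" using P by (simp add: profile_def)
  have hh: "h = sqrt h * sqrt h" using h by simp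
  note w = admissibleD[OF a]
  have wc: "continuous_on \<T> w" by (rule H1D(4)[OF w(1)])
  note M = profile_moment[OF P]
  define s where "s = sqrt h"
  have s: "s > 0" "h = s * s" "sqrt h = s" using h by (auto simp: s_def)
  show "sqrt h = 4 * ell_moment 0 (p / h)" using M[of 0] s(1) by (simp add: s(3) field_simps)
  have "mean (\<lambda>x. (w x + m) ^ 1) = m"
    using w(2) wc by (simp add: integral_add circle_integrable)
  then show m: "m = 4 * sqrt h * ell_moment 1 (p / h)"
    using M[of 1] s(1) unfolding s(3) by (simp add: s(2))
  have "((\<lambda>x. (w x)\<^sup>2 + 2 * m * w x + m\<^sup>2) has_integral e + 2 * m * 0 + m\<^sup>2) \<T>"
    using wc w(2,3) by (intro has_integral_add has_integral_mult_right)
      (auto simp: has_integral_integrable_integral intro!: circle_integrable continuous_intros)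
  then have "mean (\<lambda>x. (w x + m)\<^sup>2) = e + m\<^sup>2"
    by (intro integral_unique) (simp add: power2_eq_square algebra_simps)
  then show "e = 4 * sqrt h ^ 3 * ell_moment 2 (p / h) - m\<^sup>2"
    using M[of 2] s(1) unfolding s(3) by (simp add: s(2) power2_eq_square power3_eq_cube field_simps)
  show "mean (\<lambda>x. (w x + m) ^ 3) = 4 * sqrt h ^ 5 * ell_moment 3 (p / h)"
    using M[of 3] s(1) unfolding s(3) by (simp add: s(2) power3_eq_cube numeral_eq_Suc field_simps)
qed

lemma profile_energy:
  assumes "profile h p m w y" "admissible e w y"
  shows "e = 256 * ell_variance (p / h)"
  unfolding ell_variance_def profile_relations(3)[OF assms] profile_relations(2)[OF assms]
    profile_relations(1)[OF assms]
  by (simp add: power2_eq_square power3_eq_cube algebra_simps)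

text \<open>Equal energies give equal ratios p / h by strict monotonicity, and the moment relations
  then give h, p and m. Thus both functions solve the same equation with the same data w 0 = h - m
  and y 0 = 0.\<close>

lemma normalized_max_pair_unique:
  assumes e: "e > 0"
    and 1: "max_pair e w1 y1" "quad_ode (-3/2) B1 (3 * e / 2) w1 y1" "y1 0 = 0" "w1 0 > 0"
    and 2: "max_pair e w2 y2" "quad_ode (-3/2) B2 (3 * e / 2) w2 y2" "y2 0 = 0" "w2 0 > 0"
  shows "w1 = w2"
proof -
  obtain h1 p1 m1 where P1: "profile h1 p1 m1 w1 y1" "B1 = h1 - 3 * m1 - p1"
    by (rule max_pair_profile[OF 1(1) e 1(2-4)])
  obtain h2 p2 m2 where P2: "profile h2 p2 m2 w2 y2" "B2 = h2 - 3 * m2 - p2"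
    by (rule max_pair_profile[OF 2(1) e 2(2-4)])
  have a: "admissible e w1 y1" "admissible e w2 y2" using 1 2 by (auto simp: max_pair_def)
  have h: "h1 > 0" "p1 > 0" "h2 > 0" "p2 > 0" using P1 P2 by (auto simp: profile_def)
  have E: "e = 256 * ell_variance (p1 / h1)" "e = 256 * ell_variance (p2 / h2)"
    using profile_energy P1 P2 a by blast+
  have ratio: "p1 / h1 = p2 / h2"
    using ell_variance_less[of "p1 / h1" "p2 / h2"] ell_variance_less[of "p2 / h2" "p1 / h1"] E e h
    by (cases "p1 / h1" "p2 / h2" rule: linorder_cases) auto
  have "sqrt h1 = sqrt h2"
    using profile_relations(1)[OF P1(1) a(1)] profile_relations(1)[OF P2(1) a(2)] ratio by simp
  then have hh: "h1 = h2" by simp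
  then have pp: "p1 = p2" using ratio h by simp
  have mm: "m1 = m2"
    using profile_relations(2)[OF P1(1) a(1)] profile_relations(2)[OF P2(1) a(2)] unfolding hh pp by simp
  have "B1 = B2" using P1(2) P2(2) hh pp mm by simp
  then show ?thesis
    using quad_ode_unique[OF 1(2), of w2 y2 0] 2(2) 1(3) 2(3) P1(1) P2(1) hh mm by (simp add: profile_def)
qed

section \<open>Back to the original maximization problem\<close>

lemma quad_ode_shift:
  assumes "quad_ode A B C w y" shows "quad_ode A B C (\<lambda>x. w (x + c)) (\<lambda>x. y (x + c))"
  unfolding quad_ode_def
  using quad_odeD(1)[OF assms, THEN DERIV_shift[THEN iffD1]] quad_odeD(2)[OF assms, THEN DERIV_shift[THEN iffD1]]
  by auto

text \<open>A maximizer is shifted so that its largest value is at 0. This value is positive: w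
  \<le> 0 with |w| \<le> K would give \<integral> w^2 \<le> -K \<integral> w = 0.\<close>

lemma normalized_max_pair_exists:
  assumes e: "e > 0"
  obtains w y B where "max_pair e w y" "quad_ode (-3/2) B (3 * e / 2) w y" "y 0 = 0" "w 0 > 0"
proof -
  from max_pair_exists[OF e] obtain w0 z0 where "max_pair e w0 z0" .
  from max_pair_ODE[OF this e] obtain y B where m: "max_pair e w0 y" and o: "quad_ode (-3/2) B (3 * e / 2) w0 y"
    by blast
  note w = admissibleD[OF max_pairD(1)[OF m]]
  note oD = quad_odeD[OF o]
  have "\<exists>x\<in>\<T>. \<forall>t\<in>\<T>. w0 t \<le> w0 x"
    by (rule continuous_attains_sup) (auto simp: circle_def oD(3))
  then obtain x where x: "x \<in> \<T>" "\<And>t. t \<in> \<T> \<Longrightarrow> w0 t \<le> w0 x" by blast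
  have max: "w0 t \<le> w0 x" for t
  proof -
    have "t + of_int (- \<lfloor>t + 1/2\<rfloor>) \<in> \<T>" unfolding circle_def by (auto; linarith)
    from x(2)[OF this] show ?thesis by (simp only: periodic1_of_int[OF H1D(1)[OF w(1)]])
  qed
  have yx: "y x = 0" by (rule DERIV_local_max[OF oD(1), of 1]) (use max in auto)
  have "w0 x > 0"
  proof (rule ccontr)
    assume "\<not> w0 x > 0"
    then have neg: "w0 t \<le> 0" for t using max[of t] by simp
    obtain K where K: "\<And>t. t \<in> \<T> \<Longrightarrow> \<bar>w0 t\<bar> \<le> K"
      unfolding circle_def using continuous_on_Icc_bounded[OF oD(3)] by blast
    have "mean (\<lambda>t. (w0 t)\<^sup>2) \<le> mean (\<lambda>t. (- K) * w0 t)"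
    proof (rule integral_le)
      show "(w0 t)\<^sup>2 \<le> - K * w0 t" if "t \<in> \<T>" for t
        using mult_right_mono[OF K[OF that], of "- w0 t"] neg[of t] by (simp add: power2_eq_square)
    qed (use oD(3) in \<open>auto intro!: circle_integrable continuous_intros\<close>)
    then show False using w e by simp
  qed
  then show ?thesis
    using that[OF max_pair_shift[OF m o, of x] quad_ode_shift[OF o, of x]] yx by simp
qed

text \<open>Competitors correspond in both directions: the derivative of a periodic function has
  mean zero, and -w has a periodic primitive for every admissible w. The additive constant of the
  primitive changes neither functional.\<close>

lemma is_maximizer_iff:
  "is_maximizer E u \<longleftrightarrow> (\<exists>w z. H1 u (\<lambda>x. - w x) \<and> max_pair (2 * E) w z)"
proof -
  have neg: "H1 v z \<longleftrightarrow> H1 (\<lambda>x. - v x) (\<lambda>x. - z x)" for v z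
    using H1_cmult[of v z "-1"] H1_cmult[of "\<lambda>x. - v x" "\<lambda>x. - z x" "-1"] by auto
  have val: "Rfun u = objective w z" "Efun u = 1/2 * mean (sq w)" 
    if "H1 u (\<lambda>x. - w x)" "H1 w z" for u w z
    using functionals_H1(2,3)[OF that(1), of "\<lambda>x. - z x"] that neg[of w z] by (auto simp: objective_def)
  have A: "u \<in> H2_per \<and> Efun u = E \<longleftrightarrow> (\<exists>w z. H1 u (\<lambda>x. - w x) \<and> admissible (2 * E) w z)" for u
  proof
    assume u: "u \<in> H2_per \<and> Efun u = E"
    then obtain v z where vz: "H1 u v" "H1 v z" unfolding H2_per_iff by blast
    have i: "mean v = 0" by (rule H1D(6)[OF vz(1)])
    have "H1 u (\<lambda>x. - (- v x))" "H1 (\<lambda>x. - v x) (\<lambda>x. - z x)" using vz neg[of v z] by auto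
    moreover from this have "admissible (2 * E) (\<lambda>x. - v x) (\<lambda>x. - z x)"
      using val(2)[of u "\<lambda>x. - v x" "\<lambda>x. - z x"] u i by (simp add: admissible_def)
    ultimately show "\<exists>w z. H1 u (\<lambda>x. - w x) \<and> admissible (2 * E) w z"
      by (intro exI[of _ "\<lambda>x. - v x"] exI[of _ "\<lambda>x. - z x"] conjI)
  next
    assume "\<exists>w z. H1 u (\<lambda>x. - w x) \<and> admissible (2 * E) w z"
    then obtain w z where wz: "H1 u (\<lambda>x. - w x)" "admissible (2 * E) w z" by blast
    then show "u \<in> H2_per \<and> Efun u = E"
      using val(2)[OF wz(1), of z] neg[of w z] unfolding H2_per_iff admissible_def by auto
  qed
  have prim: "\<exists>u. H1 u (\<lambda>x. - w x)" if "admissible e w z" for e w z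
  proof -
    have "H1 (\<lambda>x. - w x) (\<lambda>x. - z x)" "mean (\<lambda>x. - w x) = 0"
      using that neg[of w z] by (auto simp: admissible_def)
    from H1_primitive[OF H1D(5)[OF this(1)] this(2), of 0] show ?thesis by blast
  qed
  show ?thesis
  proof
    assume mx: "is_maximizer E u"
    then obtain w z where wz: "H1 u (\<lambda>x. - w x)" "admissible (2 * E) w z"
      using A[of u] by (auto simp: is_maximizer_def is_arg_max_def)
    have "objective w' z' \<le> objective w z" if a: "admissible (2 * E) w' z'" for w' z'
    proof -
      from prim[OF a] obtain u' where u': "H1 u' (\<lambda>x. - w' x)" by blast
      then have "\<not> Rfun u' > Rfun u" using mx A[of u'] a by (auto simp: is_maximizer_def is_arg_max_def)
      then show ?thesis using val(1)[OF u', of z'] val(1)[OF wz(1), of z] a wz(2) by (simp add: admissible_def)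
    qed
    then show "\<exists>w z. H1 u (\<lambda>x. - w x) \<and> max_pair (2 * E) w z"
      using wz by (auto simp: max_pair_def)
  next
    assume "\<exists>w z. H1 u (\<lambda>x. - w x) \<and> max_pair (2 * E) w z"
    then obtain w z where wz: "H1 u (\<lambda>x. - w x)" "admissible (2 * E) w z"
      and mx: "\<And>w' z'. admissible (2 * E) w' z' \<Longrightarrow> objective w' z' \<le> objective w z" by (auto simp: max_pair_def)
    have "\<not> Rfun u' > Rfun u" if u': "u' \<in> H2_per \<and> Efun u' = E" for u'
    proof -
      from u' obtain w' z' where "H1 u' (\<lambda>x. - w' x)" "admissible (2 * E) w' z'" using A[of u'] by blast
      then show ?thesis using mx[of w' z'] val(1)[of u' w' z'] val(1)[OF wz(1), of z] wz(2) by (simp add: admissible_def)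
    qed
    moreover have "u \<in> H2_per \<and> Efun u = E" using A[of u] wz by blast
    ultimately show "is_maximizer E u" by (auto simp: is_maximizer_def is_arg_max_def)
  qed
qed

text \<open>Oddness does two things: it makes w even, so that 0 is a critical point, and it fixes
  the additive constant of u. The sign of the slope puts the crest of w, not its trough, at
  0.\<close>

lemma odd_maximizer_normalized:
  assumes E: "E > 0" and u: "is_odd_maximizer E u"
  obtains w y B where "H1 u (\<lambda>x. - w x)" "max_pair (2 * E) w y"
    "quad_ode (-3/2) B (3 * (2 * E) / 2) w y" "y 0 = 0" "w 0 > 0" "u 0 = 0"
proof -
  have odd: "\<And>x. u (- x) = - u x" and d0: "deriv u 0 < 0"
    using u by (auto simp: is_odd_maximizer_def H2_per_odd_def)
  obtain w z where wz: "H1 u (\<lambda>x. - w x)" "max_pair (2 * E) w z"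
    using u is_maximizer_iff by (auto simp: is_odd_maximizer_def)
  from max_pair_ODE[OF wz(2)] E obtain y B where y: "max_pair (2 * E) w y" "quad_ode (-3/2) B (3 * (2 * E) / 2) w y"
    by auto
  note oD = quad_odeD[OF y(2)]
  have D: "(u has_real_derivative - w x) (at x)" for x
    by (rule H1_DERIV[OF wz(1)]) (use oD(3) in \<open>auto intro!: continuous_intros\<close>)
  have w0: "w 0 > 0" using DERIV_imp_deriv[OF D[of 0]] d0 by simp
  have even: "w (- x) = w x" for x
  proof -
    have "((\<lambda>x. - u (- x)) has_real_derivative - (- (- w (- x)))) (at x)"
      by (rule DERIV_minus[OF DERIV_mirror[THEN iffD1, OF D]])
    then have "(u has_real_derivative - w (- x)) (at x)" by (simp add: odd)
    from DERIV_unique[OF this D] show ?thesis by simp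
  qed
  have "y 0 = 0" using derivative_of_even[OF oD(1) even, of 0] by simp
  moreover have "u 0 = 0" using odd[of 0] by simp
  ultimately show ?thesis using that wz(1) y w0 by blast
qed

text \<open>The condition \<open>u 0 = 0\<close> selects the primitive of -w, and this primitive is
  odd because w is even; so everything reduces to the normalized pair.\<close>

theorem odd_maximizer_unique_exists:
  assumes E: "E > 0"
  shows "\<exists>!u. is_odd_maximizer E u"
proof (rule ex_ex1I)
  obtain w y B where w: "max_pair (2 * E) w y" "quad_ode (-3/2) B (3 * (2 * E) / 2) w y" "y 0 = 0" "w 0 > 0"
    using normalized_max_pair_exists[of "2 * E"] E by auto
  note oD = quad_odeD[OF w(2)]
  have even: "w (- x) = w x" for x using quad_ode_symmetric[OF w(2,3), of x] by simp
  note W = admissibleD[OF max_pairD(1)[OF w(1)]]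
  have "H1 (\<lambda>x. - w x) (\<lambda>x. - y x)" using H1_cmult[OF W(1), of "-1"] by simp
  then have "(\<lambda>x. - w x) \<in> L2_per" "mean (\<lambda>x. - w x) = 0" using H1D(5) W(2) by auto
  from H1_primitive[OF this, of 0] obtain u where u: "H1 u (\<lambda>x. - w x)" "u 0 = 0" by force
  have D: "(u has_real_derivative - w x) (at x)" for x
    by (rule H1_DERIV[OF u(1)]) (use oD(3) in \<open>auto intro!: continuous_intros\<close>)
  have "((\<lambda>x. u x + u (- x)) has_real_derivative 0) (at x)" for x
    using DERIV_add[OF D DERIV_mirror[THEN iffD1, OF D], of x] by (simp add: even)
  then have odd: "u (- x) = - u x" for x
    using DERIV_isconst_all[of "\<lambda>x. u x + u (- x)" x 0] u(2) by simp
  have mx: "is_maximizer E u" using is_maximizer_iff u(1) w(1) by blast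
  then have "u \<in> H2_per" by (simp add: is_maximizer_def is_arg_max_def)
  then have "is_odd_maximizer E u"
    using mx odd DERIV_imp_deriv[OF D[of 0]] w(4) by (simp add: is_odd_maximizer_def H2_per_odd_def)
  then show "\<exists>u. is_odd_maximizer E u" by blast
next
  fix u1 u2 assume u: "is_odd_maximizer E u1" "is_odd_maximizer E u2"
  from odd_maximizer_normalized[OF E u(1)] obtain w1 y1 B1 where 1: "H1 u1 (\<lambda>x. - w1 x)" "max_pair (2 * E) w1 y1"
    "quad_ode (-3/2) B1 (3 * (2 * E) / 2) w1 y1" "y1 0 = 0" "w1 0 > 0" "u1 0 = 0" .
  from odd_maximizer_normalized[OF E u(2)] obtain w2 y2 B2 where 2: "H1 u2 (\<lambda>x. - w2 x)" "max_pair (2 * E) w2 y2"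
    "quad_ode (-3/2) B2 (3 * (2 * E) / 2) w2 y2" "y2 0 = 0" "w2 0 > 0" "u2 0 = 0" .
  have ww: "w1 = w2" using normalized_max_pair_unique[OF _ 1(2-5) 2(2-5)] E by simp
  show "u1 = u2"
  proof
    fix x
    show "u1 x = u2 x"
    proof (cases "0 \<le> x")
      case True
      show ?thesis using has_integral_unique[OF H1D(3)[OF 1(1) True] H1D(3)[OF 2(1) True, folded ww]] 1(6) 2(6) by simp
    next
      case False
      then have x: "x \<le> 0" by simp
      show ?thesis using has_integral_unique[OF H1D(3)[OF 1(1) x] H1D(3)[OF 2(1) x, folded ww]] 1(6) 2(6) by simp
    qed
  qed
qed

section \<open>Asymptotics\<close>

text \<open>The weight is at most 1 / sqrt eps. The true growth as eps tends to 0 is only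
  logarithmic, but this bound already turns \<open>sqrt h = 4 * ell_moment 0 eps\<close> into
  \<open>sqrt h * sqrt eps \<le> 8\<close>.\<close>

lemma ell_moment_0_le:
  assumes "eps > 0" shows "ell_moment 0 eps * sqrt eps \<le> 2"
proof -
  have "ell_moment 0 eps \<le> integral {0..pi/2} (\<lambda>t. 1 / sqrt eps)"
    unfolding ell_moment_def
  proof (rule integral_le)
    show "cos t ^ (2 * 0) / sqrt ((cos t)\<^sup>2 + eps) \<le> 1 / sqrt eps" for t
      using assms zero_le_power2[of "cos t"] by (auto intro!: divide_left_mono mult_pos_pos add_nonneg_pos)
  qed (auto intro!: integrable_continuous_real ell_moment_continuous[OF assms, of _ 0, simplified])
  also have "\<dots> = (pi/2) / sqrt eps" by simp
  finally have "ell_moment 0 eps * sqrt eps \<le> pi / 2" using assms by (simp add: field_simps)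
  then show ?thesis using pi_less_4 by simp
qed

text \<open>At eps = 0 the weight is 1 / cos, which one factor cos cancels; this is why i = 0 is
  excluded. The integrands differ by at most s - cos t with s = sqrt (cos^2 t + eps), hence by sqrt
  eps, over an interval of length pi/2 < 2.\<close>

lemma ell_moment_approx:
  assumes "eps > 0" "i \<ge> 1" and c: "((\<lambda>t. cos t ^ (2 * i - 1)) has_integral c) {0..pi/2}"
  shows "\<bar>ell_moment i eps - c\<bar> \<le> 2 * sqrt eps"
proof -
  have j: "((\<lambda>t. (cos t) ^ (2 * i) / sqrt ((cos t)\<^sup>2 + eps)) has_integral ell_moment i eps) {0..pi/2}"
    unfolding ell_moment_def
    by (intro integrable_integral integrable_continuous_real ell_moment_continuous assms)
  have b: "0 \<le> cos t ^ (2 * i - 1) - cos t ^ (2 * i) / sqrt ((cos t)\<^sup>2 + eps) \<and>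
      cos t ^ (2 * i - 1) - cos t ^ (2 * i) / sqrt ((cos t)\<^sup>2 + eps) \<le> sqrt eps" if t: "t \<in> {0..pi/2}" for t
  proof -
    define C where "C = cos t"
    define s where "s = sqrt (C\<^sup>2 + eps)"
    have C: "0 \<le> C" "C \<le> 1" using t by (auto simp: C_def intro!: cos_ge_zero)
    have s: "s > 0" "C \<le> s" "s \<le> C + sqrt eps"
      using assms(1) C zero_le_power2[of C] sqrt_add_le_add_sqrt[of "C\<^sup>2" eps]
      by (auto simp: s_def add_nonneg_pos intro!: real_le_rsqrt)
    obtain k where k: "i = Suc k" using assms(2) by (cases i) auto
    have "C ^ (2 * i - 1) - C ^ (2 * i) / s = C ^ (2 * k) * ((C / s) * (s - C))"
      using s(1) by (simp add: k field_simps power2_eq_square)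
    moreover have "(C / s) * (s - C) \<le> 1 * sqrt eps" using s C assms(1) by (intro mult_mono) auto
    moreover have A: "0 \<le> (C / s) * (s - C)" using s C by (intro mult_nonneg_nonneg) auto
    moreover have "C ^ (2 * k) \<le> 1" and B: "0 \<le> C ^ (2 * k)" using C by (auto intro: power_le_one)
    moreover have "C ^ (2 * k) * ((C / s) * (s - C)) \<le> 1 * sqrt eps"
      using calculation by (intro mult_mono) auto
    moreover have "0 \<le> C ^ (2 * k) * ((C / s) * (s - C))"
      by (rule mult_nonneg_nonneg[OF B A])
    ultimately have "0 \<le> C ^ (2 * i - 1) - C ^ (2 * i) / s \<and> C ^ (2 * i - 1) - C ^ (2 * i) / s \<le> sqrt eps"
      by (simp only: mult_1_left)
    then show ?thesis unfolding C_def s_def .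
  qed
  have d: "((\<lambda>t. cos t ^ (2 * i - 1) - cos t ^ (2 * i) / sqrt ((cos t)\<^sup>2 + eps)) has_integral c - ell_moment i eps) {0..pi/2}"
    by (rule has_integral_diff[OF c j])
  have "0 \<le> c - ell_moment i eps" using has_integral_nonneg[OF d] b by blast
  moreover have "c - ell_moment i eps \<le> (pi/2 - 0) * sqrt eps"
    using has_integral_le[OF d has_integral_const_real[of "sqrt eps" 0 "pi/2"]] b by simp
  moreover have "(pi/2 - 0) * sqrt eps \<le> 2 * sqrt eps" using pi_less_4 assms(1) by (intro mult_right_mono) auto
  ultimately show ?thesis by linarith
qed

lemma has_integral_cos_odd_powers:
  "((\<lambda>t. cos t ^ (2 * 1 - 1)) has_integral 1) {0..pi/2}"
  "((\<lambda>t. cos t ^ (2 * 2 - 1)) has_integral 2/3) {0..pi/2}"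
  "((\<lambda>t. cos t ^ (2 * 3 - 1)) has_integral 8/15) {0..pi/2}"
proof -
  have ftc: "(f has_integral F (pi/2) - F 0) {0..pi/2}" if "\<And>t. (F has_real_derivative f t) (at t)" for f F :: "real \<Rightarrow> real"
    using that by (intro has_integral_derivative) (auto intro: has_field_derivative_at_within)
  have "(sin has_real_derivative cos t ^ (2 * 1 - 1)) (at t)" for t :: real
    by (auto intro!: derivative_eq_intros)
  from ftc[OF this] show "((\<lambda>t. cos t ^ (2 * 1 - 1)) has_integral 1) {0..pi/2}" by simp
  have "((\<lambda>t. sin t - sin t ^ 3 / 3) has_real_derivative cos t ^ (2 * 2 - 1)) (at t)" for t :: real
  proof -
    have "((\<lambda>t. sin t - sin t ^ 3 / 3) has_real_derivative cos t * (1 - (sin t)\<^sup>2)) (at t)"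
      by (auto intro!: derivative_eq_intros simp: algebra_simps)
    also have "cos t * (1 - (sin t)\<^sup>2) = cos t ^ (2 * 2 - 1)"
      unfolding cos_squared_eq[symmetric] by (simp add: numeral_eq_Suc)
    finally show ?thesis .
  qed
  from ftc[OF this] show "((\<lambda>t. cos t ^ (2 * 2 - 1)) has_integral 2/3) {0..pi/2}" by simp
  have "((\<lambda>t. sin t - 2 * sin t ^ 3 / 3 + sin t ^ 5 / 5) has_real_derivative cos t ^ (2 * 3 - 1)) (at t)" for t :: real
  proof -
    have "((\<lambda>t. sin t - 2 * sin t ^ 3 / 3 + sin t ^ 5 / 5) has_real_derivative cos t * (1 - (sin t)\<^sup>2)\<^sup>2) (at t)"
      by (auto intro!: derivative_eq_intros) (simp add: power2_eq_square algebra_simps numeral_eq_Suc)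
    also have "cos t * (1 - (sin t)\<^sup>2)\<^sup>2 = cos t ^ (2 * 3 - 1)"
      unfolding cos_squared_eq[symmetric] by (simp add: numeral_eq_Suc)
    finally show ?thesis .
  qed
  from ftc[OF this] show "((\<lambda>t. cos t ^ (2 * 3 - 1)) has_integral 8/15) {0..pi/2}" by simp
qed

text \<open>With L = \<open>sqrt h\<close> everything rests on L sqrt eps \<le> 8: its square is p
  \<le> 64, and it turns the moment error 4 L^k * 2 sqrt eps into 64 L^(k-1). The main coefficients
  are 4 times 1, 2/3 and 8/15; moreover 68 = 4 + 64 and 4688 = 68^2 + 64.\<close>

lemma profile_estimates:
  assumes P: "profile h p m w y" and a: "admissible e w y" and L1: "sqrt h \<ge> 1"
  shows "0 \<le> m" "\<bar>m - 4 * sqrt h\<bar> \<le> 64" "m \<le> 68 * sqrt h"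
    and "\<bar>(e + m\<^sup>2) - 8/3 * sqrt h ^ 3\<bar> \<le> 64 * sqrt h ^ 2" "e + m\<^sup>2 \<le> 67 * sqrt h ^ 3"
    and "\<bar>e - 8/3 * sqrt h ^ 3\<bar> \<le> 4688 * sqrt h ^ 2"
    and "\<bar>mean (\<lambda>x. (w x + m) ^ 3) - 32/15 * sqrt h ^ 5\<bar> \<le> 64 * sqrt h ^ 4"
    and "p \<le> 64"
proof -
  define L where "L = sqrt h"
  define eps where "eps = p / h"
  have h: "h > 0" "p > 0" using P by (auto simp: profile_def)
  then have eps: "eps > 0" by (simp add: eps_def)
  note rel = profile_relations[OF P a, folded L_def eps_def]
  have L: "L \<ge> 1" "L > 0" "h = L\<^sup>2" using L1 h by (auto simp: L_def)
  have "L * sqrt eps = 4 * (ell_moment 0 eps * sqrt eps)" by (simp only: rel(1) mult.assoc)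
  with ell_moment_0_le[OF eps] have Le: "L * sqrt eps \<le> 8" by linarith
  have "(L * sqrt eps)\<^sup>2 \<le> 8\<^sup>2" using Le L eps by (intro power_mono) auto
  then show "p \<le> 64" using eps h L by (simp add: power_mult_distrib eps_def)
  have app: "\<bar>4 * L ^ k * ell_moment i eps - 4 * L ^ k * c\<bar> \<le> 64 * L ^ l"
    if "i \<ge> 1" "((\<lambda>t. cos t ^ (2 * i - 1)) has_integral c) {0..pi/2}" "k = Suc l" for i c k l
  proof -
    have "\<bar>4 * L ^ k * ell_moment i eps - 4 * L ^ k * c\<bar> = 4 * L ^ k * \<bar>ell_moment i eps - c\<bar>"
      using L by (simp add: abs_mult flip: right_diff_distrib)
    also have "\<dots> \<le> 4 * L ^ k * (2 * sqrt eps)"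
      using ell_moment_approx[OF eps that(1,2)] L by (intro mult_left_mono) auto
    also have "\<dots> = 8 * L ^ l * (L * sqrt eps)" by (simp add: that(3))
    also have "\<dots> \<le> 8 * L ^ l * 8" using Le L by (intro mult_left_mono) auto
    finally show ?thesis by simp
  qed
  have pw: "L ^ i \<le> L ^ j" if "i \<le> j" for i j by (rule power_increasing[OF that L(1)])
  have j1: "0 \<le> ell_moment 1 eps" unfolding ell_moment_def
    using eps by (intro Henstock_Kurzweil_Integration.integral_nonneg integrable_continuous_real ell_moment_continuous) auto
  show m0: "0 \<le> m" using j1 L rel(2) by simp
  have "\<bar>4 * L ^ 1 * ell_moment 1 eps - 4 * L ^ 1 * 1\<bar> \<le> 64 * L ^ 0"
    by (rule app[OF _ has_integral_cos_odd_powers(1)]) simp_all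
  then have m1: "\<bar>m - 4 * L\<bar> \<le> 64" unfolding rel(2) by simp
  then show "\<bar>m - 4 * sqrt h\<bar> \<le> 64" by (simp add: L_def)
  have m68: "m \<le> 68 * L" using m1 L by linarith
  then show "m \<le> 68 * sqrt h" by (simp add: L_def)
  have M2: "\<bar>(e + m\<^sup>2) - 8/3 * L ^ 3\<bar> \<le> 64 * L ^ 2"
  proof -
    have "4 * L ^ 3 * ell_moment 2 eps = e + m\<^sup>2" using rel(3) by linarith
    moreover have "\<bar>4 * L ^ 3 * ell_moment 2 eps - 4 * L ^ 3 * (2/3)\<bar> \<le> 64 * L ^ 2"
      by (rule app[OF _ has_integral_cos_odd_powers(2)]) simp_all
    ultimately show ?thesis by simp
  qed
  then show "\<bar>(e + m\<^sup>2) - 8/3 * sqrt h ^ 3\<bar> \<le> 64 * sqrt h ^ 2" by (simp add: L_def)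
  show "e + m\<^sup>2 \<le> 67 * sqrt h ^ 3"
    using M2 pw[of 2 3] L zero_le_power[of L 3] unfolding L_def[symmetric] by linarith
  have "m\<^sup>2 \<le> (68 * L)\<^sup>2" using m68 m0 by (rule power_mono)
  then have "m\<^sup>2 \<le> 4624 * L ^ 2" by (simp add: power_mult_distrib)
  then show "\<bar>e - 8/3 * sqrt h ^ 3\<bar> \<le> 4688 * sqrt h ^ 2"
    using M2 zero_le_power2[of m] unfolding L_def[symmetric] by linarith
  show "\<bar>mean (\<lambda>x. (w x + m) ^ 3) - 32/15 * sqrt h ^ 5\<bar> \<le> 64 * sqrt h ^ 4"
  proof -
    have "\<bar>4 * L ^ 5 * ell_moment 3 eps - 4 * L ^ 5 * (8/15)\<bar> \<le> 64 * L ^ 4"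
      by (rule app[OF _ has_integral_cos_odd_powers(3)]) simp_all
    then show ?thesis unfolding rel(4) L_def[symmetric] by simp
  qed
qed

text \<open>Averaging the first integral y^2 = (h - p) f^2 + h p f - f^3, with f = w + m, expresses
  the Dirichlet integral by the moments of f, so no separate integral of y^2 has to be
  evaluated.\<close>

lemma profile_objective:
  assumes P: "profile h p m w y" and a: "admissible e w y"
  shows "objective w y = 2 * mean (\<lambda>x. (w x + m) ^ 3) - (h - p) * (e + m\<^sup>2) - h * p * m - 3 * m * e - m ^ 3"
proof -
  note w = admissibleD[OF a]
  have wc: "continuous_on \<T> w" by (rule H1D(4)[OF w(1)])
  define T where "T = mean (\<lambda>x. w x ^ 3)"
  define M3 where "M3 = mean (\<lambda>x. (w x + m) ^ 3)"
  have y2: "(y x)\<^sup>2 = (w x + m) * (w x + m + p) * (h - (w x + m))" for x using P by (simp add: profile_def)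
  have i: "(w has_integral 0) \<T>" "((sq w) has_integral e) \<T>" "((\<lambda>x. w x ^ 3) has_integral T) \<T>"
    "\<And>c::real. ((\<lambda>x. c) has_integral c) \<T>" "((\<lambda>x. (w x + m) ^ 3) has_integral M3) \<T>"
    using wc w(2,3) unfolding T_def M3_def
    by (auto simp: has_integral_integrable_integral intro!: circle_integrable continuous_intros)
  have "((\<lambda>x. w x ^ 3 + 3 * m * (w x)\<^sup>2 + 3 * m\<^sup>2 * w x + m ^ 3) has_integral T + 3 * m * e + 3 * m\<^sup>2 * 0 + m ^ 3) \<T>"
    by (intro has_integral_add has_integral_mult_right i)
  then have M3: "M3 = T + 3 * m * e + m ^ 3" unfolding M3_def
    by (intro integral_unique) (simp add: power2_eq_square power3_eq_cube algebra_simps)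
  have "((\<lambda>x. (h - p) * ((w x)\<^sup>2 + 2 * m * w x + m\<^sup>2) + h * p * (w x + m) - (w x + m) ^ 3) has_integral
    (h - p) * (e + 2 * m * 0 + m\<^sup>2) + h * p * (0 + m) - M3) \<T>"
    by (intro has_integral_add has_integral_diff has_integral_mult_right i)
  moreover have "(h - p) * ((w x)\<^sup>2 + 2 * m * w x + m\<^sup>2) + h * p * (w x + m) - (w x + m) ^ 3 = (y x)\<^sup>2" for x
    unfolding y2 by (simp add: power2_eq_square power3_eq_cube algebra_simps)
  ultimately have "mean (sq y) = (h - p) * (e + m\<^sup>2) + h * p * m - M3"
    by (intro integral_unique) simp
  then show ?thesis using M3 unfolding objective_def T_def[symmetric] M3_def[symmetric] by simp
qed

text \<open>The leading coefficient is 2 * 32/15 - 8/3 = 8/5. All other terms are of order at most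
  L^4, since p is bounded, m is of order L and e of order L^3.\<close>

lemma profile_objective_estimate:
  assumes P: "profile h p m w y" and a: "admissible e w y" and L1: "sqrt h \<ge> 1"
  shows "\<bar>objective w y - 8/5 * sqrt h ^ 5\<bar> \<le> 400000 * sqrt h ^ 4"
proof -
  define L where "L = sqrt h"
  define M3 where "M3 = mean (\<lambda>x. (w x + m) ^ 3)"
  define M2 where "M2 = e + m\<^sup>2"
  have h: "h > 0" "p > 0" using P by (auto simp: profile_def)
  have L: "L \<ge> 1" "h = L\<^sup>2" using L1 h by (auto simp: L_def)
  note est = profile_estimates[OF P a L1, folded L_def M3_def M2_def]
  have e0: "0 \<le> e"
    using integral_circle_nonneg[of "\<lambda>x. (w x)\<^sup>2"] a H1D(4)[of w y \<T>]
    unfolding admissible_def by (auto intro!: circle_integrable continuous_intros)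
  then have "M2 \<ge> 0" by (simp add: M2_def)
  have e: "0 \<le> e" "e \<le> 67 * L ^ 3"
    using e0 est(5) zero_le_power2[of m] unfolding M2_def by linarith+
  have pw: "L ^ 3 \<le> L ^ 4" using L(1) by (intro power_increasing) auto
  have b1: "\<bar>L\<^sup>2 * (M2 - 8/3 * L ^ 3)\<bar> \<le> 64 * L ^ 4"
  proof -
    have "\<bar>L\<^sup>2 * (M2 - 8/3 * L ^ 3)\<bar> = L\<^sup>2 * \<bar>M2 - 8/3 * L ^ 3\<bar>" by (simp add: abs_mult)
    also have "\<dots> \<le> L\<^sup>2 * (64 * L ^ 2)" using est(4) by (intro mult_left_mono) auto
    also have "\<dots> = 64 * L ^ 4" by (simp add: numeral_eq_Suc)
    finally show ?thesis .
  qed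
  have b2: "0 \<le> p * M2" "p * M2 \<le> 64 * (67 * L ^ 3)"
    using h \<open>M2 \<ge> 0\<close> mult_mono[OF est(8,5)] by auto
  have b3: "0 \<le> L\<^sup>2 * (p * m)" "L\<^sup>2 * (p * m) \<le> L\<^sup>2 * (64 * (68 * L))"
    using est(1) h L(1) mult_left_mono[OF mult_mono[OF est(8,3)], of "L\<^sup>2"] by auto
  have b4: "0 \<le> m * e" "m * e \<le> (68 * L) * (67 * L ^ 3)"
    using est(1) e L(1) mult_mono[OF est(3) e(2)] by auto
  have b5: "0 \<le> m ^ 3" "m ^ 3 \<le> (68 * L) ^ 3" using est(1) power_mono[OF est(3,1), of 3] by auto
  have eq: "objective w y - 8/5 * L ^ 5 = 2 * (M3 - 32/15 * L ^ 5) - L\<^sup>2 * (M2 - 8/3 * L ^ 3) + p * M2 - L\<^sup>2 * (p * m) - 3 * (m * e) - m ^ 3"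
    unfolding profile_objective[OF P a, folded M3_def M2_def] L(2)
    by (simp add: algebra_simps flip: power_add)
  have k: "L\<^sup>2 * (64 * (68 * L)) = 4352 * L ^ 3" "(68 * L) * (67 * L ^ 3) = 4556 * L ^ 4"
    "(68 * L) ^ 3 = 314432 * L ^ 3"
    by (simp_all add: power_mult_distrib numeral_eq_Suc)
  \<comment> \<open>Everything is linear in the listed quantities; their bounds add up to less than
    337000, within the rounded constant.\<close>
  have gen: "\<bar>X\<bar> \<le> 400000 * l4"
    if "X = 2 * A - b + c - d - 3 * f - g" "\<bar>A\<bar> \<le> 64 * l4" "\<bar>b\<bar> \<le> 64 * l4" "0 \<le> c" "c \<le> 64 * (67 * l3)"
      "0 \<le> d" "d \<le> 4352 * l3" "0 \<le> f" "f \<le> 4556 * l4" "0 \<le> g" "g \<le> 314432 * l3" "l3 \<le> l4" "0 \<le> l3"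
    for X A b c d f g l3 l4 :: real
    using that by linarith
  have "0 \<le> L ^ 3" using L(1) by simp
  from gen[OF eq est(7) b1 b2 b3(1) b3(2)[unfolded k(1)] b4(1) b4(2)[unfolded k(2)] b5(1) b5(2)[unfolded k(3)] pw this]
  have "\<bar>objective w y - 8/5 * L ^ 5\<bar> \<le> 400000 * L ^ 4" .
  then show ?thesis by (simp add: L_def)
qed

text \<open>On half a period \<open>u = g - m * (1/2 - x)\<close> with \<open>g x = \<integral> f\<close> over \<open>{x..1/2}\<close>. As \<open>r = sqrt (h - f)\<close>
  satisfies \<open>r' \<ge> f / 2\<close>, one gets \<open>g \<le> 2 * (sqrt h - r) \<le> 2 * f / sqrt h\<close>; so \<open>\<integral> g\<close> is bounded.\<close>

lemma profile_Kfun: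
  assumes P: "profile h p m w y" and a: "admissible e w y" and u: "H1 u (\<lambda>x. - w x)"
    and odd: "\<And>x. u (- x) = - u x"
  shows "\<bar>Kfun u - m\<^sup>2 / 24\<bar> \<le> 2 * m\<^sup>2 / sqrt h"
proof -
  note W = admissibleD[OF a]
  have wc: "continuous_on S w" for S by (rule H1D(4)[OF W(1)])
  have Du: "(u has_real_derivative - w x) (at x)" for x
    by (rule H1_DERIV[OF u]) (auto intro!: continuous_intros wc)
  have uc: "continuous_on S u" for S by (rule H1D(4)[OF u])
  define f where "f = (\<lambda>x. w x + m)"
  note h = profileD(1,2)[OF P f_def] and fends = profileD(3,4)[OF P f_def] and Df = profileD(5)[OF P f_def]
    and fc = profileD(6)[OF P f_def] and yneg = profileD(7)[OF P f_def] and y2 = profileD(8)[OF P f_def]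
    and even = profileD(9)[OF P f_def] and f01 = profileD(11)[OF P f_def]
  have u12: "u (1/2) = 0"
    using periodic1_add[OF H1D(1)[OF u], of "-(1/2)"] odd[of "1/2"] by simp
  define g where "g = (\<lambda>x. u x + m * (1/2 - x))"
  have gc: "continuous_on S g" for S unfolding g_def by (intro continuous_intros uc)
  have Dg: "(g has_real_derivative - f x) (at x)" for x
    unfolding g_def f_def by (auto intro!: derivative_eq_intros Du)
  have g1: "g (1/2) = 0" by (simp add: g_def u12)
  have g00: "g 0 = m / 2" using odd[of 0] by (simp add: g_def)
  have g0: "0 \<le> g x" if "x \<in> {0..1/2}" for x
  proof -
    have "g (1/2) \<le> g x"
      by (rule DERIV_nonpos_imp_decreasing_open) (use that Dg f01 gc in \<open>auto intro!: exI[of _ "- f _"]\<close>)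
    then show ?thesis using g1 by simp
  qed
  have gm: "g x \<le> m / 2" if "x \<in> {0..1/2}" for x
  proof -
    have "g x \<le> g 0"
      by (rule DERIV_nonpos_imp_decreasing_open) (use that Dg f01 gc in \<open>auto intro!: exI[of _ "- f _"]\<close>)
    then show ?thesis using g00 by simp
  qed
  have m0: "0 \<le> m" using g0[of 0] g00 by simp
  have gf: "g x \<le> 2 * f x / sqrt h" if x: "x \<in> {0..1/2}" for x
  proof -
    define r where "r = (\<lambda>x. sqrt (h - f x))"
    have "2 * (sqrt h - r (1/2)) - g (1/2) \<le> 2 * (sqrt h - r x) - g x"
    proof (rule DERIV_nonpos_imp_decreasing_open[of x "1/2" "\<lambda>x. 2 * (sqrt h - r x) - g x"])
      show "x \<le> 1/2" using x by simp
      show "continuous_on {x..1/2} (\<lambda>x. 2 * (sqrt h - r x) - g x)"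
        unfolding r_def by (intro continuous_intros fc gc)
      fix t assume t: "x < t" "t < 1/2"
      then have t0: "0 < t" using x by simp
      have ft: "0 < f t" "f t < h" using profileD(10)[OF P f_def t0 t(2)] by auto
      have "((\<lambda>x. h - f x) has_real_derivative - y t) (at t)" by (auto intro!: derivative_eq_intros Df)
      moreover have "(sqrt has_real_derivative inverse (r t) / 2) (at (h - f t))"
        unfolding r_def by (rule DERIV_real_sqrt) (use ft in simp)
      ultimately have rd: "(r has_real_derivative inverse (r t) / 2 * (- y t)) (at t)"
        unfolding r_def by (rule DERIV_chain2[rotated])
      have rt: "r t > 0" "(r t)\<^sup>2 = h - f t" using ft by (auto simp: r_def)
      \<comment> \<open>Dropping p from y^2 = f (f + p) (h - f) leaves f^2 (h - f), the square of f
        r.\<close>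
      have "(f t * r t)\<^sup>2 \<le> (- y t)\<^sup>2"
      proof -
        have "f t * (f t * (h - f t)) \<le> f t * ((f t + p) * (h - f t))"
          using ft h by (intro mult_left_mono mult_right_mono) auto
        moreover have "(f t * r t)\<^sup>2 = f t * (f t * (h - f t))"
          by (simp only: power_mult_distrib rt(2)) (simp only: power2_eq_square mult.assoc)
        moreover have "(- y t)\<^sup>2 = f t * ((f t + p) * (h - f t))"
          using y2[of t] by (simp add: mult.assoc)
        ultimately show ?thesis by simp
      qed
      then have "f t * r t \<le> - y t" by (rule power2_le_imp_le) (use yneg[OF t0 t(2)] in simp)
      then have "f t \<le> inverse (r t) * (- y t)" using rt(1) by (simp add: field_simps)
      moreover have "((\<lambda>x. 2 * (sqrt h - r x) - g x) has_real_derivative (f t - inverse (r t) * (- y t))) (at t)"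
        by (auto intro!: derivative_eq_intros rd Dg)
      ultimately show "\<exists>d. ((\<lambda>x. 2 * (sqrt h - r x) - g x) has_real_derivative d) (at t) \<and> d \<le> 0" by force
    qed
    moreover have "r (1/2) = sqrt h" using fends by (simp add: r_def)
    ultimately have "g x \<le> 2 * (sqrt h - r x)" using g1 by simp
    moreover have "(sqrt h - r x) * sqrt h \<le> f x"
    proof -
      have rx: "0 \<le> r x" "(r x)\<^sup>2 = h - f x" "r x \<le> sqrt h" using f01[OF x] by (auto simp: r_def)
      have "(sqrt h - r x) * sqrt h \<le> (sqrt h - r x) * (sqrt h + r x)" using rx by (intro mult_left_mono) auto
      also have "\<dots> = f x" using rx h by (simp add: algebra_simps power2_eq_square)
      finally show ?thesis .
    qed
    then have "sqrt h - r x \<le> f x / sqrt h" using h by (simp add: field_simps)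
    ultimately show ?thesis by simp
  qed
  have intc: "\<phi> integrable_on {0..1/2}" if "continuous_on {0..1/2} \<phi>" for \<phi> :: "real \<Rightarrow> real"
    using that by (rule integrable_continuous_real)
  have "2 * integral {0..1/2} f = mean f"
    using fc even by (intro integral_circle_even[symmetric])
  also have "\<dots> = m" unfolding f_def using wc W(2) by (simp add: integral_add circle_integrable)
  finally have If: "integral {0..1/2} f = m / 2" by simp
  have "integral {0..1/2} g \<le> integral {0..1/2} (\<lambda>x. (2 / sqrt h) * f x)"
    using gf fc gc by (intro integral_le intc continuous_intros) auto
  also have "\<dots> = m / sqrt h" using If by simp
  finally have Ig: "integral {0..1/2} g \<le> m / sqrt h" .
  have Ig0: "0 \<le> integral {0..1/2} g" using g0 gc by (intro Henstock_Kurzweil_Integration.integral_nonneg intc) auto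
  have K: "Kfun u = integral {0..1/2} (sq u)"
  proof -
    have "H1 (\<lambda>x. - w x) (\<lambda>x. - y x)" using H1_cmult[OF W(1), of "-1"] by simp
    from functionals_H1(1)[OF u this] have "Kfun u = 1/2 * mean (sq u)" .
    moreover have "mean (sq u) = 2 * integral {0..1/2} (sq u)"
      using uc odd by (intro integral_circle_even continuous_intros) auto
    ultimately show ?thesis by simp
  qed
  \<comment> \<open>The linear part of u accounts for m^2 / 24, which is 2/3 L^2 for m = 4
    L.\<close>
  have "((\<lambda>x. (m * (1/2 - x))\<^sup>2) has_integral (- m\<^sup>2 * (1/2 - 1/2) ^ 3 / 3) - (- m\<^sup>2 * (1/2 - 0) ^ 3 / 3)) {0..1/2}"
    by (rule has_integral_derivative) (auto intro!: derivative_eq_intros simp: power2_eq_square field_simps)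
  then have q: "((\<lambda>x. (m * (1/2 - x))\<^sup>2) has_integral m\<^sup>2 / 24) {0..1/2}"
    by (simp add: power3_eq_cube)
  have ui: "((sq u) has_integral Kfun u) {0..1/2}"
    unfolding K by (intro integrable_integral intc continuous_intros uc)
  have d: "((\<lambda>x. (u x)\<^sup>2 - (m * (1/2 - x))\<^sup>2) has_integral Kfun u - m\<^sup>2 / 24) {0..1/2}"
    by (rule has_integral_diff[OF ui q])
  \<comment> \<open>A difference of squares: one factor is g, whose integral is at most m / sqrt h,
    and the other is bounded by 2 m.\<close>
  have pt: "\<bar>(u x)\<^sup>2 - (m * (1/2 - x))\<^sup>2\<bar> \<le> 2 * m * g x" if x: "x \<in> {0..1/2}" for x
  proof -
    have "(u x)\<^sup>2 - (m * (1/2 - x))\<^sup>2 = g x * (g x - 2 * (m * (1/2 - x)))"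
      by (simp add: g_def power2_eq_square algebra_simps)
    moreover have "\<bar>g x - 2 * (m * (1/2 - x))\<bar> \<le> 2 * m"
    proof -
      have "0 \<le> m * (1/2 - x)" "m * (1/2 - x) \<le> m * (1/2)"
        using m0 x mult_left_mono[of "1/2 - x" "1/2" m] by auto
      then show ?thesis using g0[OF x] gm[OF x] by (simp add: abs_le_iff)
    qed
    ultimately show ?thesis
      using mult_left_mono[of "\<bar>g x - 2 * (m * (1/2 - x))\<bar>" "2 * m" "g x"] g0[OF x] by (simp add: abs_mult mult.commute)
  qed
  have "\<bar>Kfun u - m\<^sup>2 / 24\<bar> = \<bar>integral {0..1/2} (\<lambda>x. (u x)\<^sup>2 - (m * (1/2 - x))\<^sup>2)\<bar>"
    using integral_unique[OF d] by simp
  also have "\<dots> \<le> integral {0..1/2} (\<lambda>x. 2 * m * g x)"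
    using d pt gc by (intro abs_integral_le) (auto simp: integrable_on_def[of "\<lambda>x. (u x)\<^sup>2 - _ x"] intro!: intc continuous_intros uc)
  also have "\<dots> = 2 * m * integral {0..1/2} g" by simp
  also have "\<dots> \<le> 2 * m * (m / sqrt h)" using Ig m0 by (intro mult_left_mono) auto
  finally show ?thesis by (simp add: power2_eq_square)
qed

lemma odd_maximizer_estimates:
  assumes E: "E > 34" and u: "is_odd_maximizer E u"
  obtains L where "L \<ge> 1" "\<bar>2 * E - 8/3 * L ^ 3\<bar> \<le> 4688 * L ^ 2"
    "\<bar>Kfun u - 2/3 * L ^ 2\<bar> \<le> 10000 * L" "\<bar>Rfun u - 8/5 * L ^ 5\<bar> \<le> 400000 * L ^ 4"
proof -
  from E have E0: "E > 0" "2 * E > 0" by auto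
  from odd_maximizer_normalized[OF E0(1) u] obtain w y B where
    w: "H1 u (\<lambda>x. - w x)" "max_pair (2 * E) w y"
    "quad_ode (-3/2) B (3 * (2 * E) / 2) w y" "y 0 = 0" "w 0 > 0" .
  from max_pair_profile[OF w(2) E0(2) w(3-5)] obtain h p m where P: "profile h p m w y" .
  have a: "admissible (2 * E) w y" using w(2) by (simp add: max_pair_def)
  have odd: "u (- x) = - u x" for x using u by (auto simp: is_odd_maximizer_def H2_per_odd_def)
  define L where "L = sqrt h"
  have h: "h > 0" "p > 0" using P by (auto simp: profile_def)
  then have L0: "L > 0" by (simp add: L_def)
  \<comment> \<open>The origin of the threshold 34: if L < 1, then L times the second moment is at
    most 2/3 + 16 < 17, so that 2 E \<le> 4 L^2 * 17 \<le> 68.\<close>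
  have L1: "L \<ge> 1"
  proof (rule ccontr)
    assume "\<not> L \<ge> 1"
    then have L: "L < 1" by simp
    let ?j = "ell_moment 2 (p / h)"
    have "\<bar>?j - 2/3\<bar> \<le> 2 * sqrt (p / h)"
      using h by (intro ell_moment_approx has_integral_cos_odd_powers) auto
    moreover have "L * sqrt (p / h) \<le> 8"
    proof -
      have "L * sqrt (p / h) = 4 * (ell_moment 0 (p / h) * sqrt (p / h))"
        unfolding L_def profile_relations(1)[OF P a] by (simp only: mult.assoc)
      moreover have "p / h > 0" using h by simp
      ultimately show ?thesis using ell_moment_0_le[of "p / h"] by linarith
    qed
    ultimately have j: "?j \<le> 2/3 + 2 * sqrt (p / h)" and Ls: "L * sqrt (p / h) \<le> 8" by linarith+
    have "L * ?j \<le> L * (2/3 + 2 * sqrt (p / h))" using j L0 by (intro mult_left_mono) auto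
    also have "\<dots> = L * (2/3) + 2 * (L * sqrt (p / h))" by (simp add: algebra_simps)
    also have "\<dots> \<le> 17" using Ls L by linarith
    finally have Lj: "L * ?j \<le> 17" .
    have "2 * E \<le> 4 * L ^ 3 * ?j" using profile_relations(3)[OF P a] zero_le_power2[of m] unfolding L_def by linarith
    also have "\<dots> = (4 * L\<^sup>2) * (L * ?j)" by (simp add: power3_eq_cube power2_eq_square)
    also have "\<dots> \<le> (4 * L\<^sup>2) * 17" using Lj by (intro mult_left_mono) auto
    also have "\<dots> \<le> (4 * 1) * 17" using L L0 power_le_one[of L 2] by simp
    finally show False using E by simp
  qed
  note est = profile_estimates[OF P a L1[unfolded L_def], folded L_def]
  have "\<bar>Kfun u - 2/3 * L ^ 2\<bar> \<le> 10000 * L"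
  proof -
    have m2: "m\<^sup>2 \<le> 4624 * L\<^sup>2"
      using power_mono[OF est(3,1), of 2] by (simp add: power_mult_distrib)
    have "2 * m\<^sup>2 / L \<le> 2 * (4624 * L\<^sup>2) / L" using m2 L0 by (intro divide_right_mono) auto
    then have 1: "\<bar>Kfun u - m\<^sup>2 / 24\<bar> \<le> 9248 * L"
      using profile_Kfun[OF P a w(1) odd, folded L_def] L0 by (simp add: power2_eq_square)
    have "\<bar>m\<^sup>2 / 24 - 2/3 * L\<^sup>2\<bar> = \<bar>m - 4 * L\<bar> * (m + 4 * L) / 24"
    proof -
      have eq: "m\<^sup>2 / 24 - 2/3 * L\<^sup>2 = (m - 4 * L) * (m + 4 * L) / 24" by (simp add: power2_eq_square field_simps)
      show ?thesis unfolding eq using est(1) L0 by (simp add: abs_mult)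
    qed
    also have "\<dots> \<le> 64 * (72 * L) / 24" using est(1-3) L0 by (intro divide_right_mono mult_mono) auto
    finally have "\<bar>m\<^sup>2 / 24 - 2/3 * L\<^sup>2\<bar> \<le> 192 * L" by simp
    with 1 L0 show ?thesis by linarith
  qed
  moreover have "Rfun u = objective w y"
  proof -
    have "H1 (\<lambda>x. - w x) (\<lambda>x. - y x)" using H1_cmult[of w y "-1"] a by (simp add: admissible_def)
    from functionals_H1(3)[OF w(1) this] show ?thesis by (simp add: objective_def)
  qed
  moreover have "\<bar>objective w y - 8/5 * L ^ 5\<bar> \<le> 400000 * L ^ 4"
    using profile_objective_estimate[OF P a L1[unfolded L_def]] by (simp add: L_def)
  ultimately show ?thesis using that[of L] L1 est(6) by simp
qed

text \<open>s solves the leading-order relation 2 E = 8/3 s^3 exactly. Dividing the error in the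
  cubes by L^2 gives |s - L| \<le> 3/8 * 4688 = 1758, so replacing L by s costs one power, as much
  as the error terms allow.\<close>

lemma odd_maximizer_asymptotics:
  assumes E: "E > 34" and u: "is_odd_maximizer E u" and s: "s > 0" "s ^ 3 = 3/4 * E"
  shows "\<bar>Kfun u - 2/3 * s ^ 2\<bar> \<le> 10 ^ 8 * s" "\<bar>Rfun u - 8/5 * s ^ 5\<bar> \<le> 10 ^ 19 * s ^ 4"
proof -
  obtain L where L: "L \<ge> 1" "\<bar>2 * E - 8/3 * L ^ 3\<bar> \<le> 4688 * L ^ 2"
    "\<bar>Kfun u - 2/3 * L ^ 2\<bar> \<le> 10000 * L" "\<bar>Rfun u - 8/5 * L ^ 5\<bar> \<le> 400000 * L ^ 4"
    by (rule odd_maximizer_estimates[OF E u])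
  have s1: "s \<ge> 1"
  proof (rule ccontr)
    assume "\<not> s \<ge> 1"
    then have "s ^ 3 \<le> 1" using s by (intro power_le_one) auto
    then show False using s E by simp
  qed
  have sL: "\<bar>s - L\<bar> \<le> 1758"
  proof -
    have "\<bar>s - L\<bar> * L\<^sup>2 \<le> \<bar>s - L\<bar> * (s\<^sup>2 + s * L + L\<^sup>2)"
      using s L by (intro mult_left_mono) auto
    also have "\<dots> = \<bar>(s - L) * (s\<^sup>2 + s * L + L\<^sup>2)\<bar>" using s L by (simp add: abs_mult)
    also have "(s - L) * (s\<^sup>2 + s * L + L\<^sup>2) = s ^ 3 - L ^ 3" by (simp add: power2_eq_square power3_eq_cube algebra_simps)
    also have "\<bar>s ^ 3 - L ^ 3\<bar> \<le> 1758 * L\<^sup>2" using L(2) s(2) by (simp add: abs_le_iff)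
    finally show ?thesis using L(1) by simp
  qed
  \<comment> \<open>A common bound for s and L: L \<le> s + 1758 \<le> 1759 s because s \<ge>
    1.\<close>
  define b where "b = 1759 * s"
  have b: "s \<le> b" "L \<le> b" "0 \<le> L" "0 \<le> s" "0 \<le> b" using sL s1 L(1) by (auto simp: b_def)
  have "\<bar>L\<^sup>2 - s\<^sup>2\<bar> = \<bar>s - L\<bar> * (L + s)"
    using b by (simp add: abs_mult[symmetric] power2_eq_square square_diff_square_factored) (simp add: abs_mult abs_minus_commute mult.commute)
  also have "\<dots> \<le> 1758 * (b + b)" using sL b by (intro mult_mono) auto
  finally have 1: "\<bar>L\<^sup>2 - s\<^sup>2\<bar> \<le> 3516 * b" by simp
  show "\<bar>Kfun u - 2/3 * s ^ 2\<bar> \<le> 10 ^ 8 * s"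
    using L(3) 1 b by (simp add: b_def)
  have "\<bar>L ^ 5 - s ^ 5\<bar> = \<bar>s - L\<bar> * (L ^ 4 + L ^ 3 * s + L ^ 2 * s ^ 2 + L * s ^ 3 + s ^ 4)"
  proof -
    have "L ^ 5 - s ^ 5 = - (s - L) * (L ^ 4 + L ^ 3 * s + L ^ 2 * s ^ 2 + L * s ^ 3 + s ^ 4)"
      by (simp add: numeral_eq_Suc algebra_simps)
    moreover have "0 \<le> L ^ 4 + L ^ 3 * s + L ^ 2 * s ^ 2 + L * s ^ 3 + s ^ 4" using b by simp
    ultimately show ?thesis by (simp only: abs_mult abs_minus_cancel abs_of_nonneg)
  qed
  also have "\<dots> \<le> 1758 * (b ^ 4 + b ^ 3 * b + b ^ 2 * b ^ 2 + b * b ^ 3 + b ^ 4)"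
    using sL b by (intro mult_mono add_mono power_mono) auto
  also have "\<dots> = 8790 * b ^ 4" by (simp add: numeral_eq_Suc)
  finally have 2: "\<bar>L ^ 5 - s ^ 5\<bar> \<le> 8790 * b ^ 4" .
  have 3: "L ^ 4 \<le> b ^ 4" using b by (intro power_mono) auto
  have 4: "b ^ 4 = 1759 ^ 4 * s ^ 4" by (simp add: b_def power_mult_distrib)
  \<comment> \<open>Here 414064 = 400000 + 8/5 * 8790; its product with 1759^4 is below
    10^19.\<close>
  have "\<bar>Rfun u - 8/5 * s ^ 5\<bar> \<le> 414064 * b ^ 4"
    using L(4) 2 3 by linarith
  also have "\<dots> \<le> 10 ^ 19 * s ^ 4" unfolding 4 using b by simp
  finally show "\<bar>Rfun u - 8/5 * s ^ 5\<bar> \<le> 10 ^ 19 * s ^ 4" .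
qed

theorem corollary1:
  shows "(\<forall>\<^sub>F \<E> in at_top. \<exists>!u. is_odd_maximizer \<E> u) \<and>
    (\<lambda>\<E>. Kfun (ustar \<E>) - 1 / 6 powr (1/3) * \<E> powr (2/3)) \<in> O[at_top](\<lambda>\<E>. \<E> powr (1/3)) \<and>
    (\<lambda>\<E>. Rfun (ustar \<E>) - 3 powr (5/3) / (5 * 2 powr (1/3)) * \<E> powr (5/3))
      \<in> O[at_top](\<lambda>\<E>. \<E> powr (4/3))"
proof (intro conjI)
  show "\<forall>\<^sub>F E in at_top. \<exists>!u. is_odd_maximizer E u"
    using eventually_gt_at_top[of 0] by eventually_elim (rule odd_maximizer_unique_exists)
  \<comment> \<open>For s = c E^(1/3) the condition s^3 = 3/4 E holds. The constants of the
    statement are therefore 2/3 c^2 and 8/5 c^5, identified below through their cubes 1/6 and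
    243/250.\<close>
  define c :: real where "c = (3/4) powr (1/3)"
  have c: "0 < c" "c \<le> 1" "c ^ 3 = 3/4"
    by (auto simp: c_def powr_le1 simp flip: powr_numeral powr_powr) (simp add: powr_powr)
  have pk: "(x powr (1/3)) ^ k = x powr (real k / 3)" if "x > 0" for x :: real and k
    using that by (simp add: powr_power)
  have c2: "2/3 * c\<^sup>2 = 1 / 6 powr (1/3)"
  proof -
    have "(2/3 * c\<^sup>2) ^ 3 = (1 / 6 powr (1/3)) ^ 3"
    proof -
      have "(2/3 * c\<^sup>2) ^ 3 = 8/27 * (c ^ 3)\<^sup>2" by (simp add: power_mult_distrib power3_eq_cube power2_eq_square)
      also have "\<dots> = 1/6" unfolding c(3) by (simp add: power2_eq_square)
      also have "\<dots> = (1 / 6 powr (1/3)) ^ 3" by (simp add: power_divide pk)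
      finally show ?thesis .
    qed
    then show ?thesis by (rule power_eq_imp_eq_base) (use c(1) in auto)
  qed
  have c5: "8/5 * c ^ 5 = 3 powr (5/3) / (5 * 2 powr (1/3))"
  proof -
    have "(8/5 * c ^ 5) ^ 3 = (3 powr (5/3) / (5 * 2 powr (1/3))) ^ 3"
    proof -
      have "(8/5 * c ^ 5) ^ 3 = 512/125 * (c ^ 3) ^ 5" by (simp add: power_mult_distrib numeral_eq_Suc)
      also have "\<dots> = 243 / 250" unfolding c(3) by (simp add: power_divide)
      also have "\<dots> = (3 powr (5/3) / (5 * 2 powr (1/3))) ^ 3"
        by (simp add: power_divide power_mult_distrib powr_power)
      finally show ?thesis .
    qed
    then show ?thesis by (rule power_eq_imp_eq_base) (use c(1) in auto)
  qed
  have main: "\<bar>Kfun (ustar E) - 1 / 6 powr (1/3) * E powr (2/3)\<bar> \<le> 10 ^ 8 * E powr (1/3)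
     \<and> \<bar>Rfun (ustar E) - 3 powr (5/3) / (5 * 2 powr (1/3)) * E powr (5/3)\<bar> \<le> 10 ^ 19 * E powr (4/3)"
    if E: "E > 34" for E :: real
  proof -
    have E0: "E > 0" using E by simp
    have u: "is_odd_maximizer E (ustar E)"
      unfolding ustar_def by (rule theI'[OF odd_maximizer_unique_exists[OF E0]])
    define r where "r = E powr (1/3)"
    have r: "r > 0" "\<And>k. r ^ k = E powr (real k / 3)" using E0 pk[OF E0] by (auto simp: r_def)
    have s: "c * r > 0" "(c * r) ^ 3 = 3/4 * E" using c r(1) r(2)[of 3] E0 by (auto simp: power_mult_distrib)
    note est = odd_maximizer_asymptotics[OF E u s]
    have "2/3 * (c * r)\<^sup>2 = 1 / 6 powr (1/3) * E powr (2/3)"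
      using r(2)[of 2] c2 by (simp add: power_mult_distrib flip: mult.assoc)
    moreover have "8/5 * (c * r) ^ 5 = 3 powr (5/3) / (5 * 2 powr (1/3)) * E powr (5/3)"
      using r(2)[of 5] c5 by (simp only: power_mult_distrib flip: mult.assoc) simp
    moreover have "10 ^ 8 * (c * r) \<le> 10 ^ 8 * E powr (1/3)"
      using c(1,2) r(1) by (simp add: r_def mult_left_le_one_le)
    moreover have "10 ^ 19 * (c * r) ^ 4 \<le> 10 ^ 19 * E powr (4/3)"
      using c(1,2) r(1) r(2)[of 4] power_le_one[of c 4] by (simp add: power_mult_distrib mult_left_le_one_le)
    ultimately show ?thesis using est by linarith
  qed
  show "(\<lambda>E. Kfun (ustar E) - 1 / 6 powr (1/3) * E powr (2/3)) \<in> O(\<lambda>E. E powr (1/3))"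
    by (rule bigoI[of _ "10 ^ 8"], rule eventually_mono[OF eventually_gt_at_top[of 34]]) (use main in auto)
  show "(\<lambda>E. Rfun (ustar E) - 3 powr (5/3) / (5 * 2 powr (1/3)) * E powr (5/3)) \<in> O(\<lambda>E. E powr (4/3))"
    by (rule bigoI[of _ "10 ^ 19"], rule eventually_mono[OF eventually_gt_at_top[of 34]]) (use main in auto)
qed

end
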